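(* Let $X$ be a compact complex $n$-dimensional Calabi-Yau $\partial\bar\partial$-manifold with a fixed non-vanishing holomorphic $n$-form $u$, and let $\omega$ be an SKT metric on $X$. Then the isomorphism $\widetilde{T_{[u]}}:H^{0,1}(X,T^{1,0}X)\to H^{n-1,1}_{BC}(X,\mathbb{C})$ restricts to an isomorphism $$\widetilde{T_{[u]}}:H^{0,1}(X,T^{1,0}X)_{[\omega]}\longrightarrow H^{n-1,1}_{BC,prim}(X,\mathbb{C}).$$
   Context: A compact complex manifold $X$ is a $\partial\bar\partial$-manifold if for every $d$-closed form of pure type, the properties of being $d$-exact, $\partial$-exact, $\bar\partial$-exact and $\partial\bar\partial$-exact are equivalent. It is Calabi-Yau if its canonical bundle is trivial. An SKT metric is a positive definite smooth $(1,1)$-form $\omega$ with $\partial\bar\partial\omega=0$. Cohomologies: $H^{p,q}_{BC}(X,\mathbb{C})=\frac{\ker\partial\cap\ker\bar\partial}{\mathrm{Im}\,\partial\bar\partial}$, $H^{p,q}_{\bar\partial}(X,\mathbb{C})=\frac{\ker\bar\partial}{\mathrm{Im}\,\bar\partial}$, $H^{p,q}_{A}(X,\mathbb{C})=\frac{\ker\partial\bar\partial}{\mathrm{Im}\,\partial+\mathrm{Im}\,\bar\partial}$ on smooth $(p,q)$-forms. On a $\partial\bar\partial$-manifold the canonical maps $H^{p,q}_{BC}\to H^{p,q}_{\bar\partial}\to H^{p,q}_A$ induced by the identity are isomorphisms. For an SKT metric $\omega$ on a $\partial\bar\partial$-manifold there is a smooth $(0,1)$-form $\alpha$ with $\bar\partial\omega=\partial\bar\partial\alpha$;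 then $\omega+\partial\alpha+\bar\partial\bar\alpha$ is a $d$-closed representative of the Aeppli class $[\omega]_A$. The Dolbeault class $[\omega]_{\bar\partial}:=[\omega+\partial\alpha]_{\bar\partial}\in H^{1,1}_{\bar\partial}(X,\mathbb{C})$ is the image of $[\omega]_A$ under the canonical isomorphism $H^{1,1}_A\cong H^{1,1}_{\bar\partial}$. For a $T^{1,0}X$-valued $(0,1)$-form $\theta$ and a form $\beta$, $\theta\lrcorner\beta$ is the contraction of $\beta$ by the vector field component of $\theta$ combined with multiplication by the $(0,1)$-form component. Define $$H^{0,1}(X,T^{1,0}X)_{[\omega]}:=\{[\theta]\in H^{0,1}(X,T^{1,0}X)\mid[\theta\lrcorner\zeta]_{\bar\partial}=0\in H^{0,2}_{\bar\partial}(X,\mathbb{C})\},$$ where $\zeta$ is any representative of $[\omega]_{\bar\partial}$ (this does not depend on choices). The map $\widetilde{T_{[u]}}$ is the composition of the Calabi-Yau isomorphism $H^{0,1}(X,T^{1,0}X)\to H^{n-1,1}_{\bar\partial}(X,\mathbb{C})$, $[\theta]\mapsto[\theta\lrcorner u]_{\bar\partial}$, with the canonical isomorphism $H^{n-1,1}_{\bar\partial}\cong H^{n-1,1}_{BC}$. Explicitly, $\widetilde{T_{[u]}}([\theta])=[\theta\lrcorner u+\bar\partial\eta]_{BC}$ for any $(n-1,0)$-form $\eta$ such that $\partial(\theta\lrcorner u+\bar\partial\eta)=0$. The map $L_{[\omega]}:H^{p,q}_{BC}(X,\mathbb{C})\to H^{p+1,q+1}_A(X,\mathbb{C})$, $[\gamma]_{BC}\mapsto[\omega\wedge\gamma]_A$,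 is well defined, and $H^{n-1,1}_{BC,prim}(X,\mathbb{C}):=\ker\big(L_{[\omega]}:H^{n-1,1}_{BC}(X,\mathbb{C})\to H^{n,2}_A(X,\mathbb{C})\big)$ is the space of ($[\omega]_A$-)primitive Bott-Chern classes of bidegree $(n-1,1)$. *)

theory Defs
  imports "HOL-Analysis.Analysis" "HOL-Library.Function_Algebras"
begin

section \<open>Complex manifolds\<close>

primrec Ck_on :: "nat \<Rightarrow> 'v::real_normed_vector set \<Rightarrow> ('v \<Rightarrow> 'w::real_normed_vector) \<Rightarrow> bool" where
  "Ck_on 0 S f \<longleftrightarrow> continuous_on S f"
| "Ck_on (Suc k) S f \<longleftrightarrow>
     (\<forall>x\<in>S. f differentiable (at x)) \<and> (\<forall>v. Ck_on k S (\<lambda>x. frechet_derivative f (at x) v))"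

text \<open>Only used for open \<open>S\<close>.\<close>
definition smooth_on :: "'v::real_normed_vector set \<Rightarrow> ('v \<Rightarrow> 'w::real_normed_vector) \<Rightarrow> bool" where
  "smooth_on S f \<longleftrightarrow> (\<forall>k. Ck_on k S f)"

text \<open>The Wirtinger derivatives
  \<open>\<partial>/\<partial>z\<^sub>k = (\<partial>/\<partial>x\<^sub>k - \<i> \<partial>/\<partial>y\<^sub>k) / 2\<close> and \<open>\<partial>/\<partial>zbar\<^sub>k = (\<partial>/\<partial>x\<^sub>k + \<i> \<partial>/\<partial>y\<^sub>k) / 2\<close>.\<close>

definition wirt :: "'n::finite \<Rightarrow> (complex^'n \<Rightarrow> complex^'i::finite) \<Rightarrow> complex^'n \<Rightarrow> complex^'i" where
  "wirt k f z = (1/2) *s (frechet_derivative f (at z) (axis k 1)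
                          - \<i> *s frechet_derivative f (at z) (axis k \<i>))"

definition wirtbar :: "'n::finite \<Rightarrow> (complex^'n \<Rightarrow> complex^'i::finite) \<Rightarrow> complex^'n \<Rightarrow> complex^'i" where
  "wirtbar k f z = (1/2) *s (frechet_derivative f (at z) (axis k 1)
                             + \<i> *s frechet_derivative f (at z) (axis k \<i>))"

definition holomorphic_map_on :: "(complex^'n::finite) set \<Rightarrow> (complex^'n \<Rightarrow> complex^'m::finite) \<Rightarrow> bool" where
  "holomorphic_map_on S f \<longleftrightarrow> smooth_on S f \<and> (\<forall>z\<in>S. \<forall>k. wirtbar k f z = 0)"

type_synonym 'n cspace = "complex^'n"

type_synonym ('a, 'n) chart = "'a set \<times> ('a \<Rightarrow> complex^'n)"

definition chart_image :: "('a, 'n::finite) chart \<Rightarrow> (complex^'n) set" where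
  "chart_image c = snd c ` fst c"

definition overlap :: "('a, 'n::finite) chart \<Rightarrow> ('a, 'n) chart \<Rightarrow> (complex^'n) set" where
  "overlap c c' = snd c ` (fst c \<inter> fst c')"

text \<open>Coordinate change from the coordinates of \<open>c\<close> to those of \<open>c'\<close>, meaningful on \<open>overlap c c'\<close>.\<close>
definition transition :: "('a, 'n::finite) chart \<Rightarrow> ('a, 'n) chart \<Rightarrow> complex^'n \<Rightarrow> complex^'n" where
  "transition c c' = snd c' \<circ> inv_into (fst c) (snd c)"

definition complex_manifold :: "'a topology \<Rightarrow> ('a, 'n::finite) chart set \<Rightarrow> bool" where
  "complex_manifold X A \<longleftrightarrow>
     Hausdorff_space X \<and> second_countable X \<and> topspace X = (\<Union>c\<in>A. fst c) \<and>
     (\<forall>c\<in>A. openin X (fst c) \<and> open (chart_image c) \<and>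
        homeomorphic_map (subtopology X (fst c)) (top_of_set (chart_image c)) (snd c)) \<and>
     (\<forall>c\<in>A. \<forall>c'\<in>A. holomorphic_map_on (overlap c c') (transition c c'))"

section \<open>Exterior algebra of \<open>\<complex>\<^sup>n\<close>\<close>

text \<open>An element of the exterior algebra on \<open>dz\<^sub>k, dzbar\<^sub>k\<close> is given by its coefficients:
  the entry \<open>(I, J)\<close> is the coefficient of \<open>dz\<^sub>I \<and> dzbar\<^sub>J\<close>, where \<open>dz\<^sub>I\<close> and \<open>dzbar\<^sub>J\<close> are the
  wedge products in increasing order of the indices.\<close>
type_synonym 'n ext = "complex^('n set \<times> 'n set)"

definition shuffle_sign :: "'n::linorder set \<Rightarrow> 'n set \<Rightarrow> complex" where
  "shuffle_sign K L = (-1) ^ card {(k, l). k \<in> K \<and> l \<in> L \<and> l < k}"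

text \<open>The factor \<open>(-1) ^ (card L * card (I - K))\<close> comes from moving \<open>dz\<^sub>I\<^sub>-\<^sub>K\<close> past \<open>dzbar\<^sub>L\<close>.\<close>
definition wedge :: "'n::{finite,linorder} ext \<Rightarrow> 'n ext \<Rightarrow> 'n ext" where
  "wedge a b = vec_lambda (\<lambda>(I, J). \<Sum>K\<in>Pow I. \<Sum>L\<in>Pow J.
     (-1) ^ (card L * card (I - K)) * shuffle_sign K (I - K) * shuffle_sign L (J - L)
       * a $ (K, L) * b $ (I - K, J - L))"

definition ext_one :: "'n::finite ext" where
  "ext_one = axis ({}, {}) 1"

definition dz :: "'n::finite \<Rightarrow> 'n ext" where
  "dz k = axis ({k}, {}) 1"

definition dzbar :: "'n::finite \<Rightarrow> 'n ext" where
  "dzbar k = axis ({}, {k}) 1"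

text \<open>Contraction with \<open>\<partial>/\<partial>z\<^sub>k\<close>, using \<open>dz\<^sub>I\<^sub>\<union>\<^sub>{\<^sub>k\<^sub>} = shuffle_sign {k} I dz\<^sub>k \<and> dz\<^sub>I\<close>.\<close>
definition interior_dz :: "('n::{finite,linorder}) \<Rightarrow> 'n ext \<Rightarrow> 'n ext" where
  "interior_dz k b = vec_lambda (\<lambda>(I, J). if k \<in> I then 0 else shuffle_sign {k} I * b $ (insert k I, J))"

text \<open>Pullback at \<open>z\<close> under a holomorphic map \<open>\<tau>\<close>: \<open>dz\<^sub>i\<close> and \<open>dzbar\<^sub>i\<close> are replaced by
  the differentials of \<open>\<tau>\<^sub>i\<close> and of its conjugate.\<close>
definition pullback :: "('n::{finite,linorder} cspace \<Rightarrow> 'n cspace) \<Rightarrow> 'n cspace \<Rightarrow> 'n ext \<Rightarrow> 'n ext" where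
  "pullback \<tau> z a =
     (let d\<tau> = (\<lambda>i. \<Sum>j\<in>UNIV. (wirt j \<tau> z $ i) *s dz j);
          d\<tau>bar = (\<lambda>i. \<Sum>j\<in>UNIV. cnj (wirt j \<tau> z $ i) *s dzbar j);
          wedges = (\<lambda>\<eta> I. foldr wedge (map \<eta> (sorted_list_of_set I)) ext_one)
      in \<Sum>(I, J)\<in>UNIV. (a $ (I, J)) *s wedge (wedges d\<tau> I) (wedges d\<tau>bar J))"

section \<open>Differential forms\<close>

text \<open>A form (or a \<open>T\<^sup>1\<^sup>,\<^sup>0\<close>-valued form) on a manifold is the family of its local expressions in the
  charts of the atlas. For uniqueness these are \<open>0\<close> outside the chart images and the atlas.\<close>

type_synonym ('a, 'n, 'i) family = "('a, 'n) chart \<Rightarrow> complex^'n \<Rightarrow> complex^'i"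
type_synonym ('a, 'n) form = "('a, 'n, 'n set \<times> 'n set) family"

definition smooth_family :: "('a, 'n::finite) chart set \<Rightarrow> ('a, 'n, 'i::finite) family \<Rightarrow> bool" where
  "smooth_family A \<alpha> \<longleftrightarrow>
     (\<forall>c z. c \<notin> A \<or> z \<notin> chart_image c \<longrightarrow> \<alpha> c z = 0) \<and> (\<forall>c\<in>A. smooth_on (chart_image c) (\<alpha> c))"

definition smooth_form :: "('a, 'n::{finite,linorder}) chart set \<Rightarrow> ('a, 'n) form \<Rightarrow> bool" where
  "smooth_form A \<alpha> \<longleftrightarrow> smooth_family A \<alpha> \<and>
     (\<forall>c\<in>A. \<forall>c'\<in>A. \<forall>z\<in>overlap c c'.
        \<alpha> c z = pullback (transition c c') z (\<alpha> c' (transition c c' z)))"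

text \<open>Degrees are integers, so that there are no nonzero forms of negative degree.\<close>

definition kforms :: "('a, 'n::{finite,linorder}) chart set \<Rightarrow> int \<Rightarrow> ('a, 'n) form set" where
  "kforms A k = {\<alpha>. smooth_form A \<alpha> \<and>
     (\<forall>c z I J. \<alpha> c z $ (I, J) \<noteq> 0 \<longrightarrow> int (card I) + int (card J) = k)}"

definition forms :: "('a, 'n::{finite,linorder}) chart set \<Rightarrow> int \<Rightarrow> int \<Rightarrow> ('a, 'n) form set" where
  "forms A p q = {\<alpha>. smooth_form A \<alpha> \<and>
     (\<forall>c z I J. \<alpha> c z $ (I, J) \<noteq> 0 \<longrightarrow> int (card I) = p \<and> int (card J) = q)}"

definition local_del :: "('n::{finite,linorder} cspace \<Rightarrow> 'n ext) \<Rightarrow> 'n cspace \<Rightarrow> 'n ext" where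
  "local_del f z = (\<Sum>k\<in>UNIV. wedge (dz k) (wirt k f z))"

definition local_delbar :: "('n::{finite,linorder} cspace \<Rightarrow> 'n ext) \<Rightarrow> 'n cspace \<Rightarrow> 'n ext" where
  "local_delbar f z = (\<Sum>k\<in>UNIV. wedge (dzbar k) (wirtbar k f z))"

definition del :: "('a, 'n::{finite,linorder}) chart set \<Rightarrow> ('a, 'n) form \<Rightarrow> ('a, 'n) form" where
  "del A \<alpha> = (\<lambda>c z. if c \<in> A \<and> z \<in> chart_image c then local_del (\<alpha> c) z else 0)"

definition delbar :: "('a, 'n::{finite,linorder}) chart set \<Rightarrow> ('a, 'n) form \<Rightarrow> ('a, 'n) form" where
  "delbar A \<alpha> = (\<lambda>c z. if c \<in> A \<and> z \<in> chart_image c then local_delbar (\<alpha> c) z else 0)"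

definition ext_d :: "('a, 'n::{finite,linorder}) chart set \<Rightarrow> ('a, 'n) form \<Rightarrow> ('a, 'n) form" where
  "ext_d A \<alpha> = del A \<alpha> + delbar A \<alpha>"

definition form_wedge :: "('a, 'n::{finite,linorder}) form \<Rightarrow> ('a, 'n) form \<Rightarrow> ('a, 'n) form" where
  "form_wedge \<alpha> \<beta> = (\<lambda>c z. wedge (\<alpha> c z) (\<beta> c z))"

section \<open>\<open>T\<^sup>1\<^sup>,\<^sup>0\<close>-valued forms\<close>

text \<open>The local expression of \<open>\<theta> = \<Sum>\<^sub>i \<theta>\<^sup>i \<otimes> \<partial>/\<partial>z\<^sub>i\<close> has at \<open>(i, I, J)\<close> the coefficient \<open>(I, J)\<close>
  of the form \<open>\<theta>\<^sup>i\<close>.\<close>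
type_synonym ('a, 'n) vform = "('a, 'n, 'n \<times> 'n set \<times> 'n set) family"

definition vcomp :: "'n::finite \<Rightarrow> complex^('n \<times> 'n set \<times> 'n set) \<Rightarrow> 'n ext" where
  "vcomp i t = (\<chi> P. t $ (i, P))"

text \<open>In the transformation law, \<open>\<partial>/\<partial>z\<^sub>i = \<Sum>\<^sub>k (\<partial>\<tau>\<^sub>k/\<partial>z\<^sub>i) \<partial>/\<partial>w\<^sub>k\<close> for the coordinate change \<open>w = \<tau>(z)\<close>.\<close>
definition vforms :: "('a, 'n::{finite,linorder}) chart set \<Rightarrow> int \<Rightarrow> int \<Rightarrow> ('a, 'n) vform set" where
  "vforms A p q = {\<theta>. smooth_family A \<theta> \<and>
     (\<forall>c\<in>A. \<forall>c'\<in>A. \<forall>z\<in>overlap c c'. \<forall>k.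
        (\<Sum>i\<in>UNIV. (wirt i (transition c c') z $ k) *s vcomp i (\<theta> c z))
          = pullback (transition c c') z (vcomp k (\<theta> c' (transition c c' z)))) \<and>
     (\<forall>c z i I J. \<theta> c z $ (i, I, J) \<noteq> 0 \<longrightarrow> int (card I) = p \<and> int (card J) = q)}"

definition vdelbar :: "('a, 'n::{finite,linorder}) chart set \<Rightarrow> ('a, 'n) vform \<Rightarrow> ('a, 'n) vform" where
  "vdelbar A \<theta> = (\<lambda>c z. if c \<in> A \<and> z \<in> chart_image c
     then vec_lambda (\<lambda>(i, P). local_delbar (\<lambda>w. vcomp i (\<theta> c w)) z $ P) else 0)"

text \<open>\<open>\<theta> \<lrcorner> \<beta> = \<Sum>\<^sub>i \<theta>\<^sup>i \<and> (\<partial>/\<partial>z\<^sub>i \<lrcorner> \<beta>)\<close>\<close>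
definition contract :: "('a, 'n::{finite,linorder}) vform \<Rightarrow> ('a, 'n) form \<Rightarrow> ('a, 'n) form" where
  "contract \<theta> \<beta> = (\<lambda>c z. \<Sum>i\<in>UNIV. wedge (vcomp i (\<theta> c z)) (interior_dz i (\<beta> c z)))"

section \<open>Quotient spaces\<close>

text \<open>The elements of a quotient \<open>Z / B\<close> are the cosets \<open>x +o B\<close>; sums of cosets are the
  elementwise sums of sets.\<close>

definition quotient_space :: "('v::plus) set \<Rightarrow> 'v set \<Rightarrow> 'v set set" where
  "quotient_space Z B = (\<lambda>x. x +o B) ` Z"

definition family_scale :: "complex \<Rightarrow> ('a, 'n, 'i::finite) family \<Rightarrow> ('a, 'n, 'i) family" where
  "family_scale k \<alpha> = (\<lambda>c z. k *s \<alpha> c z)"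

text \<open>Adding \<open>B\<close> matters only for \<open>k = 0\<close>.\<close>
definition coset_scale :: "('a, 'n, 'i::finite) family set \<Rightarrow> complex \<Rightarrow>
    ('a, 'n, 'i) family set \<Rightarrow> ('a, 'n, 'i) family set" where
  "coset_scale B k C = family_scale k ` C + B"

text \<open>\<open>H\<close> is a complex vector space of cosets of \<open>B\<close>, whose zero is the coset \<open>B\<close>.\<close>
definition coset_vector_space :: "('a, 'n, 'i::finite) family set \<Rightarrow> ('a, 'n, 'i) family set set \<Rightarrow> bool" where
  "coset_vector_space B H \<longleftrightarrow> B \<in> H \<and> (\<forall>C\<in>H. \<exists>x. C = x +o B) \<and>
     (\<forall>C\<in>H. \<forall>D\<in>H. C + D \<in> H) \<and> (\<forall>k. \<forall>C\<in>H. coset_scale B k C \<in> H)"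

definition linear_isomorphism ::
  "('a, 'n, 'i::finite) family set \<Rightarrow> ('a, 'n, 'i) family set set \<Rightarrow>
   ('a, 'n, 'j::finite) family set \<Rightarrow> ('a, 'n, 'j) family set set \<Rightarrow>
   (('a, 'n, 'i) family set \<Rightarrow> ('a, 'n, 'j) family set) \<Rightarrow> bool" where
  "linear_isomorphism B H B' H' f \<longleftrightarrow>
     coset_vector_space B H \<and> coset_vector_space B' H' \<and> bij_betw f H H' \<and>
     (\<forall>C\<in>H. \<forall>D\<in>H. f (C + D) = f C + f D) \<and>
     (\<forall>k. \<forall>C\<in>H. f (coset_scale B k C) = coset_scale B' k (f C))"

text \<open>The map \<open>[x] \<mapsto> [f x]\<close> into a quotient by \<open>B'\<close>: if \<open>f\<close> is linear and maps \<open>B\<close> into \<open>B'\<close>, then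
  \<open>f ` (x +o B) + B' = f x +o B'\<close>.\<close>
definition induced_map :: "('w::plus) set \<Rightarrow> ('v \<Rightarrow> 'w) \<Rightarrow> 'v set \<Rightarrow> 'w set" where
  "induced_map B' f C = f ` C + B'"

section \<open>Cohomology\<close>

definition BC_exact :: "('a, 'n::{finite,linorder}) chart set \<Rightarrow> int \<Rightarrow> int \<Rightarrow> ('a, 'n) form set" where
  "BC_exact A p q = (\<lambda>\<beta>. del A (delbar A \<beta>)) ` forms A (p - 1) (q - 1)"

definition H_BC :: "('a, 'n::{finite,linorder}) chart set \<Rightarrow> int \<Rightarrow> int \<Rightarrow> ('a, 'n) form set set" where
  "H_BC A p q = quotient_space {\<alpha> \<in> forms A p q. del A \<alpha> = 0 \<and> delbar A \<alpha> = 0} (BC_exact A p q)"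

definition delbar_exact :: "('a, 'n::{finite,linorder}) chart set \<Rightarrow> int \<Rightarrow> int \<Rightarrow> ('a, 'n) form set" where
  "delbar_exact A p q = delbar A ` forms A p (q - 1)"

definition H_delbar :: "('a, 'n::{finite,linorder}) chart set \<Rightarrow> int \<Rightarrow> int \<Rightarrow> ('a, 'n) form set set" where
  "H_delbar A p q = quotient_space {\<alpha> \<in> forms A p q. delbar A \<alpha> = 0} (delbar_exact A p q)"

definition A_exact :: "('a, 'n::{finite,linorder}) chart set \<Rightarrow> int \<Rightarrow> int \<Rightarrow> ('a, 'n) form set" where
  "A_exact A p q = del A ` forms A (p - 1) q + delbar A ` forms A p (q - 1)"

definition H_A :: "('a, 'n::{finite,linorder}) chart set \<Rightarrow> int \<Rightarrow> int \<Rightarrow> ('a, 'n) form set set" where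
  "H_A A p q = quotient_space {\<alpha> \<in> forms A p q. del A (delbar A \<alpha>) = 0} (A_exact A p q)"

definition T_exact :: "('a, 'n::{finite,linorder}) chart set \<Rightarrow> int \<Rightarrow> ('a, 'n) vform set" where
  "T_exact A q = vdelbar A ` vforms A 0 (q - 1)"

text \<open>\<open>H\<^sup>0\<^sup>,\<^sup>q(X, T\<^sup>1\<^sup>,\<^sup>0X)\<close>\<close>
definition H_T :: "('a, 'n::{finite,linorder}) chart set \<Rightarrow> int \<Rightarrow> ('a, 'n) vform set set" where
  "H_T A q = quotient_space {\<theta> \<in> vforms A 0 q. vdelbar A \<theta> = 0} (T_exact A q)"

definition ddbar_manifold :: "('a, 'n::{finite,linorder}) chart set \<Rightarrow> bool" where
  "ddbar_manifold A \<longleftrightarrow> (\<forall>p q. \<forall>\<alpha> \<in> forms A p q. ext_d A \<alpha> = 0 \<longrightarrow>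
     (\<alpha> \<in> ext_d A ` kforms A (p + q - 1) \<longleftrightarrow> \<alpha> \<in> del A ` forms A (p - 1) q) \<and>
     (\<alpha> \<in> del A ` forms A (p - 1) q \<longleftrightarrow> \<alpha> \<in> delbar A ` forms A p (q - 1)) \<and>
     (\<alpha> \<in> delbar A ` forms A p (q - 1) \<longleftrightarrow>
        \<alpha> \<in> (\<lambda>\<beta>. del A (delbar A \<beta>)) ` forms A (p - 1) (q - 1)))"

section \<open>SKT metrics on Calabi-Yau manifolds\<close>

text \<open>A form \<open>u\<close> as below exists iff the canonical bundle is trivial.\<close>
definition nonvanishing_holomorphic_volume_form ::
  "('a, 'n::{finite,linorder}) chart set \<Rightarrow> ('a, 'n) form \<Rightarrow> bool" where
  "nonvanishing_holomorphic_volume_form A u \<longleftrightarrow>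
     u \<in> forms A (int CARD('n)) 0 \<and> delbar A u = 0 \<and> (\<forall>c\<in>A. \<forall>z\<in>chart_image c. u c z \<noteq> 0)"

text \<open>\<open>\<omega> = \<i> \<Sum>\<^sub>j\<^sub>k h\<^sub>j\<^sub>k dz\<^sub>j \<and> dzbar\<^sub>k\<close> is positive definite iff the matrix \<open>h\<close> is Hermitian positive
  definite, i.e. iff \<open>\<Sum>\<^sub>j\<^sub>k h\<^sub>j\<^sub>k v\<^sub>j vbar\<^sub>k\<close> is real and positive for all \<open>v \<noteq> 0\<close>.\<close>
definition positive_definite :: "('a, 'n::{finite,linorder}) chart set \<Rightarrow> ('a, 'n) form \<Rightarrow> bool" where
  "positive_definite A \<omega> \<longleftrightarrow> (\<forall>c\<in>A. \<forall>z\<in>chart_image c. \<forall>v. v \<noteq> 0 \<longrightarrow>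
     (let h = (\<Sum>j\<in>UNIV. \<Sum>k\<in>UNIV. - \<i> * \<omega> c z $ ({j}, {k}) * v $ j * cnj (v $ k))
      in h \<in> \<real> \<and> 0 < Re h))"

definition SKT_metric :: "('a, 'n::{finite,linorder}) chart set \<Rightarrow> ('a, 'n) form \<Rightarrow> bool" where
  "SKT_metric A \<omega> \<longleftrightarrow> \<omega> \<in> forms A 1 1 \<and> positive_definite A \<omega> \<and> del A (delbar A \<omega>) = 0"

text \<open>The set of all representatives of \<open>[\<omega> + \<partial>\<alpha>]\<close>, where \<open>\<alpha>\<close> ranges over the \<open>(0,1)\<close>-forms with
  \<open>\<partial>bar \<omega> = \<partial> \<partial>bar \<alpha>\<close>; on a \<open>\<partial>\<partial>bar\<close>-manifold the class does not depend on \<open>\<alpha>\<close>.\<close>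
definition SKT_delbar_class :: "('a, 'n::{finite,linorder}) chart set \<Rightarrow> ('a, 'n) form \<Rightarrow> ('a, 'n) form set" where
  "SKT_delbar_class A \<omega> =
     (\<Union>\<alpha>\<in>{\<alpha> \<in> forms A 0 1. delbar A \<omega> = del A (delbar A \<alpha>)}. (\<omega> + del A \<alpha>) +o delbar_exact A 1 1)"

text \<open>\<open>H\<^sup>0\<^sup>,\<^sup>1(X, T\<^sup>1\<^sup>,\<^sup>0X)\<^bsub>[\<omega>]\<^esub>\<close>\<close>
definition H_T_polarised :: "('a, 'n::{finite,linorder}) chart set \<Rightarrow> ('a, 'n) form \<Rightarrow> ('a, 'n) vform set set" where
  "H_T_polarised A \<omega> = {C \<in> H_T A 1. \<forall>\<theta>\<in>C. \<forall>\<zeta>\<in>SKT_delbar_class A \<omega>.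
     contract \<theta> \<zeta> +o delbar_exact A 0 2 = 0 +o delbar_exact A 0 2}"

definition canonical_BC_delbar :: "('a, 'n::{finite,linorder}) chart set \<Rightarrow> int \<Rightarrow> int \<Rightarrow>
    ('a, 'n) form set \<Rightarrow> ('a, 'n) form set" where
  "canonical_BC_delbar A p q = induced_map (delbar_exact A p q) (\<lambda>\<alpha>. \<alpha>)"

definition calabi_yau_map :: "('a, 'n::{finite,linorder}) chart set \<Rightarrow> ('a, 'n) form \<Rightarrow>
    ('a, 'n) vform set \<Rightarrow> ('a, 'n) form set" where
  "calabi_yau_map A u = induced_map (delbar_exact A (int CARD('n) - 1) 1) (\<lambda>\<theta>. contract \<theta> u)"

definition T_tilde :: "('a, 'n::{finite,linorder}) chart set \<Rightarrow> ('a, 'n) form \<Rightarrow>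
    ('a, 'n) vform set \<Rightarrow> ('a, 'n) form set" where
  "T_tilde A u =
     inv_into (H_BC A (int CARD('n) - 1) 1) (canonical_BC_delbar A (int CARD('n) - 1) 1)
       \<circ> calabi_yau_map A u"

text \<open>\<open>L\<^bsub>[\<omega>]\<^esub>\<close> on \<open>H\<^sub>B\<^sub>C\<^sup>p\<^sup>,\<^sup>q\<close>\<close>
definition lefschetz :: "('a, 'n::{finite,linorder}) chart set \<Rightarrow> ('a, 'n) form \<Rightarrow> int \<Rightarrow> int \<Rightarrow>
    ('a, 'n) form set \<Rightarrow> ('a, 'n) form set" where
  "lefschetz A \<omega> p q = induced_map (A_exact A (p + 1) (q + 1)) (form_wedge \<omega>)"

definition H_BC_prim :: "('a, 'n::{finite,linorder}) chart set \<Rightarrow> ('a, 'n) form \<Rightarrow> ('a, 'n) form set set" where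
  "H_BC_prim A \<omega> = {C \<in> H_BC A (int CARD('n) - 1) 1.
     lefschetz A \<omega> (int CARD('n) - 1) 1 C = 0 +o A_exact A (int CARD('n)) 2}"

end

theory Submission
  imports Defs
begin

text \<open>
  The map \<^const>\<open>T_tilde\<close> is the Calabi-Yau map \<open>[\<theta>] \<mapsto> [\<theta> \<lrcorner> u]\<close> followed by the inverse of the canonical map from
  Bott-Chern to Dolbeault cohomology. The Calabi-Yau map is an isomorphism already before passing to
  cohomology: as \<open>u\<close> has no zeros, contraction of \<open>u\<close> is a bijection of \<open>T\<^sup>1\<^sup>,\<^sup>0\<close>-valued \<open>(0, q)\<close>-forms onto
  \<open>(n - 1, q)\<close>-forms (\<open>contract_u_surj\<close>, \<open>contract_u_cancel\<close>), and as \<open>\<partial>bar u = 0\<close>, it commutes with \<open>\<partial>bar\<close>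
  (\<open>contract_vdelbar\<close>). That the canonical map is an isomorphism is the \<open>\<partial>\<partial>bar\<close>-property
  (\<open>canonical_BC_delbar_iso\<close>).

  For the restricted map, let \<open>\<zeta> = \<omega> + \<partial>\<alpha> + \<partial>bar \<beta>\<close> be a \<open>\<partial>bar\<close>-closed representative of the class of \<open>\<omega>\<close>, and let
  \<open>\<gamma> = \<theta> \<lrcorner> u + \<partial>bar \<eta>\<close> be a \<open>d\<close>-closed representative of the image of \<open>[\<theta>]\<close>. By the Leibniz rule
  \<open>\<omega> \<and> \<gamma>\<close> and \<open>\<zeta> \<and> (\<theta> \<lrcorner> u)\<close> have the same Aeppli class. Now \<open>\<zeta> \<and> u\<close> has bidegree \<open>(n + 1, 1)\<close>, so it vanishes,
  and \<open>\<theta> \<lrcorner> _\<close> is a derivation; thus \<open>\<zeta> \<and> (\<theta> \<lrcorner> u) = - u \<and> (\<theta> \<lrcorner> \<zeta>)\<close> (\<open>form_wedge_contract\<close>). On a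
  \<open>\<partial>\<partial>bar\<close>-manifold this \<open>\<partial>bar\<close>-closed form is zero in Aeppli cohomology iff it is \<open>\<partial>bar\<close>-exact
  (\<open>A_exact_imp_delbar_exact\<close>), and division by the holomorphic form \<open>u\<close> turns this into the \<open>\<partial>bar\<close>-exactness of
  \<open>\<theta> \<lrcorner> \<zeta>\<close> (\<open>form_wedge_u_delbar_exact_iff\<close>). Hence \<open>\<gamma>\<close> is primitive iff \<open>\<theta>\<close> satisfies the condition of
  \<^const>\<open>H_T_polarised\<close>, for every choice of \<open>\<theta>\<close> and \<open>\<zeta>\<close> in their classes (\<open>wedge_omega_exact_iff\<close>). So the
  polarised classes are the preimage of the primitive ones.

  Most of the text builds the calculus of forms on which this rests. Pointwise, pullback is an algebra
  homomorphism (\<open>ext_subst_wedge\<close>) and intertwines contractions (\<open>interior_ext_subst\<close>); both are proved by induction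
  over products of the generators \<open>dz\<^sub>k\<close>, \<open>dzbar\<^sub>k\<close>. Analytically, the symmetry of second derivatives gives
  \<open>\<partial>\<partial> = 0\<close>, \<open>\<partial>bar \<partial>bar = 0\<close>, \<open>\<partial>\<partial>bar = - \<partial>bar \<partial>\<close> and, together with the chain rule, the compatibility of
  \<open>\<partial>\<close> and \<open>\<partial>bar\<close> with holomorphic coordinate changes (\<open>local_dd_pullback\<close>), so that both operators act on
  global forms.
\<close>

section \<open>Exterior algebra in coordinates\<close>

lemma wedge_add_left: "wedge (a + b) c = wedge a c + wedge b c"
  by (simp add: wedge_def vec_eq_iff sum.distrib algebra_simps)

lemma wedge_add_right: "wedge a (b + c) = wedge a b + wedge a c"
  by (simp add: wedge_def vec_eq_iff sum.distrib algebra_simps)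

lemma wedge_scale_left: "wedge (k *s a) b = k *s wedge a b"
  by (simp add: wedge_def vec_eq_iff sum_distrib_left algebra_simps)

lemma wedge_scale_right: "wedge a (k *s b) = k *s wedge a b"
  by (simp add: wedge_def vec_eq_iff sum_distrib_left algebra_simps)

lemma wedge_zero_left [simp]: "wedge 0 b = 0"
  by (simp add: wedge_def vec_eq_iff)

lemma wedge_zero_right [simp]: "wedge a 0 = 0"
  by (simp add: wedge_def vec_eq_iff)

lemma wedge_minus_left: "wedge (- a) b = - wedge a b"
  using wedge_scale_left[of "-1" a b] by simp

lemma wedge_minus_right: "wedge a (- b) = - wedge a b"
  using wedge_scale_right[of a "-1" b] by simp

lemma wedge_diff_left: "wedge (a - b) c = wedge a c - wedge b c"
  by (metis add_uminus_conv_diff wedge_add_left wedge_minus_left)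

lemma wedge_diff_right: "wedge c (a - b) = wedge c a - wedge c b"
  by (metis add_uminus_conv_diff wedge_add_right wedge_minus_right)

lemma wedge_sum_left: "wedge (sum f S) b = (\<Sum>i\<in>S. wedge (f i) b)"
  by (induction S rule: infinite_finite_induct) (auto simp: wedge_add_left)

lemma wedge_sum_right: "wedge b (sum f S) = (\<Sum>i\<in>S. wedge b (f i))"
  by (induction S rule: infinite_finite_induct) (auto simp: wedge_add_right)

lemmas wedge_linear = wedge_add_left wedge_add_right wedge_scale_left wedge_scale_right
  wedge_minus_left wedge_minus_right wedge_sum_left wedge_sum_right

lemma ext_basis_induct [case_names basis add scale]:
  fixes a :: "complex^'i::finite"
  assumes "\<And>S. P (axis S 1)" and "\<And>a b. P a \<Longrightarrow> P b \<Longrightarrow> P (a + b)" and "\<And>k a. P a \<Longrightarrow> P (k *s a)"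
  shows "P a"
proof -
  have P0: "P 0"
    using assms(3)[OF assms(1), of 0] by simp
  have "P (\<Sum>i\<in>S. (a $ i) *s axis i 1)" for S :: "'i set"
    by (induction S rule: infinite_finite_induct) (simp_all add: P0 assms)
  from this[of UNIV] show ?thesis
    by (simp add: basis_expansion)
qed

text \<open>The sign of \<open>dz\<^sub>I \<and> dzbar\<^sub>J\<close> in the product of two monomials. It counts inversions, hence is
  multiplicative under disjoint unions in both arguments; this is what makes the wedge product
  associative.\<close>
definition merge_sign :: "'n::linorder set \<times> 'n set \<Rightarrow> 'n set \<times> 'n set \<Rightarrow> complex" where
  "merge_sign S T = (-1) ^ (card (snd S) * card (fst T))
     * shuffle_sign (fst S) (fst T) * shuffle_sign (snd S) (snd T)"

lemma wedge_axis:
  fixes K L K' L' :: "'n::{finite,linorder} set"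
  shows "wedge (axis (K, L) 1) (axis (K', L') 1) =
    (if K \<inter> K' = {} \<and> L \<inter> L' = {} then merge_sign (K, L) (K', L') *s axis (K \<union> K', L \<union> L') 1 else 0)"
    (is "?l = ?r")
proof -
  have "?l $ (I, J) = ?r $ (I, J)" for I J
  proof -
    have "?l $ (I, J) = (\<Sum>K0\<in>Pow I. \<Sum>L0\<in>Pow J. if K0 = K \<and> L0 = L then
       (if I - K = K' \<and> J - L = L' then merge_sign (K, L) (K', L') else 0) else 0)"
      unfolding wedge_def vec_lambda_beta prod.case
      by (intro sum.cong refl) (simp add: axis_def merge_sign_def)
    also have "\<dots> = (\<Sum>K0\<in>Pow I. if K0 = K then (\<Sum>L0\<in>Pow J. if L0 = L then
       (if I - K = K' \<and> J - L = L' then merge_sign (K, L) (K', L') else 0) else 0) else 0)"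
      by (intro sum.cong) auto
    also have "\<dots> = (if K \<subseteq> I \<and> L \<subseteq> J \<and> I - K = K' \<and> J - L = L' then merge_sign (K, L) (K', L') else 0)"
      by (simp add: sum.delta)
    also have "\<dots> = (if K \<inter> K' = {} \<and> L \<inter> L' = {} \<and> I = K \<union> K' \<and> J = L \<union> L' then merge_sign (K, L) (K', L') else 0)"
    proof -
      have "K \<subseteq> I \<and> L \<subseteq> J \<and> I - K = K' \<and> J - L = L' \<longleftrightarrow> K \<inter> K' = {} \<and> L \<inter> L' = {} \<and> I = K \<union> K' \<and> J = L \<union> L'"
        by blast
      then show ?thesis
        by presburger
    qed
    also have "\<dots> = ?r $ (I, J)"
      by (simp add: axis_def)
    finally show ?thesis .
  qed
  then show ?thesis
    by (simp add: vec_eq_iff)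
qed

lemma shuffle_sign_Un_left:
  fixes K K' M :: "'n::{finite,linorder} set"
  assumes "K \<inter> K' = {}"
  shows "shuffle_sign (K \<union> K') M = shuffle_sign K M * shuffle_sign K' M"
proof -
  have "{(k, l). k \<in> K \<union> K' \<and> l \<in> M \<and> l < k} =
      {(k, l). k \<in> K \<and> l \<in> M \<and> l < k} \<union> {(k, l). k \<in> K' \<and> l \<in> M \<and> l < k}"
    by auto
  moreover have "card ({(k, l). k \<in> K \<and> l \<in> M \<and> l < k} \<union> {(k, l). k \<in> K' \<and> l \<in> M \<and> l < k}) =
      card {(k, l). k \<in> K \<and> l \<in> M \<and> l < k} + card {(k, l). k \<in> K' \<and> l \<in> M \<and> l < k}"
    by (rule card_Un_disjoint) (use assms in auto)
  ultimately show ?thesis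
    by (simp add: shuffle_sign_def power_add)
qed

lemma shuffle_sign_Un_right:
  fixes K M M' :: "'n::{finite,linorder} set"
  assumes "M \<inter> M' = {}"
  shows "shuffle_sign K (M \<union> M') = shuffle_sign K M * shuffle_sign K M'"
proof -
  have "{(k, l). k \<in> K \<and> l \<in> M \<union> M' \<and> l < k} =
      {(k, l). k \<in> K \<and> l \<in> M \<and> l < k} \<union> {(k, l). k \<in> K \<and> l \<in> M' \<and> l < k}"
    by auto
  moreover have "card ({(k, l). k \<in> K \<and> l \<in> M \<and> l < k} \<union> {(k, l). k \<in> K \<and> l \<in> M' \<and> l < k}) =
      card {(k, l). k \<in> K \<and> l \<in> M \<and> l < k} + card {(k, l). k \<in> K \<and> l \<in> M' \<and> l < k}"
    by (rule card_Un_disjoint) (use assms in auto)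
  ultimately show ?thesis
    by (simp add: shuffle_sign_def power_add)
qed

lemma shuffle_sign_square [simp]: "shuffle_sign K L * shuffle_sign K L = 1"
  by (simp add: shuffle_sign_def flip: power_add)

lemma shuffle_sign_empty [simp]: "shuffle_sign {} L = 1" "shuffle_sign K {} = 1"
  by (simp_all add: shuffle_sign_def)

lemma shuffle_sign_swap:
  fixes K L :: "'n::{finite,linorder} set"
  assumes "K \<inter> L = {}"
  shows "shuffle_sign K L = (-1) ^ (card K * card L) * shuffle_sign L K"
proof -
  have c: "card {(k, l). k \<in> K \<and> l \<in> L \<and> k < l} = card {(l, k). l \<in> L \<and> k \<in> K \<and> k < l}"
    by (rule bij_betw_same_card[of prod.swap]) (auto simp: bij_betw_def inj_on_def image_def)
  have "K \<times> L = {(k, l). k \<in> K \<and> l \<in> L \<and> l < k} \<union> {(k, l). k \<in> K \<and> l \<in> L \<and> k < l}"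
    using assms by (auto simp: not_less_iff_gr_or_eq)
  moreover have "card ({(k, l). k \<in> K \<and> l \<in> L \<and> l < k} \<union> {(k, l). k \<in> K \<and> l \<in> L \<and> k < l}) =
      card {(k, l). k \<in> K \<and> l \<in> L \<and> l < k} + card {(k, l). k \<in> K \<and> l \<in> L \<and> k < l}"
    by (rule card_Un_disjoint) auto
  ultimately have "card K * card L = card {(k, l). k \<in> K \<and> l \<in> L \<and> l < k} + card {(l, k). l \<in> L \<and> k \<in> K \<and> k < l}"
    by (metis c card_cartesian_product)
  then have "shuffle_sign K L * shuffle_sign L K = (-1) ^ (card K * card L)"
    by (simp add: shuffle_sign_def power_add)
  then show ?thesis
    by (metis mult.assoc mult.right_neutral shuffle_sign_square)
qed

lemma merge_sign_Un_left:
  fixes K L K' L' :: "'n::{finite,linorder} set"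
  assumes "K \<inter> K' = {}" "L \<inter> L' = {}"
  shows "merge_sign (K \<union> K', L \<union> L') T = merge_sign (K, L) T * merge_sign (K', L') T"
  using assms by (simp add: merge_sign_def shuffle_sign_Un_left card_Un_disjoint power_add algebra_simps)

lemma merge_sign_Un_right:
  fixes K L K' L' :: "'n::{finite,linorder} set"
  assumes "K \<inter> K' = {}" "L \<inter> L' = {}"
  shows "merge_sign S (K \<union> K', L \<union> L') = merge_sign S (K, L) * merge_sign S (K', L')"
  using assms by (simp add: merge_sign_def shuffle_sign_Un_right card_Un_disjoint power_add algebra_simps)

lemma merge_sign_swap:
  fixes K L K' L' :: "'n::{finite,linorder} set"
  assumes "K \<inter> K' = {}" "L \<inter> L' = {}"
  shows "merge_sign (K, L) (K', L') =
    (-1) ^ ((card K + card L) * (card K' + card L')) * merge_sign (K', L') (K, L)"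
proof -
  have [simp]: "(-1::complex) ^ (a * b) * ((-1) ^ (a * b) * x) = x" for a b :: nat and x :: complex
    by simp
  show ?thesis
    using assms
    by (simp add: merge_sign_def shuffle_sign_swap[of K] shuffle_sign_swap[of L] power_add algebra_simps)
qed

lemma wedge_assoc: "wedge (wedge a b) c = wedge a (wedge b c)"
proof (induction a rule: ext_basis_induct)
  case a: (basis S)
  show ?case
  proof (induction b rule: ext_basis_induct)
    case b: (basis T)
    show ?case
    proof (induction c rule: ext_basis_induct)
      case (basis U)
      obtain K L K' L' K'' L'' where [simp]: "S = (K, L)" "T = (K', L')" "U = (K'', L'')"
        by (cases S, cases T, cases U)
      let ?d = "K \<inter> K' = {} \<and> L \<inter> L' = {} \<and> K \<inter> K'' = {} \<and> L \<inter> L'' = {} \<and> K' \<inter> K'' = {} \<and> L' \<inter> L'' = {}"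
      let ?s = "merge_sign (K, L) (K', L') * merge_sign (K, L) (K'', L'') * merge_sign (K', L') (K'', L'')"
      have "wedge (wedge (axis S 1) (axis T 1)) (axis U 1) = (if ?d then ?s *s axis (K \<union> K' \<union> K'', L \<union> L' \<union> L'') 1 else 0)"
        by (simp add: wedge_axis wedge_scale_left Int_Un_distrib2 merge_sign_Un_left)
      moreover have "wedge (axis S 1) (wedge (axis T 1) (axis U 1)) = (if ?d then ?s *s axis (K \<union> K' \<union> K'', L \<union> L' \<union> L'') 1 else 0)"
        by (simp add: wedge_axis wedge_scale_right Int_Un_distrib merge_sign_Un_right Un_assoc mult_ac)
      ultimately show ?case
        by simp
    qed (simp_all add: wedge_linear)
  qed (simp_all add: wedge_linear)
qed (simp_all add: wedge_linear)

lemma wedge_one_left [simp]: "wedge ext_one b = b"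
proof (induction b rule: ext_basis_induct)
  case (basis S)
  then show ?case by (cases S) (simp add: ext_one_def wedge_axis merge_sign_def)
qed (simp_all add: wedge_linear)

lemma wedge_one_right [simp]: "wedge b ext_one = b"
proof (induction b rule: ext_basis_induct)
  case (basis S)
  then show ?case by (cases S) (simp add: ext_one_def wedge_axis merge_sign_def)
qed (simp_all add: wedge_linear)

lemma wedge_dz_axis:
  "wedge (dz k) (axis (I, J) 1) = (if k \<in> I then 0 else shuffle_sign {k} I *s axis (insert k I, J) 1)"
  by (simp add: dz_def wedge_axis merge_sign_def)

lemma wedge_dzbar_axis:
  "wedge (dzbar k) (axis (I, J) 1) =
     (if k \<in> J then 0 else ((-1) ^ card I * shuffle_sign {k} J) *s axis (I, insert k J) 1)"
  by (simp add: dzbar_def wedge_axis merge_sign_def)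

text \<open>The main induction principle for identities between linear maps on the exterior algebra.\<close>
lemma ext_wedge_induct [case_names one dz dzbar add scale]:
  fixes a :: "'n::{finite,linorder} ext"
  assumes one: "P ext_one"
    and dz: "\<And>k a. P a \<Longrightarrow> P (wedge (dz k) a)" and dzbar: "\<And>k a. P a \<Longrightarrow> P (wedge (dzbar k) a)"
    and add: "\<And>a b. P a \<Longrightarrow> P b \<Longrightarrow> P (a + b)" and scale: "\<And>k a. P a \<Longrightarrow> P (k *s a)"
  shows "P a"
proof (induction a rule: ext_basis_induct)
  case (basis S)
  have J: "P (axis ({}, J) 1)" for J
  proof (induction J rule: finite_induct[OF finite])
    case 1
    show ?case using one by (simp add: ext_one_def)
  next
    case (2 k J)
    have "axis ({}, insert k J) 1 = shuffle_sign {k} J *s wedge (dzbar k) (axis ({}, J) 1)"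
      using 2 by (simp add: wedge_dzbar_axis vector_smult_assoc)
    then show ?case using scale[OF dzbar[OF 2(3)], of "shuffle_sign {k} J" k] by simp
  qed
  have "P (axis (I, J) 1)" for I J
  proof (induction I rule: finite_induct[OF finite])
    case 1
    show ?case by (rule J)
  next
    case (2 k I)
    have "axis (insert k I, J) 1 = shuffle_sign {k} I *s wedge (dz k) (axis (I, J) 1)"
      using 2 by (simp add: wedge_dz_axis vector_smult_assoc)
    then show ?case using scale[OF dz[OF 2(3)], of "shuffle_sign {k} I" k] by simp
  qed
  then show ?case by (cases S) simp
qed (use add scale in auto)

section \<open>Bidegrees and graded commutativity\<close>

definition bideg :: "int \<Rightarrow> int \<Rightarrow> 'n::finite ext \<Rightarrow> bool" where
  "bideg p q a \<longleftrightarrow> (\<forall>I J. a $ (I, J) \<noteq> 0 \<longrightarrow> int (card I) = p \<and> int (card J) = q)"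

lemma bideg_zero [simp]: "bideg p q 0"
  by (simp add: bideg_def)

lemma bideg_add: "bideg p q a \<Longrightarrow> bideg p q b \<Longrightarrow> bideg p q (a + b)"
  unfolding bideg_def vector_add_component by (metis add_0)

lemma bideg_scale: "bideg p q a \<Longrightarrow> bideg p q (k *s a)"
  by (auto simp: bideg_def)

lemma bideg_minus: "bideg p q a \<Longrightarrow> bideg p q (- a)"
  by (simp add: bideg_def)

lemma bideg_diff: "bideg p q a \<Longrightarrow> bideg p q b \<Longrightarrow> bideg p q (a - b)"
  using bideg_add bideg_minus by fastforce

lemma bideg_sum: "(\<And>i. i \<in> S \<Longrightarrow> bideg p q (f i)) \<Longrightarrow> bideg p q (sum f S)"
  by (induction S rule: infinite_finite_induct) (auto intro: bideg_add)

lemma bideg_one: "bideg 0 0 ext_one"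
  by (auto simp: bideg_def ext_one_def axis_def)

lemma bideg_dz: "bideg 1 0 (dz k)"
  by (auto simp: bideg_def dz_def axis_def)

lemma bideg_dzbar: "bideg 0 1 (dzbar k)"
  by (auto simp: bideg_def dzbar_def axis_def)

lemma bideg_wedge:
  fixes a b :: "'n::{finite,linorder} ext"
  assumes "bideg p q a" "bideg r s b"
  shows "bideg (p + r) (q + s) (wedge a b)"
  unfolding bideg_def
proof (intro allI impI)
  fix I J
  assume "wedge a b $ (I, J) \<noteq> 0"
  then obtain K where "K \<in> Pow I" and "(\<Sum>L\<in>Pow J. (-1) ^ (card L * card (I - K)) * shuffle_sign K (I - K)
      * shuffle_sign L (J - L) * a $ (K, L) * b $ (I - K, J - L)) \<noteq> 0"
    unfolding wedge_def by (metis (no_types, lifting) case_prod_conv sum.neutral vec_lambda_beta)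
  then obtain L where "K \<subseteq> I" "L \<subseteq> J" "a $ (K, L) \<noteq> 0" "b $ (I - K, J - L) \<noteq> 0"
    by (metis (no_types, lifting) Pow_iff mult_eq_0_iff sum.neutral)
  moreover from this have "card I = card K + card (I - K)" "card J = card L + card (J - L)"
    by (metis card_Diff_subset card_mono finite le_add_diff_inverse)+
  ultimately show "int (card I) = p + r \<and> int (card J) = q + s"
    using assms unfolding bideg_def by (metis of_nat_add)
qed

text \<open>By linearity this is a statement about monomials, where it says that reversing the order of two
  disjoint sets changes the number of inversions from \<open>i\<close> to \<open>card S * card T - i\<close>.\<close>
lemma wedge_commute:
  fixes a b :: "'n::{finite,linorder} ext"
  assumes "bideg p q a" "bideg r s b"
  shows "wedge a b = (if odd (p + q) \<and> odd (r + s) then - wedge b a else wedge b a)"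
proof -
  define \<epsilon> :: complex where "\<epsilon> = (if odd (p + q) \<and> odd (r + s) then -1 else 1)"
  have *: "(a $ S * b $ T) *s wedge (axis S 1) (axis T 1) = (a $ S * b $ T) *s (\<epsilon> *s wedge (axis T 1) (axis S 1))" for S T
  proof (cases "a $ S = 0 \<or> b $ T = 0")
    case False
    obtain K L K' L' where ST [simp]: "S = (K, L)" "T = (K', L')"
      by (cases S, cases T)
    have "int (card K + card L) = p + q" "int (card K' + card L') = r + s"
      using False assms by (auto simp: bideg_def)
    note eqs = this
    have "odd (p + q) \<longleftrightarrow> odd (card K + card L)" "odd (r + s) \<longleftrightarrow> odd (card K' + card L')"
      unfolding eqs[symmetric] even_of_nat by (rule refl)+
    then have "\<epsilon> = (-1) ^ ((card K + card L) * (card K' + card L'))"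
      by (simp only: \<epsilon>_def uminus_power_if even_mult_iff) auto
    then show ?thesis
      by (simp add: wedge_axis Int_commute Un_commute merge_sign_swap[of K K' L L'] vector_smult_assoc mult_ac)
  qed auto
  have "wedge a b = wedge (\<Sum>S\<in>UNIV. (a $ S) *s axis S 1) (\<Sum>T\<in>UNIV. (b $ T) *s axis T 1)"
    by (simp add: basis_expansion)
  also have "\<dots> = (\<Sum>S\<in>UNIV. \<Sum>T\<in>UNIV. (a $ S * b $ T) *s wedge (axis S 1) (axis T 1))"
    unfolding wedge_sum_left
    by (simp only: wedge_sum_right wedge_scale_left wedge_scale_right vector_smult_assoc vec.scale_sum_right,
        simp only: mult_ac)
  also have "\<dots> = (\<Sum>S\<in>UNIV. \<Sum>T\<in>UNIV. \<epsilon> *s ((b $ T * a $ S) *s wedge (axis T 1) (axis S 1)))"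
    unfolding * by (simp add: mult_ac)
  also have "\<dots> = \<epsilon> *s wedge (\<Sum>T\<in>UNIV. (b $ T) *s axis T 1) (\<Sum>S\<in>UNIV. (a $ S) *s axis S 1)"
    unfolding wedge_sum_left
    by (subst sum.swap) (simp only: wedge_sum_right wedge_scale_left wedge_scale_right
        vector_smult_assoc vec.scale_sum_right, simp only: mult_ac)
  also have "\<dots> = \<epsilon> *s wedge b a"
    by (simp add: basis_expansion)
  finally show ?thesis
    by (simp add: \<epsilon>_def)
qed

lemma complex_eq_minus_self: "x = - x \<Longrightarrow> x = (0::complex)"
proof -
  have "x = - x \<longleftrightarrow> x = 0"
    by (auto simp: complex_eq_iff)
  then show "x = - x \<Longrightarrow> x = 0"
    by blast
qed

lemma wedge_self_zero:
  fixes a :: "'n::{finite,linorder} ext"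
  assumes "wedge a a = - wedge a a"
  shows "wedge a a = 0"
proof -
  have "wedge a a $ i = - (wedge a a $ i)" for i
    by (subst assms) (rule vector_uminus_component)
  then have "wedge a a $ i = 0" for i
    using complex_eq_minus_self by blast
  then show ?thesis
    by (simp add: vec_eq_iff)
qed

section \<open>Substitution of one-forms and the contraction with coordinate vector fields\<close>

text \<open>The products of one-forms that occur in \<^const>\<open>pullback\<close>.\<close>
definition wedge_over :: "('n \<Rightarrow> 'n::{finite,linorder} ext) \<Rightarrow> 'n set \<Rightarrow> 'n ext" where
  "wedge_over \<eta> I = foldr wedge (map \<eta> (sorted_list_of_set I)) ext_one"

text \<open>The algebra homomorphism with \<open>dz\<^sub>k \<mapsto> \<eta> k\<close> and \<open>dzbar\<^sub>k \<mapsto> \<mu> k\<close>. It isolates the algebra of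
  \<^const>\<open>pullback\<close>, in which only the bidegrees of the new generators matter.\<close>
definition ext_subst :: "('n \<Rightarrow> 'n::{finite,linorder} ext) \<Rightarrow> ('n \<Rightarrow> 'n ext) \<Rightarrow> 'n ext \<Rightarrow> 'n ext" where
  "ext_subst \<eta> \<mu> a = (\<Sum>(I, J)\<in>UNIV. (a $ (I, J)) *s wedge (wedge_over \<eta> I) (wedge_over \<mu> J))"

lemma pullback_eq_ext_subst:
  "pullback \<tau> z = ext_subst (\<lambda>i. \<Sum>j\<in>UNIV. (wirt j \<tau> z $ i) *s dz j)
                            (\<lambda>i. \<Sum>j\<in>UNIV. cnj (wirt j \<tau> z $ i) *s dzbar j)"
  by (rule ext) (simp add: pullback_def ext_subst_def wedge_over_def)

lemma ext_subst_add: "ext_subst \<eta> \<mu> (a + b) = ext_subst \<eta> \<mu> a + ext_subst \<eta> \<mu> b"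
  by (simp add: ext_subst_def case_prod_beta vec.scale_left_distrib sum.distrib)

lemma ext_subst_scale: "ext_subst \<eta> \<mu> (k *s a) = k *s ext_subst \<eta> \<mu> a"
  by (simp add: ext_subst_def case_prod_beta vec.scale_sum_right vector_smult_assoc)

lemma ext_subst_zero [simp]: "ext_subst \<eta> \<mu> 0 = 0"
  by (simp add: ext_subst_def case_prod_beta)

lemma ext_subst_minus: "ext_subst \<eta> \<mu> (- a) = - ext_subst \<eta> \<mu> a"
  using ext_subst_scale[of \<eta> \<mu> "-1" a] by simp

lemma ext_subst_sum: "ext_subst \<eta> \<mu> (sum f S) = (\<Sum>i\<in>S. ext_subst \<eta> \<mu> (f i))"
  by (induction S rule: infinite_finite_induct) (auto simp: ext_subst_add)

lemma ext_subst_axis: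
  fixes \<eta> \<mu> :: "'n::{finite,linorder} \<Rightarrow> 'n ext"
  shows "ext_subst \<eta> \<mu> (axis (I, J) 1) = wedge (wedge_over \<eta> I) (wedge_over \<mu> J)"
proof -
  have "ext_subst \<eta> \<mu> (axis (I, J) 1) =
      (\<Sum>P\<in>UNIV. if P = (I, J) then wedge (wedge_over \<eta> I) (wedge_over \<mu> J) else 0)"
    unfolding ext_subst_def by (rule sum.cong[OF refl]) (simp add: axis_def split: prod.split)
  then show ?thesis
    by simp
qed

lemma wedge_over_empty [simp]: "wedge_over \<eta> {} = ext_one"
  by (simp add: wedge_over_def)

text \<open>Moving \<open>\<eta> k\<close> into its place in an increasing product costs one sign for each smaller index.\<close>
lemma wedge_foldr_insort:
  fixes \<eta> :: "'n::{finite,linorder} \<Rightarrow> 'n ext"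
  assumes anti: "\<And>i j. wedge (\<eta> i) (\<eta> j) = - wedge (\<eta> j) (\<eta> i)"
  shows "sorted xs \<Longrightarrow> distinct xs \<Longrightarrow> k \<notin> set xs \<Longrightarrow>
    wedge (\<eta> k) (foldr wedge (map \<eta> xs) ext_one) =
      (-1) ^ card {l \<in> set xs. l < k} *s foldr wedge (map \<eta> (insort k xs)) ext_one"
proof (induction xs)
  case (Cons x xs)
  show ?case
  proof (cases "k \<le> x")
    case True
    then have "{l \<in> set (x # xs). l < k} = {}"
      using Cons.prems by auto
    then show ?thesis
      using True by (simp only: card.empty) simp
  next
    case False
    have "{l \<in> set (x # xs). l < k} = insert x {l \<in> set xs. l < k}"
      using False by auto
    moreover have "x \<notin> {l \<in> set xs. l < k}"
      using Cons.prems by auto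
    ultimately have c: "card {l \<in> set (x # xs). l < k} = Suc (card {l \<in> set xs. l < k})"
      by simp
    have "wedge (\<eta> k) (foldr wedge (map \<eta> (x # xs)) ext_one) = - wedge (\<eta> x) (wedge (\<eta> k) (foldr wedge (map \<eta> xs) ext_one))"
      by (simp add: wedge_assoc[symmetric] anti[of k x] wedge_minus_left)
    also have "\<dots> = - wedge (\<eta> x) ((-1) ^ card {l \<in> set xs. l < k} *s foldr wedge (map \<eta> (insort k xs)) ext_one)"
      using Cons by simp
    also have "\<dots> = (-1) ^ card {l \<in> set (x # xs). l < k} *s foldr wedge (map \<eta> (insort k (x # xs))) ext_one"
      unfolding c using False by (simp add: wedge_scale_right)
    finally show ?thesis .
  qed
qed simp

lemma wedge_wedge_over:
  fixes \<eta> :: "'n::{finite,linorder} \<Rightarrow> 'n ext"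
  assumes anti: "\<And>i j. wedge (\<eta> i) (\<eta> j) = - wedge (\<eta> j) (\<eta> i)"
  shows "wedge (\<eta> k) (wedge_over \<eta> I) = (if k \<in> I then 0 else shuffle_sign {k} I *s wedge_over \<eta> (insert k I))"
proof -
  have out: "wedge (\<eta> k) (wedge_over \<eta> I) = shuffle_sign {k} I *s wedge_over \<eta> (insert k I)" if "k \<notin> I" for I
  proof -
    have "{(j, l). j \<in> {k} \<and> l \<in> I \<and> l < j} = Pair k ` {l \<in> I. l < k}"
      by auto
    then have "card {(j, l). j \<in> {k} \<and> l \<in> I \<and> l < j} = card {l \<in> I. l < k}"
      by (simp add: card_image inj_on_def)
    then show ?thesis
      using wedge_foldr_insort[OF anti, of "sorted_list_of_set I" k] that
      by (simp add: wedge_over_def shuffle_sign_def sorted_list_of_set_insert)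
  qed
  have "wedge (\<eta> k) (wedge_over \<eta> I) = 0" if "k \<in> I"
  proof -
    have "wedge_over \<eta> I = shuffle_sign {k} (I - {k}) *s wedge (\<eta> k) (wedge_over \<eta> (I - {k}))"
      using out[of "I - {k}"] that by (simp add: vector_smult_assoc insert_absorb)
    moreover have "wedge (\<eta> k) (\<eta> k) = 0"
      by (rule wedge_self_zero) (rule anti)
    ultimately show ?thesis
      by (simp add: wedge_scale_right wedge_assoc[symmetric])
  qed
  with out show ?thesis
    by auto
qed

lemma wedge_over_insert:
  fixes \<eta> :: "'n::{finite,linorder} \<Rightarrow> 'n ext"
  assumes anti: "\<And>i j. wedge (\<eta> i) (\<eta> j) = - wedge (\<eta> j) (\<eta> i)" and "k \<notin> I"
  shows "wedge_over \<eta> (insert k I) = shuffle_sign {k} I *s wedge (\<eta> k) (wedge_over \<eta> I)"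
  using wedge_wedge_over[where \<eta> = \<eta> and k = k and I = I, OF anti] \<open>k \<notin> I\<close> by (simp add: vector_smult_assoc)

text \<open>Substituting one-forms of type (1,0) for the \<open>dz\<^sub>k\<close> and of type (0,1) for the \<open>dzbar\<^sub>k\<close>
  respects wedge products, because the new generators anticommute as well.\<close>

locale one_form_subst =
  fixes \<eta> \<mu> :: "'n::{finite,linorder} \<Rightarrow> 'n ext"
  assumes bideg_eta: "bideg 1 0 (\<eta> i)" and bideg_mu: "bideg 0 1 (\<mu> i)"
begin

lemma anti_eta: "wedge (\<eta> i) (\<eta> j) = - wedge (\<eta> j) (\<eta> i)"
  by (rule trans[OF wedge_commute[OF bideg_eta bideg_eta]]) simp

lemma anti_mu: "wedge (\<mu> i) (\<mu> j) = - wedge (\<mu> j) (\<mu> i)"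
  by (rule trans[OF wedge_commute[OF bideg_mu bideg_mu]]) simp

lemma wedge_wedge_over_eta:
  "wedge (\<eta> k) (wedge_over \<eta> I) = (if k \<in> I then 0 else shuffle_sign {k} I *s wedge_over \<eta> (insert k I))"
  by (rule wedge_wedge_over) (rule anti_eta)

lemma wedge_wedge_over_mu:
  "wedge (\<mu> k) (wedge_over \<mu> I) = (if k \<in> I then 0 else shuffle_sign {k} I *s wedge_over \<mu> (insert k I))"
  by (rule wedge_wedge_over) (rule anti_mu)

lemma bideg_wedge_over_eta: "bideg (int (card I)) 0 (wedge_over \<eta> I)"
proof (induction I rule: finite_induct[OF finite])
  case 1
  then show ?case by (simp add: bideg_one)
next
  case (2 k I)
  have "bideg (int (card (insert k I))) 0 (wedge (\<eta> k) (wedge_over \<eta> I))"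
    using bideg_wedge[OF bideg_eta 2(3)] 2(2) by (simp add: add.commute)
  then show ?case
    using 2(2) by (subst wedge_over_insert) (auto intro: anti_eta bideg_scale)
qed

lemma bideg_wedge_over_mu: "bideg 0 (int (card J)) (wedge_over \<mu> J)"
proof (induction J rule: finite_induct[OF finite])
  case 1
  then show ?case by (simp add: bideg_one)
next
  case (2 k J)
  have "bideg 0 (int (card (insert k J))) (wedge (\<mu> k) (wedge_over \<mu> J))"
    using bideg_wedge[OF bideg_mu 2(3)] 2(2) by (simp add: add.commute)
  then show ?case
    using 2(2) by (subst wedge_over_insert) (auto intro: anti_mu bideg_scale)
qed

lemma bideg_ext_subst:
  assumes "bideg p q a"
  shows "bideg p q (ext_subst \<eta> \<mu> a)"
  unfolding ext_subst_def case_prod_beta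
proof (rule bideg_sum)
  fix S :: "'n set \<times> 'n set"
  obtain I J where [simp]: "S = (I, J)"
    by (cases S)
  show "bideg p q (a $ (fst S, snd S) *s wedge (wedge_over \<eta> (fst S)) (wedge_over \<mu> (snd S)))"
  proof (cases "a $ (I, J) = 0")
    case False
    then have "int (card I) = p" "int (card J) = q"
      using assms by (auto simp: bideg_def)
    then show ?thesis
      using bideg_wedge[OF bideg_wedge_over_eta[of I] bideg_wedge_over_mu[of J]]
      by (auto intro: bideg_scale)
  qed simp
qed

lemma ext_subst_one: "ext_subst \<eta> \<mu> ext_one = ext_one"
  using ext_subst_axis[of \<eta> \<mu> "{}" "{}"] by (simp add: ext_one_def[symmetric])

lemma ext_subst_dz_wedge: "ext_subst \<eta> \<mu> (wedge (dz k) b) = wedge (\<eta> k) (ext_subst \<eta> \<mu> b)"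
proof (induction b rule: ext_basis_induct)
  case (basis S)
  then show ?case
    by (cases S) (auto simp: wedge_dz_axis ext_subst_axis ext_subst_scale wedge_assoc[symmetric]
        wedge_wedge_over_eta wedge_scale_left)
qed (simp_all add: wedge_linear ext_subst_add ext_subst_scale)

lemma ext_subst_dzbar_wedge: "ext_subst \<eta> \<mu> (wedge (dzbar k) b) = wedge (\<mu> k) (ext_subst \<eta> \<mu> b)"
proof (induction b rule: ext_basis_induct)
  case (basis S)
  obtain I J where S: "S = (I, J)" by (cases S)
  have "wedge (\<mu> k) (wedge_over \<eta> I) = (-1) ^ card I *s wedge (wedge_over \<eta> I) (\<mu> k)"
    by (subst wedge_commute[OF bideg_mu bideg_wedge_over_eta]) (simp add: uminus_power_if)
  then have "wedge (\<mu> k) (wedge (wedge_over \<eta> I) (wedge_over \<mu> J)) =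
      (-1) ^ card I *s wedge (wedge_over \<eta> I) (wedge (\<mu> k) (wedge_over \<mu> J))"
    by (simp add: wedge_assoc[symmetric] wedge_scale_left)
  then show ?case
    by (auto simp: S wedge_dzbar_axis ext_subst_axis ext_subst_scale
        wedge_wedge_over_mu wedge_scale_right vector_smult_assoc)
qed (simp_all add: wedge_linear ext_subst_add ext_subst_scale)

lemma ext_subst_wedge: "ext_subst \<eta> \<mu> (wedge a b) = wedge (ext_subst \<eta> \<mu> a) (ext_subst \<eta> \<mu> b)"
  by (induction a rule: ext_wedge_induct)
    (simp_all add: wedge_linear ext_subst_add ext_subst_scale wedge_assoc ext_subst_one
      ext_subst_dz_wedge ext_subst_dzbar_wedge)

end

lemma interior_add: "interior_dz k (a + b) = interior_dz k a + interior_dz k b"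
  by (simp add: interior_dz_def vec_eq_iff algebra_simps)

lemma interior_scale: "interior_dz k (s *s a) = s *s interior_dz k a"
  by (simp add: interior_dz_def vec_eq_iff algebra_simps)

lemma interior_zero [simp]: "interior_dz k 0 = 0"
  by (simp add: interior_dz_def vec_eq_iff)

lemma interior_minus: "interior_dz k (- a) = - interior_dz k a"
  using interior_scale[of k "-1" a] by simp

lemma interior_sum: "interior_dz k (sum f S) = (\<Sum>i\<in>S. interior_dz k (f i))"
  by (induction S rule: infinite_finite_induct) (auto simp: interior_add)

lemma interior_axis:
  fixes k :: "'n::{finite,linorder}"
  shows "interior_dz k (axis (I, J) 1) = (if k \<in> I then shuffle_sign {k} (I - {k}) *s axis (I - {k}, J) 1 else 0)"
proof -
  have "interior_dz k (axis (I, J) 1) $ (I', J') =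
      (if k \<in> I then shuffle_sign {k} (I - {k}) *s axis (I - {k}, J) 1 else 0) $ (I', J')" for I' J'
  proof (cases "k \<notin> I' \<and> I = insert k I'")
    case True
    then have "I - {k} = I'" "k \<in> I" by auto
    then show ?thesis using True by (auto simp: interior_dz_def axis_def)
  next
    case False
    then have "insert k I' \<noteq> I \<or> k \<in> I'" "k \<in> I \<Longrightarrow> I' \<noteq> I - {k}" by auto
    then show ?thesis by (auto simp: interior_dz_def axis_def)
  qed
  then show ?thesis
    by (simp add: vec_eq_iff)
qed

lemma interior_one [simp]: "interior_dz k ext_one = 0"
  by (simp add: ext_one_def interior_axis)

lemma bideg_interior:
  assumes "bideg p q a"
  shows "bideg (p - 1) q (interior_dz k a)"
  unfolding bideg_def
proof (intro allI impI)
  fix I J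
  assume "interior_dz k a $ (I, J) \<noteq> 0"
  then have "k \<notin> I" "a $ (insert k I, J) \<noteq> 0"
    by (auto simp: interior_dz_def split: if_splits)
  moreover from this have "int (card (insert k I)) = p \<and> int (card J) = q"
    using assms unfolding bideg_def by blast
  ultimately show "int (card I) = p - 1 \<and> int (card J) = q"
    by auto
qed

lemma shuffle_sign_single_swap:
  fixes j k :: "'n::{finite,linorder}"
  shows "j \<noteq> k \<Longrightarrow> shuffle_sign {j} {k} = - shuffle_sign {k} {j}"
  using shuffle_sign_swap[of "{j}" "{k}"] by simp

lemma interior_dz_wedge:
  "interior_dz k (wedge (dz j) b) = (if j = k then b else 0) - wedge (dz j) (interior_dz k b)"
proof (induction b rule: ext_basis_induct)
  case (basis S)
  obtain I J where S: "S = (I, J)" by (cases S)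
  consider "j \<in> I" "j = k" | "j \<in> I" "j \<noteq> k" | "j \<notin> I" "j = k" | "j \<notin> I" "j \<noteq> k" "k \<notin> I" | "j \<notin> I" "j \<noteq> k" "k \<in> I"
    by blast
  then show ?case
  proof cases
    case 5
    define I' where "I' = I - {k}"
    have I: "I = insert k I'" "k \<notin> I'" "j \<notin> I'"
      using 5 by (auto simp: I'_def)
    have "shuffle_sign {j} (insert k I') = shuffle_sign {j} {k} * shuffle_sign {j} I'"
      and "shuffle_sign {k} (insert j I') = shuffle_sign {k} {j} * shuffle_sign {k} I'"
      using I shuffle_sign_Un_right[of "{k}" I' "{j}"] shuffle_sign_Un_right[of "{j}" I' "{k}"] by auto
    moreover have "insert j (insert k I') - {k} = insert j I'" "insert k I' - {k} = I'"
      using I 5 by auto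
    moreover have "shuffle_sign {j} {k} * (shuffle_sign {k} {j} * x) = - x" for x
      using 5 by (simp add: shuffle_sign_single_swap[of j k] mult.assoc[symmetric])
    ultimately show ?thesis
      using 5 I by (simp add: S wedge_dz_axis interior_axis interior_scale wedge_scale_right vector_smult_assoc mult_ac)
  qed (auto simp: S wedge_dz_axis interior_axis interior_scale wedge_scale_right vector_smult_assoc insert_absorb)
next
  case (add a b)
  then show ?case by (auto simp: wedge_linear interior_add)
next
  case (scale s a)
  then show ?case by (auto simp: wedge_linear interior_scale vec.scale_right_diff_distrib)
qed

lemma interior_dzbar_wedge:
  "interior_dz k (wedge (dzbar j) b) = - wedge (dzbar j) (interior_dz k b)"
proof (induction b rule: ext_basis_induct)
  case (basis S)
  obtain I J where S: "S = (I, J)" by (cases S)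
  have "card (I - {k}) = m" if "card I = Suc m" "k \<in> I" for m
    using that by simp
  moreover have "card I \<noteq> 0" if "k \<in> I"
    using that by auto
  ultimately show ?case
    by (cases "card I") (auto simp: S wedge_dzbar_axis interior_minus interior_axis interior_scale wedge_scale_right vector_smult_assoc mult_ac)
qed (simp_all add: wedge_linear interior_add interior_scale algebra_simps)

text \<open>With the parity involution \<open>inv a\<close> in place of the sign the rule makes sense for all \<open>a\<close>, so it follows
  by induction over the generators; on homogeneous elements \<open>inv\<close> is the sign.\<close>
lemma interior_wedge:
  fixes a b :: "'n::{finite,linorder} ext"
  assumes "bideg p q a"
  shows "interior_dz k (wedge a b) =
    wedge (interior_dz k a) b + (if even (p + q) then 1 else -1) *s wedge a (interior_dz k b)"
proof -
  define inv :: "'n ext \<Rightarrow> 'n ext" where "inv a = (\<chi> S. (-1) ^ (card (fst S) + card (snd S)) * a $ S)" for a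
  have inv_axis: "inv (axis (I, J) 1) = (-1) ^ (card I + card J) *s axis (I, J) 1" for I J
    by (auto simp: inv_def vec_eq_iff axis_def)
  have inv_lin: "inv (a + b) = inv a + inv b" "inv (s *s a) = s *s inv a" for a b s
    by (auto simp: inv_def vec_eq_iff algebra_simps)
  have inv_coframe: "inv (wedge (dz j) a) = - wedge (dz j) (inv a)" "inv (wedge (dzbar j) a) = - wedge (dzbar j) (inv a)" for j a
  proof -
    have "inv (wedge (dz j) a) = - wedge (dz j) (inv a) \<and> inv (wedge (dzbar j) a) = - wedge (dzbar j) (inv a)"
    proof (induction a rule: ext_basis_induct)
      case (basis S)
      obtain I J where S: "S = (I, J)" by (cases S)
      have [simp]: "inv 0 = 0" by (simp add: inv_def vec_eq_iff)
      show ?case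
        by (simp add: S wedge_dz_axis wedge_dzbar_axis inv_lin inv_axis wedge_scale_right vector_smult_assoc mult_ac power_add)
    qed (simp_all add: wedge_linear inv_lin)
    then show "inv (wedge (dz j) a) = - wedge (dz j) (inv a)" "inv (wedge (dzbar j) a) = - wedge (dzbar j) (inv a)"
      by blast+
  qed
  have inv1: "inv ext_one = ext_one"
    using inv_axis[of "{}" "{}"] by (simp add: ext_one_def)
  have *: "interior_dz k (wedge a b) = wedge (interior_dz k a) b + wedge (inv a) (interior_dz k b)" for a
    by (induction a rule: ext_wedge_induct)
      (simp_all add: wedge_linear wedge_diff_left wedge_diff_right wedge_assoc interior_add interior_scale
        interior_dz_wedge interior_dzbar_wedge inv_lin inv_coframe inv1 algebra_simps)
  have "inv a = (if even (p + q) then 1 else -1) *s a"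
  proof -
    have "inv a $ (I, J) = ((if even (p + q) then 1 else -1) *s a) $ (I, J)" for I J
    proof (cases "a $ (I, J) = 0")
      case False
      then have pq: "int (card I + card J) = p + q"
        using assms by (auto simp: bideg_def)
      have "even (p + q) \<longleftrightarrow> even (card I + card J)"
        unfolding pq[symmetric] even_of_nat by (rule refl)
      then show ?thesis
        by (simp only: inv_def vec_lambda_beta fst_conv snd_conv uminus_power_if vector_smult_component) simp
    qed (simp add: inv_def)
    then show ?thesis
      by (simp add: vec_eq_iff)
  qed
  then show ?thesis
    using * by (simp add: wedge_scale_left)
qed

text \<open>Contraction transforms dually to the one-forms \<open>\<eta> k\<close>. For the pullback under a coordinate change this is
  the transformation law of \<open>\<partial>/\<partial>z\<^sub>i\<close>, which makes the contraction of forms by vector fields global.\<close>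
lemma interior_ext_subst:
  fixes \<eta> \<mu> :: "'n::{finite,linorder} \<Rightarrow> 'n ext"
  assumes eta: "\<And>k. \<eta> k = (\<Sum>i\<in>UNIV. h k i *s dz i)" and mu: "\<And>k. \<mu> k = (\<Sum>i\<in>UNIV. h' k i *s dzbar i)"
  shows "interior_dz i (ext_subst \<eta> \<mu> b) = (\<Sum>k\<in>UNIV. h k i *s ext_subst \<eta> \<mu> (interior_dz k b))"
proof -
  interpret one_form_subst \<eta> \<mu>
    by unfold_locales (auto simp: eta mu intro!: bideg_sum bideg_scale bideg_dz bideg_dzbar)
  have int_eta: "interior_dz i (wedge (\<eta> k) c) = h k i *s c - wedge (\<eta> k) (interior_dz i c)" for k c
  proof -
    have "interior_dz i (wedge (\<eta> k) c) = (\<Sum>j\<in>UNIV. h k j *s interior_dz i (wedge (dz j) c))"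
      by (simp add: eta wedge_sum_left interior_sum wedge_scale_left interior_scale)
    also have "\<dots> = (\<Sum>j\<in>UNIV. if j = i then h k i *s c else 0) - (\<Sum>j\<in>UNIV. h k j *s wedge (dz j) (interior_dz i c))"
      unfolding sum_subtractf[symmetric]
      by (rule sum.cong) (auto simp: interior_dz_wedge vec.scale_right_diff_distrib)
    finally show ?thesis
      by (simp add: eta wedge_sum_left wedge_scale_left)
  qed
  have int_mu: "interior_dz i (wedge (\<mu> k) c) = - wedge (\<mu> k) (interior_dz i c)" for k c
    by (simp add: mu wedge_sum_left interior_sum wedge_scale_left interior_scale interior_dzbar_wedge sum_negf)
  show ?thesis
  proof (induction b rule: ext_wedge_induct)
    case (dz k a)
    have "(\<Sum>l\<in>UNIV. h l i *s ext_subst \<eta> \<mu> (interior_dz l (wedge (dz k) a))) =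
       (\<Sum>l\<in>UNIV. if l = k then h k i *s ext_subst \<eta> \<mu> a else 0)
         - (\<Sum>l\<in>UNIV. h l i *s wedge (\<eta> k) (ext_subst \<eta> \<mu> (interior_dz l a)))"
      unfolding sum_subtractf[symmetric]
      by (rule sum.cong)
        (auto simp: interior_dz_wedge diff_conv_add_uminus ext_subst_add ext_subst_minus ext_subst_dz_wedge
          vec.scale_right_distrib simp del: add_uminus_conv_diff)
    also have "\<dots> = interior_dz i (ext_subst \<eta> \<mu> (wedge (dz k) a))"
      by (simp add: ext_subst_dz_wedge int_eta dz wedge_sum_right wedge_scale_right)
    finally show ?case by simp
  next
    case (dzbar k a)
    then show ?case
      by (simp add: ext_subst_dzbar_wedge int_mu interior_dzbar_wedge ext_subst_minus
          wedge_sum_right wedge_scale_right sum_negf)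
  qed (simp_all add: ext_subst_one ext_subst_add ext_subst_scale interior_add interior_scale sum.distrib
      vec.scale_right_distrib vec.scale_sum_right vector_smult_assoc mult_ac)
qed

section \<open>Smooth functions on open sets\<close>

lemma frechet_derivative_eqI: "(f has_derivative f') (at x) \<Longrightarrow> frechet_derivative f (at x) = f'"
  by (rule frechet_derivative_at[symmetric])

lemma Ck_on_cong:
  assumes "open S" and "\<And>x. x \<in> S \<Longrightarrow> f x = g x" and "Ck_on k S f"
  shows "Ck_on k S g"
  using assms(2,3)
proof (induction k arbitrary: f g)
  case 0
  then show ?case by (simp cong: continuous_on_cong)
next
  case (Suc k)
  have d: "(g has_derivative frechet_derivative f (at x)) (at x)" if "x \<in> S" for x
    by (rule has_derivative_transform_within_open[where f = f, OF _ \<open>open S\<close> that])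
      (use Suc.prems that in \<open>auto simp: frechet_derivative_works\<close>)
  have "frechet_derivative g (at x) = frechet_derivative f (at x)" if "x \<in> S" for x
    by (rule frechet_derivative_eqI[OF d[OF that]])
  then have "Ck_on k S (\<lambda>x. frechet_derivative g (at x) v)" for v
    using Suc.IH[of "\<lambda>x. frechet_derivative f (at x) v" "\<lambda>x. frechet_derivative g (at x) v"] Suc.prems by auto
  then show ?case
    using d by (auto intro: differentiableI)
qed

text \<open>It suffices to know some derivative on the open set, in whatever form it arises.\<close>
lemma Ck_on_SucI:
  assumes "open S" and "\<And>x. x \<in> S \<Longrightarrow> (f has_derivative f' x) (at x)"
    and "\<And>v. Ck_on k S (\<lambda>x. f' x v)"
  shows "Ck_on (Suc k) S f"
proof -
  have "Ck_on k S (\<lambda>x. frechet_derivative f (at x) v)" for v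
    by (rule Ck_on_cong[OF \<open>open S\<close> _ assms(3)[of v]]) (simp add: frechet_derivative_eqI[OF assms(2)])
  then show ?thesis
    using assms(2) by (auto intro: differentiableI)
qed

lemma Ck_on_SucD: "Ck_on (Suc k) S f \<Longrightarrow> Ck_on k S f"
proof (induction k arbitrary: f)
  case 0
  then show ?case
    by (auto intro!: differentiable_imp_continuous_on simp: differentiable_on_def differentiable_at_withinI)
next
  case (Suc k)
  then show ?case by auto
qed

lemma Ck_on_has_derivative:
  "Ck_on (Suc k) S f \<Longrightarrow> x \<in> S \<Longrightarrow> (f has_derivative frechet_derivative f (at x)) (at x)"
  by (simp add: frechet_derivative_works)

lemma Ck_on_const: "open S \<Longrightarrow> Ck_on k S (\<lambda>x. c)"
  by (induction k arbitrary: c) (auto intro!: Ck_on_SucI derivative_eq_intros simp del: Ck_on.simps(2))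

lemma Ck_on_add:
  assumes "open S" shows "Ck_on k S f \<Longrightarrow> Ck_on k S g \<Longrightarrow> Ck_on k S (\<lambda>x. f x + g x)"
proof (induction k arbitrary: f g)
  case (Suc k)
  show ?case
    by (rule Ck_on_SucI[OF \<open>open S\<close> has_derivative_add[OF Ck_on_has_derivative Ck_on_has_derivative]])
      (use Suc in auto)
qed (auto intro: continuous_intros)

lemma Ck_on_linear:
  assumes "open S" "bounded_linear L" shows "Ck_on k S f \<Longrightarrow> Ck_on k S (\<lambda>x. L (f x))"
proof (induction k arbitrary: f)
  case 0
  then show ?case using bounded_linear.continuous_on[OF assms(2)] by simp
next
  case (Suc k)
  show ?case
    by (rule Ck_on_SucI[OF \<open>open S\<close> bounded_linear.has_derivative[OF assms(2) Ck_on_has_derivative]])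
      (use Suc in auto)
qed

lemma Ck_on_bilinear:
  assumes "open S" "bounded_bilinear mul"
  shows "Ck_on k S f \<Longrightarrow> Ck_on k S g \<Longrightarrow> Ck_on k S (\<lambda>x. mul (f x) (g x))"
proof (induction k arbitrary: f g)
  case 0
  then show ?case using bounded_bilinear.continuous_on[OF assms(2)] by simp
next
  case (Suc k)
  show ?case
  proof (rule Ck_on_SucI[OF \<open>open S\<close> bounded_bilinear.FDERIV[OF assms(2) Ck_on_has_derivative Ck_on_has_derivative]])
    show "Ck_on k S (\<lambda>x. mul (f x) (frechet_derivative g (at x) v) + mul (frechet_derivative f (at x) v) (g x))" for v
      by (rule Ck_on_add[OF \<open>open S\<close>]; rule Suc.IH) (use Suc.prems Ck_on_SucD in auto)
  qed (use Suc in auto)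
qed

lemma Ck_on_inverse:
  fixes f :: "'v::real_normed_vector \<Rightarrow> complex"
  assumes "open S" "\<And>x. x \<in> S \<Longrightarrow> f x \<noteq> 0"
  shows "Ck_on k S f \<Longrightarrow> Ck_on k S (\<lambda>x. inverse (f x))"
proof (induction k)
  case 0
  then show ?case using assms by (auto intro: continuous_intros)
next
  case (Suc k)
  show ?case
  proof (rule Ck_on_SucI[OF \<open>open S\<close> Deriv.has_derivative_inverse[OF _ Ck_on_has_derivative]])
    have i: "Ck_on k S (\<lambda>x. inverse (f x))"
      by (rule Suc.IH) (rule Ck_on_SucD[OF Suc.prems])
    have "Ck_on k S (\<lambda>x. frechet_derivative f (at x) v)" for v
      using Suc.prems by auto
    then show "Ck_on k S (\<lambda>x. - (inverse (f x) * frechet_derivative f (at x) v * inverse (f x)))" for v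
      by (intro Ck_on_linear[OF \<open>open S\<close> bounded_linear_minus[OF bounded_linear_ident]]
          Ck_on_bilinear[OF \<open>open S\<close> bounded_bilinear_mult] i)
  qed (use Suc assms in auto)
qed

lemma smooth_on_cong: "open S \<Longrightarrow> (\<And>x. x \<in> S \<Longrightarrow> f x = g x) \<Longrightarrow> smooth_on S f \<Longrightarrow> smooth_on S g"
  unfolding smooth_on_def using Ck_on_cong by blast

lemma smooth_on_const: "open S \<Longrightarrow> smooth_on S (\<lambda>x. c)"
  by (simp add: smooth_on_def Ck_on_const)

lemma smooth_on_add: "open S \<Longrightarrow> smooth_on S f \<Longrightarrow> smooth_on S g \<Longrightarrow> smooth_on S (\<lambda>x. f x + g x)"
  by (simp add: smooth_on_def Ck_on_add)

lemma smooth_on_linear: "open S \<Longrightarrow> bounded_linear L \<Longrightarrow> smooth_on S f \<Longrightarrow> smooth_on S (\<lambda>x. L (f x))"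
  by (simp add: smooth_on_def Ck_on_linear)

lemma smooth_on_bilinear:
  "open S \<Longrightarrow> bounded_bilinear mul \<Longrightarrow> smooth_on S f \<Longrightarrow> smooth_on S g \<Longrightarrow> smooth_on S (\<lambda>x. mul (f x) (g x))"
  by (simp add: smooth_on_def Ck_on_bilinear)

lemma smooth_on_inverse:
  fixes f :: "'v::real_normed_vector \<Rightarrow> complex"
  shows "open S \<Longrightarrow> (\<And>x. x \<in> S \<Longrightarrow> f x \<noteq> 0) \<Longrightarrow> smooth_on S f \<Longrightarrow> smooth_on S (\<lambda>x. inverse (f x))"
  by (simp add: smooth_on_def Ck_on_inverse)

lemma smooth_on_sum:
  "open S \<Longrightarrow> (\<And>i. i \<in> I \<Longrightarrow> smooth_on S (f i)) \<Longrightarrow> smooth_on S (\<lambda>x. \<Sum>i\<in>I. f i x)"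
  by (induction I rule: infinite_finite_induct) (auto intro: smooth_on_const smooth_on_add)

lemma smooth_on_differentiable: "smooth_on S f \<Longrightarrow> x \<in> S \<Longrightarrow> f differentiable (at x)"
  unfolding smooth_on_def using Ck_on.simps(2)[of 0] by blast

lemma smooth_on_frechet_derivative: "smooth_on S f \<Longrightarrow> smooth_on S (\<lambda>x. frechet_derivative f (at x) v)"
proof -
  assume "smooth_on S f"
  then have "Ck_on (Suc k) S f" for k
    unfolding smooth_on_def by blast
  then show "smooth_on S (\<lambda>x. frechet_derivative f (at x) v)"
    unfolding smooth_on_def by simp
qed

lemma smooth_on_imp_continuous_on: "smooth_on S f \<Longrightarrow> continuous_on S f"
  unfolding smooth_on_def using Ck_on.simps(1) by blast

section \<open>Symmetry of second derivatives\<close>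

text \<open>Two applications of the mean value theorem to the second difference of \<open>g\<close>. The second difference is
  symmetric in \<open>v\<close> and \<open>w\<close>, which forces the symmetry of the second derivative in the limit \<open>h \<rightarrow> 0\<close>.\<close>
lemma second_difference_mean_value:
  fixes g :: "'v::real_normed_vector \<Rightarrow> real"
  assumes sm: "smooth_on S g" and "h > 0"
    and S: "\<And>s t. 0 \<le> s \<Longrightarrow> s \<le> h \<Longrightarrow> 0 \<le> t \<Longrightarrow> t \<le> h \<Longrightarrow> x + s *\<^sub>R v + t *\<^sub>R w \<in> S"
  obtains \<xi> \<tau> where "0 < \<xi>" "\<xi> < h" "0 < \<tau>" "\<tau> < h"
    "g (x + h *\<^sub>R v + h *\<^sub>R w) - g (x + h *\<^sub>R v) - g (x + h *\<^sub>R w) + g x =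
       h\<^sup>2 * frechet_derivative (\<lambda>y. frechet_derivative g (at y) v) (at (x + \<xi> *\<^sub>R v + \<tau> *\<^sub>R w)) w"
proof -
  have line: "((\<lambda>s. f (a + s *\<^sub>R e)) has_real_derivative frechet_derivative f (at (a + s *\<^sub>R e)) e) (at s)"
    if "smooth_on S f" "a + s *\<^sub>R e \<in> S" for f :: "'v \<Rightarrow> real" and a e s
  proof -
    have f: "(f has_derivative frechet_derivative f (at (a + s *\<^sub>R e))) (at (a + s *\<^sub>R e))"
      using smooth_on_differentiable[OF that] by (simp add: frechet_derivative_works)
    have "((\<lambda>s. a + s *\<^sub>R e) has_derivative (\<lambda>t. t *\<^sub>R e)) (at s)"
      by (auto intro!: derivative_eq_intros)
    from diff_chain_at[OF this f] have "((\<lambda>s. f (a + s *\<^sub>R e)) has_derivative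
        (\<lambda>t. frechet_derivative f (at (a + s *\<^sub>R e)) (t *\<^sub>R e))) (at s)"
      by (simp add: o_def)
    moreover have "frechet_derivative f (at (a + s *\<^sub>R e)) (t *\<^sub>R e) = frechet_derivative f (at (a + s *\<^sub>R e)) e * t" for t
      using has_derivative_linear[OF f] by (simp add: linear_cmul)
    ultimately show ?thesis
      by (simp add: has_field_derivative_def)
  qed
  define \<phi> where "\<phi> s = g ((x + h *\<^sub>R w) + s *\<^sub>R v) - g (x + s *\<^sub>R v)" for s
  define \<phi>' where "\<phi>' s = frechet_derivative g (at ((x + h *\<^sub>R w) + s *\<^sub>R v)) v
      - frechet_derivative g (at (x + s *\<^sub>R v)) v" for s
  have "DERIV \<phi> s :> \<phi>' s" if "0 \<le> s" "s \<le> h" for s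
    unfolding \<phi>_def \<phi>'_def
    by (rule DERIV_diff; rule line[OF sm]) (use S[of s h] S[of s 0] that \<open>h > 0\<close> in \<open>auto simp: add_ac\<close>)
  from MVT2[OF \<open>h > 0\<close> this] obtain \<xi> where \<xi>: "0 < \<xi>" "\<xi> < h" "\<phi> h - \<phi> 0 = h * \<phi>' \<xi>"
    by auto
  define \<psi> where "\<psi> t = frechet_derivative g (at ((x + \<xi> *\<^sub>R v) + t *\<^sub>R w)) v" for t
  have "DERIV \<psi> t :> frechet_derivative (\<lambda>y. frechet_derivative g (at y) v) (at ((x + \<xi> *\<^sub>R v) + t *\<^sub>R w)) w"
    if "0 \<le> t" "t \<le> h" for t
    unfolding \<psi>_def
    by (rule line[OF smooth_on_frechet_derivative[OF sm]]) (use S[of \<xi> t] that \<xi> in auto)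
  from MVT2[OF \<open>h > 0\<close> this] obtain \<tau> where \<tau>: "0 < \<tau>" "\<tau> < h" "\<psi> h - \<psi> 0 =
      h * frechet_derivative (\<lambda>y. frechet_derivative g (at y) v) (at ((x + \<xi> *\<^sub>R v) + \<tau> *\<^sub>R w)) w"
    by auto
  have "\<phi>' \<xi> = \<psi> h - \<psi> 0"
    by (simp add: \<phi>'_def \<psi>_def add_ac)
  with \<xi> \<tau> have "\<phi> h - \<phi> 0 = h\<^sup>2 * frechet_derivative (\<lambda>y. frechet_derivative g (at y) v) (at (x + \<xi> *\<^sub>R v + \<tau> *\<^sub>R w)) w"
    by (simp add: power2_eq_square)
  moreover have "\<phi> h - \<phi> 0 = g (x + h *\<^sub>R v + h *\<^sub>R w) - g (x + h *\<^sub>R v) - g (x + h *\<^sub>R w) + g x"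
    by (simp add: \<phi>_def add_ac)
  ultimately show ?thesis
    by (intro that[OF \<xi>(1,2) \<tau>(1,2)]) (simp only:)
qed

lemma symmetric_second_derivative_real:
  fixes g :: "'v::real_normed_vector \<Rightarrow> real"
  assumes "open S" "smooth_on S g" "x \<in> S"
  shows "frechet_derivative (\<lambda>y. frechet_derivative g (at y) v) (at x) w =
         frechet_derivative (\<lambda>y. frechet_derivative g (at y) w) (at x) v"
proof (rule ccontr)
  define D where "D v w y = frechet_derivative (\<lambda>y. frechet_derivative g (at y) v) (at y) w" for v w y
  assume "\<not> ?thesis"
  then have "\<bar>D v w x - D w v x\<bar> / 2 > 0"
    by (simp add: D_def)
  then obtain \<epsilon> where \<epsilon>: "\<epsilon> > 0" "\<epsilon> = \<bar>D v w x - D w v x\<bar> / 2"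
    by blast
  have "isCont (D a b) x" for a b
    using smooth_on_imp_continuous_on[OF smooth_on_frechet_derivative[OF smooth_on_frechet_derivative[OF assms(2)]]]
      assms(1,3) unfolding D_def by (simp add: continuous_on_eq_continuous_at)
  then have "\<exists>d>0. \<forall>y. dist y x < d \<longrightarrow> dist (D a b y) (D a b x) < \<epsilon>" for a b
    using \<epsilon>(1) unfolding continuous_at_eps_delta by blast
  from this[of v w] this[of w v] obtain d1 d2 where d: "d1 > 0" "d2 > 0"
      "\<And>y. dist y x < d1 \<Longrightarrow> dist (D v w y) (D v w x) < \<epsilon>"
      "\<And>y. dist y x < d2 \<Longrightarrow> dist (D w v y) (D w v x) < \<epsilon>"
    by blast
  obtain d3 where d3: "d3 > 0" "ball x d3 \<subseteq> S"
    using assms(1,3) openE by blast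
  define \<delta> where "\<delta> = min d1 (min d2 d3)"
  have "\<delta> > 0"
    using d d3 by (simp add: \<delta>_def)
  \<comment> \<open>small enough for the parallelogram with sides \<open>h v\<close>, \<open>h w\<close> to lie in the ball of radius \<open>\<delta>\<close>\<close>
  define h where "h = \<delta> / (2 * (norm v + norm w + 1))"
  have "h > 0"
    using \<open>\<delta> > 0\<close> by (simp add: h_def add_nonneg_pos)
  have near: "dist (x + s *\<^sub>R v + t *\<^sub>R w) x < \<delta>" if "0 \<le> s" "s \<le> h" "0 \<le> t" "t \<le> h" for s t
  proof -
    have "dist (x + s *\<^sub>R v + t *\<^sub>R w) x \<le> s * norm v + t * norm w"
      using norm_triangle_ineq[of "s *\<^sub>R v" "t *\<^sub>R w"] that by (simp add: dist_norm)
    also have "\<dots> \<le> h * norm v + h * norm w"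
      using that by (intro add_mono mult_right_mono) auto
    also have "\<dots> \<le> h * (norm v + norm w + 1)"
      using \<open>h > 0\<close> by (simp add: algebra_simps)
    also have "\<dots> = \<delta> / 2"
    proof -
      have "norm v + norm w + 1 > 0"
        by (simp add: add_nonneg_pos)
      then show ?thesis
        by (simp add: h_def field_simps)
    qed
    finally show ?thesis
      using \<open>\<delta> > 0\<close> by simp
  qed
  have S: "x + s *\<^sub>R v + t *\<^sub>R w \<in> S" if "0 \<le> s" "s \<le> h" "0 \<le> t" "t \<le> h" for s t
    using near[OF that] d3(2) by (auto simp: \<delta>_def dist_commute)
  obtain \<xi> \<tau> where 1: "0 < \<xi>" "\<xi> < h" "0 < \<tau>" "\<tau> < h"
    "g (x + h *\<^sub>R v + h *\<^sub>R w) - g (x + h *\<^sub>R v) - g (x + h *\<^sub>R w) + g x = h\<^sup>2 * D v w (x + \<xi> *\<^sub>R v + \<tau> *\<^sub>R w)"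
    by (rule second_difference_mean_value[OF assms(2) \<open>h > 0\<close> S, folded D_def])
  have S': "x + s *\<^sub>R w + t *\<^sub>R v \<in> S" if "0 \<le> s" "s \<le> h" "0 \<le> t" "t \<le> h" for s t
    using S[of t s] that by (simp add: add_ac)
  obtain \<xi>' \<tau>' where 2: "0 < \<xi>'" "\<xi>' < h" "0 < \<tau>'" "\<tau>' < h"
    "g (x + h *\<^sub>R w + h *\<^sub>R v) - g (x + h *\<^sub>R w) - g (x + h *\<^sub>R v) + g x = h\<^sup>2 * D w v (x + \<xi>' *\<^sub>R w + \<tau>' *\<^sub>R v)"
    by (rule second_difference_mean_value[OF assms(2) \<open>h > 0\<close> S', folded D_def])
  have "h\<^sup>2 * D v w (x + \<xi> *\<^sub>R v + \<tau> *\<^sub>R w) = h\<^sup>2 * D w v (x + \<xi>' *\<^sub>R w + \<tau>' *\<^sub>R v)"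
    unfolding 1(5)[symmetric] 2(5)[symmetric] by (simp add: add_ac)
  then have "D v w (x + \<xi> *\<^sub>R v + \<tau> *\<^sub>R w) = D w v (x + \<xi>' *\<^sub>R w + \<tau>' *\<^sub>R v)"
    using \<open>h > 0\<close> by simp
  moreover have "dist (D v w (x + \<xi> *\<^sub>R v + \<tau> *\<^sub>R w)) (D v w x) < \<epsilon>"
    using near[of \<xi> \<tau>] 1 by (intro d) (auto simp: \<delta>_def)
  ultimately have "dist (D w v (x + \<xi>' *\<^sub>R w + \<tau>' *\<^sub>R v)) (D v w x) < \<epsilon>"
    by (simp only:)
  moreover have "dist (D w v (x + \<xi>' *\<^sub>R w + \<tau>' *\<^sub>R v)) (D w v x) < \<epsilon>"
    using near[of \<tau>' \<xi>'] 2 by (intro d) (auto simp: \<delta>_def add_ac)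
  ultimately have "dist (D v w x) (D w v x) < 2 * \<epsilon>"
    using dist_triangle3[of "D v w x" "D w v x" "D w v (x + \<xi>' *\<^sub>R w + \<tau>' *\<^sub>R v)"] by linarith
  then show False
    by (simp add: \<epsilon>(2) dist_real_def)
qed

lemma symmetric_second_derivative:
  fixes f :: "'v::real_normed_vector \<Rightarrow> 'w::euclidean_space"
  assumes "open S" "smooth_on S f" "x \<in> S"
  shows "frechet_derivative (\<lambda>y. frechet_derivative f (at y) v) (at x) w =
         frechet_derivative (\<lambda>y. frechet_derivative f (at y) w) (at x) v"
proof (rule euclidean_eqI)
  fix b :: 'w
  have D: "frechet_derivative (\<lambda>y. g y \<bullet> b) (at y) u = frechet_derivative g (at y) u \<bullet> b"
    if "smooth_on S g" "y \<in> S" for g :: "'v \<Rightarrow> 'w" and y u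
  proof -
    have "(g has_derivative frechet_derivative g (at y)) (at y)"
      using smooth_on_differentiable[OF that] by (simp add: frechet_derivative_works)
    from frechet_derivative_eqI[OF has_derivative_inner_left[OF this]] show ?thesis
      by simp
  qed
  have DD: "frechet_derivative (\<lambda>y. frechet_derivative (\<lambda>z. f z \<bullet> b) (at y) u) (at x) u' =
      frechet_derivative (\<lambda>y. frechet_derivative f (at y) u) (at x) u' \<bullet> b" for u u'
  proof -
    have "frechet_derivative (\<lambda>y. frechet_derivative f (at y) u \<bullet> b) (at x) =
        frechet_derivative (\<lambda>y. frechet_derivative (\<lambda>z. f z \<bullet> b) (at y) u) (at x)"
    proof (rule frechet_derivative_transform_within_open[OF _ assms(1,3)])
      show "(\<lambda>y. frechet_derivative f (at y) u \<bullet> b) differentiable at x"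
      proof -
        have "(\<lambda>y. frechet_derivative f (at y) u) differentiable at x"
          by (rule smooth_on_differentiable[OF smooth_on_frechet_derivative[OF assms(2)] assms(3)])
        then show ?thesis
          unfolding differentiable_def using has_derivative_inner_left by blast
      qed
    qed (simp add: D[OF assms(2)])
    then show ?thesis
      by (simp only: D[OF smooth_on_frechet_derivative[OF assms(2)] assms(3), symmetric])
  qed
  have "smooth_on S (\<lambda>z. f z \<bullet> b)"
    by (rule smooth_on_linear[OF assms(1) bounded_linear_inner_left assms(2)])
  from symmetric_second_derivative_real[OF assms(1) this assms(3), of v w]
  show "frechet_derivative (\<lambda>y. frechet_derivative f (at y) v) (at x) w \<bullet> b =
      frechet_derivative (\<lambda>y. frechet_derivative f (at y) w) (at x) v \<bullet> b"
    unfolding DD .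
qed

section \<open>Wirtinger derivatives\<close>

definition complex_linear :: "(complex^'i::finite \<Rightarrow> complex^'j::finite) \<Rightarrow> bool" where
  "complex_linear L \<longleftrightarrow> (\<forall>a b. L (a + b) = L a + L b) \<and> (\<forall>k a. L (k *s a) = k *s L a)"

text \<open>Such maps exchange the two families of Wirtinger derivatives; they enter through the differentials of
  the conjugates of coordinate functions.\<close>
definition conj_linear :: "(complex^'i::finite \<Rightarrow> complex^'j::finite) \<Rightarrow> bool" where
  "conj_linear L \<longleftrightarrow> (\<forall>a b. L (a + b) = L a + L b) \<and> (\<forall>k a. L (k *s a) = cnj k *s L a)"

lemma scaleR_eq_smult: "r *\<^sub>R (a :: complex^'i::finite) = complex_of_real r *s a"
  unfolding vec_eq_iff vector_scaleR_component vector_smult_component by (simp add: scaleR_conv_of_real)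

lemma complex_linear_bounded_linear: "complex_linear L \<Longrightarrow> bounded_linear L"
  unfolding linear_conv_bounded_linear[symmetric]
  by (rule linearI) (simp_all add: complex_linear_def scaleR_eq_smult)

lemma conj_linear_bounded_linear: "conj_linear L \<Longrightarrow> bounded_linear L"
  unfolding linear_conv_bounded_linear[symmetric]
  by (rule linearI) (simp_all add: conj_linear_def scaleR_eq_smult)

lemma bounded_bilinear_wedge: "bounded_bilinear (wedge :: 'n::{finite,linorder} ext \<Rightarrow> _)"
  unfolding bilinear_conv_bounded_bilinear[symmetric] bilinear_def
  by (auto intro!: linearI simp: wedge_linear scaleR_eq_smult)

lemma complex_linear_scale: "complex_linear (\<lambda>a. k *s a)"
  by (simp add: complex_linear_def vec.scale_right_distrib vector_smult_assoc mult.commute)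

lemma complex_linear_wedge: "complex_linear (wedge a)"
  by (simp add: complex_linear_def wedge_linear)

lemma complex_linear_interior: "complex_linear (interior_dz i)"
  by (simp add: complex_linear_def interior_add interior_scale)

lemma complex_linear_component: "complex_linear (\<lambda>a. (a $ i) *s c)"
  by (simp add: complex_linear_def vec.scale_left_distrib vector_smult_assoc)

lemma conj_linear_component: "conj_linear (\<lambda>a. cnj (a $ i) *s c)"
  by (simp add: conj_linear_def vec.scale_left_distrib vector_smult_assoc)

text \<open>Both families of Wirtinger derivatives at once, so that \<open>\<partial>\<close> and \<open>\<partial>bar\<close> can be treated in parallel.\<close>
definition wirtinger :: "bool \<Rightarrow> 'n::finite \<Rightarrow> (complex^'n \<Rightarrow> complex^'i::finite) \<Rightarrow> complex^'n \<Rightarrow> complex^'i" where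
  "wirtinger b k f z = (1/2) *s (frechet_derivative f (at z) (axis k 1)
     + (if b then - \<i> else \<i>) *s frechet_derivative f (at z) (axis k \<i>))"

lemma wirtinger_True: "wirtinger True = wirt"
  by (intro ext) (simp add: wirtinger_def wirt_def)

lemma wirtinger_False: "wirtinger False = wirtbar"
  by (intro ext) (simp add: wirtinger_def wirtbar_def)

lemma wirtinger_eqI:
  "(f has_derivative D) (at z) \<Longrightarrow>
    wirtinger b k f z = (1/2) *s (D (axis k 1) + (if b then - \<i> else \<i>) *s D (axis k \<i>))"
  by (simp add: wirtinger_def frechet_derivative_eqI)

lemma differentiable_imp_has_derivative:
  "f differentiable (at z) \<Longrightarrow> (f has_derivative frechet_derivative f (at z)) (at z)"
  by (simp add: frechet_derivative_works)

lemma complex_linear_differentiable: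
  "complex_linear L \<Longrightarrow> f differentiable (at z) \<Longrightarrow> (\<lambda>w. L (f w)) differentiable (at z)"
  by (rule differentiableI[OF bounded_linear.has_derivative[OF complex_linear_bounded_linear differentiable_imp_has_derivative]])

lemma conj_linear_differentiable:
  "conj_linear L \<Longrightarrow> f differentiable (at z) \<Longrightarrow> (\<lambda>w. L (f w)) differentiable (at z)"
  by (rule differentiableI[OF bounded_linear.has_derivative[OF conj_linear_bounded_linear differentiable_imp_has_derivative]])

lemma wedge_differentiable:
  "f differentiable (at z) \<Longrightarrow> g differentiable (at z) \<Longrightarrow> (\<lambda>w. wedge (f w) (g w)) differentiable (at z)"
  by (rule differentiableI[OF bounded_bilinear.FDERIV[OF bounded_bilinear_wedge differentiable_imp_has_derivative differentiable_imp_has_derivative]])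

lemma wirtinger_const: "wirtinger b k (\<lambda>w. c) z = 0"
  by (subst wirtinger_eqI[OF has_derivative_const]) simp

lemma wirtinger_add:
  assumes "f differentiable (at z)" "g differentiable (at z)"
  shows "wirtinger b k (\<lambda>w. f w + g w) z = wirtinger b k f z + wirtinger b k g z"
  by (subst wirtinger_eqI[OF has_derivative_add[OF assms[THEN differentiable_imp_has_derivative]]])
    (simp add: wirtinger_def vec.scale_right_distrib add_ac)

lemma wirtinger_complex_linear:
  assumes "complex_linear L" "f differentiable (at z)"
  shows "wirtinger b k (\<lambda>w. L (f w)) z = L (wirtinger b k f z)"
  using assms(1)
  by (subst wirtinger_eqI[OF bounded_linear.has_derivative[OF complex_linear_bounded_linear[OF assms(1)]
        differentiable_imp_has_derivative[OF assms(2)]]])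
    (simp add: wirtinger_def complex_linear_def del: vec.scale_minus_left)

lemma wirtinger_conj_linear:
  assumes "conj_linear L" "f differentiable (at z)"
  shows "wirtinger b k (\<lambda>w. L (f w)) z = L (wirtinger (\<not> b) k f z)"
  using assms(1)
  by (subst wirtinger_eqI[OF bounded_linear.has_derivative[OF conj_linear_bounded_linear[OF assms(1)]
        differentiable_imp_has_derivative[OF assms(2)]]])
    (simp add: wirtinger_def conj_linear_def del: vec.scale_minus_left)

lemma wirtinger_wedge:
  assumes "f differentiable (at z)" "g differentiable (at z)"
  shows "wirtinger b k (\<lambda>w. wedge (f w) (g w)) z = wedge (wirtinger b k f z) (g z) + wedge (f z) (wirtinger b k g z)"
  by (subst wirtinger_eqI[OF bounded_bilinear.FDERIV[OF bounded_bilinear_wedge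
        assms[THEN differentiable_imp_has_derivative]]])
    (simp add: wirtinger_def wedge_linear vec.scale_right_distrib add_ac del: vec.scale_minus_left)

lemma wirtinger_transform:
  assumes "f differentiable (at z)" "open S" "z \<in> S" "\<And>w. w \<in> S \<Longrightarrow> f w = g w"
  shows "wirtinger b k f z = wirtinger b k g z"
  using frechet_derivative_transform_within_open[OF assms] by (simp add: wirtinger_def)

lemma differentiable_sum_fun:
  assumes "finite I" "\<And>i. i \<in> I \<Longrightarrow> f i differentiable (at z)"
  shows "(\<lambda>w. \<Sum>i\<in>I. f i w) differentiable (at z)"
  using assms by (simp add: differentiable_sum)

lemma wirtinger_sum:
  assumes "finite I" "\<And>i. i \<in> I \<Longrightarrow> f i differentiable (at z)"
  shows "wirtinger b k (\<lambda>w. \<Sum>i\<in>I. f i w) z = (\<Sum>i\<in>I. wirtinger b k (f i) z)"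
  using assms
proof (induction I rule: finite_induct)
  case empty
  then show ?case by (simp add: wirtinger_const)
next
  case (insert i I)
  then show ?case
    by (simp add: wirtinger_add differentiable_sum_fun)
qed

lemma smooth_on_complex_linear: "open S \<Longrightarrow> complex_linear L \<Longrightarrow> smooth_on S f \<Longrightarrow> smooth_on S (\<lambda>x. L (f x))"
  by (rule smooth_on_linear[OF _ complex_linear_bounded_linear])

lemma smooth_on_wedge:
  "open S \<Longrightarrow> smooth_on S f \<Longrightarrow> smooth_on S g \<Longrightarrow> smooth_on S (\<lambda>x. wedge (f x) (g x))"
  by (rule smooth_on_bilinear[OF _ bounded_bilinear_wedge])

lemma smooth_on_wirtinger:
  assumes "open S" "smooth_on S f" shows "smooth_on S (wirtinger b k f)"
  unfolding wirtinger_def[abs_def]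
  by (rule smooth_on_complex_linear[OF assms(1) complex_linear_scale],
      rule smooth_on_add[OF assms(1) smooth_on_frechet_derivative[OF assms(2)]],
      rule smooth_on_complex_linear[OF assms(1) complex_linear_scale],
      rule smooth_on_frechet_derivative[OF assms(2)])

lemma wirtinger_commute:
  assumes "open S" "smooth_on S f" "z \<in> S"
  shows "wirtinger b k (wirtinger b' l f) z = wirtinger b' l (wirtinger b k f) z"
proof -
  define H where "H v w = frechet_derivative (\<lambda>y. frechet_derivative f (at y) v) (at z) w" for v w
  have sym: "H v w = H w v" for v w
    unfolding H_def by (rule symmetric_second_derivative[OF assms])
  have "(wirtinger b l f has_derivative
      (\<lambda>w. (1/2) *s (H (axis l 1) w + (if b then - \<i> else \<i>) *s H (axis l \<i>) w))) (at z)" for b l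
  proof -
    have d: "((\<lambda>y. frechet_derivative f (at y) v) has_derivative H v) (at z)" for v
      unfolding H_def
      by (rule differentiable_imp_has_derivative[OF smooth_on_differentiable[OF smooth_on_frechet_derivative[OF assms(2)] assms(3)]])
    show ?thesis
      unfolding wirtinger_def[abs_def]
      by (intro bounded_linear.has_derivative[OF complex_linear_bounded_linear[OF complex_linear_scale]]
          has_derivative_add d)
  qed
  note w = wirtinger_eqI[OF this]
  show ?thesis
    unfolding w sym[of "axis k _" "axis l _"]
    by (simp add: vec.scale_right_distrib vector_smult_assoc mult.commute add_ac del: vec.scale_minus_left)
qed

text \<open>The two families of Wirtinger derivatives determine the real derivative. This reduces the complex
  chain rule to the real one.\<close>
lemma real_linear_wirtinger_decomp:
  fixes D :: "complex^'n::finite \<Rightarrow> complex^'i::finite"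
  assumes "linear D"
  shows "D v = (\<Sum>i\<in>UNIV. (v $ i) *s ((1/2) *s (D (axis i 1) + (- \<i>) *s D (axis i \<i>)))
                + cnj (v $ i) *s ((1/2) *s (D (axis i 1) + \<i> *s D (axis i \<i>))))"
proof -
  have ax: "axis i c = Re c *\<^sub>R axis i 1 + Im c *\<^sub>R axis i \<i>" for i :: 'n and c
    by (auto simp: vec_eq_iff axis_def complex_eq_iff)
  have "v = (\<Sum>i\<in>UNIV. axis i (v $ i))"
    by (simp add: vec_eq_iff axis_def)
  then have "D v = (\<Sum>i\<in>UNIV. D (axis i (v $ i)))"
    by (metis (no_types, lifting) assms linear_sum sum.cong)
  also have "\<dots> = (\<Sum>i\<in>UNIV. (v $ i) *s ((1/2) *s (D (axis i 1) + (- \<i>) *s D (axis i \<i>)))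
                + cnj (v $ i) *s ((1/2) *s (D (axis i 1) + \<i> *s D (axis i \<i>))))"
  proof (rule sum.cong[OF refl])
    fix i
    have "D (axis i (v $ i)) = of_real (Re (v $ i)) *s D (axis i 1) + of_real (Im (v $ i)) *s D (axis i \<i>)"
      by (subst ax) (simp only: linear_add[OF assms] linear_cmul[OF assms], simp only: scaleR_eq_smult)
    then show "D (axis i (v $ i)) = (v $ i) *s ((1/2) *s (D (axis i 1) + (- \<i>) *s D (axis i \<i>)))
                + cnj (v $ i) *s ((1/2) *s (D (axis i 1) + \<i> *s D (axis i \<i>)))"
      by (simp add: vec_eq_iff complex_eq_iff field_simps)
  qed
  finally show ?thesis .
qed

text \<open>For holomorphic \<open>\<tau>\<close> the real derivative is complex-linear, so the two families of derivatives of \<open>g\<close> do not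
  mix.\<close>
lemma wirtinger_chain:
  fixes \<tau> :: "complex^'n::finite \<Rightarrow> complex^'m::finite" and g :: "complex^'m \<Rightarrow> complex^'i::finite"
  assumes \<tau>: "\<tau> differentiable (at z)" and hol: "\<And>k. wirtbar k \<tau> z = 0" and g: "g differentiable (at (\<tau> z))"
  shows "wirtinger b k (\<lambda>w. g (\<tau> w)) z =
    (\<Sum>i\<in>UNIV. (if b then wirt k \<tau> z $ i else cnj (wirt k \<tau> z $ i)) *s wirtinger b i g (\<tau> z))"
proof -
  define D where "D = frechet_derivative g (at (\<tau> z))"
  define p q where "p = frechet_derivative \<tau> (at z) (axis k 1)" and "q = frechet_derivative \<tau> (at z) (axis k \<i>)"
  have D: "(g has_derivative D) (at (\<tau> z))"
    unfolding D_def by (rule differentiable_imp_has_derivative[OF g])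
  \<comment> \<open>the Cauchy-Riemann equations\<close>
  have "q = \<i> *s p"
  proof -
    have "(1/2) *s (p + \<i> *s q) = 0"
      using hol[of k] by (simp only: wirtbar_def p_def q_def)
    then have "p + \<i> *s q = 0"
      by (simp only: vec.scale_eq_0_iff) simp
    then have "\<i> *s (p + \<i> *s q) = 0"
      by simp
    then show ?thesis
      by (simp add: vec.scale_right_distrib vector_smult_assoc)
  qed
  then have wp: "wirt k \<tau> z = p"
    by (simp add: wirt_def p_def[symmetric] q_def[symmetric] vector_smult_assoc)
       (simp add: vec_eq_iff)
  have chain: "wirtinger b k (\<lambda>w. g (\<tau> w)) z = (1/2) *s (D p + (if b then - \<i> else \<i>) *s D (\<i> *s p))"
    using wirtinger_eqI[OF diff_chain_at[OF differentiable_imp_has_derivative[OF \<tau>] D], of b k] \<open>q = \<i> *s p\<close>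
    by (simp add: o_def p_def q_def)
  define P Q where "P i = (1/2) *s (D (axis i 1) + (- \<i>) *s D (axis i \<i>))"
    and "Q i = (1/2) *s (D (axis i 1) + \<i> *s D (axis i \<i>))" for i
  have Dv: "D v = (\<Sum>i\<in>UNIV. (v $ i) *s P i + cnj (v $ i) *s Q i)" for v
    unfolding P_def Q_def by (rule real_linear_wirtinger_decomp[OF has_derivative_linear[OF D]])
  have PQ: "wirtinger b i g (\<tau> z) = (if b then P i else Q i)" for i
    by (simp add: wirtinger_def P_def Q_def D_def)
  have "(1/2) *s (D p + (if b then - \<i> else \<i>) *s D (\<i> *s p)) =
     (\<Sum>i\<in>UNIV. (1/2) *s (((p $ i) *s P i + cnj (p $ i) *s Q i) + (if b then - \<i> else \<i>) *s
       ((\<i> * p $ i) *s P i + cnj (\<i> * p $ i) *s Q i)))"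
    unfolding Dv by (simp add: vec.scale_sum_right sum.distrib[symmetric] vec.scale_right_distrib del: vec.scale_minus_left)
  also have "\<dots> = (\<Sum>i\<in>UNIV. (if b then p $ i else cnj (p $ i)) *s wirtinger b i g (\<tau> z))"
    unfolding PQ by (rule sum.cong[OF refl]) (simp add: vec_eq_iff algebra_simps)
  finally show ?thesis
    unfolding chain wp .
qed

section \<open>The operators \<open>\<partial>\<close> and \<open>\<partial>bar\<close> in coordinates\<close>

text \<open>The one-forms that belong to the derivatives \<open>wirtinger b\<close>.\<close>
definition coframe :: "bool \<Rightarrow> 'n::finite \<Rightarrow> 'n ext" where
  "coframe b k = (if b then dz k else dzbar k)"

definition local_dd :: "bool \<Rightarrow> ('n::{finite,linorder} cspace \<Rightarrow> 'n ext) \<Rightarrow> 'n cspace \<Rightarrow> 'n ext" where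
  "local_dd b f z = (\<Sum>k\<in>UNIV. wedge (coframe b k) (wirtinger b k f z))"

lemma local_dd_True: "local_dd True = local_del"
  by (intro ext) (simp add: local_dd_def local_del_def coframe_def wirtinger_True)

lemma local_dd_False: "local_dd False = local_delbar"
  by (intro ext) (simp add: local_dd_def local_delbar_def coframe_def wirtinger_False)

lemma bideg_coframe: "bideg (if b then 1 else 0) (if b then 0 else 1) (coframe b k)"
  by (simp add: coframe_def bideg_dz bideg_dzbar)

lemma coframe_anticommute: "wedge (coframe b k) (coframe b' l) = - wedge (coframe b' l) (coframe b k)"
  by (rule trans[OF wedge_commute[OF bideg_coframe bideg_coframe]]) simp

lemma coframe_wedge_commute:
  "bideg p q a \<Longrightarrow> wedge (coframe b k) a = (if even (p + q) then 1 else -1) *s wedge a (coframe b k)"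
  by (rule trans[OF wedge_commute[OF bideg_coframe]], assumption) (auto simp del: even_add odd_add)

lemma local_dd_const: "local_dd b (\<lambda>w. c) z = 0"
  by (simp add: local_dd_def wirtinger_const)

lemma local_dd_add:
  "f differentiable (at z) \<Longrightarrow> g differentiable (at z) \<Longrightarrow>
    local_dd b (\<lambda>w. f w + g w) z = local_dd b f z + local_dd b g z"
  by (simp add: local_dd_def wirtinger_add wedge_linear sum.distrib)

lemma local_dd_scale:
  "f differentiable (at z) \<Longrightarrow> local_dd b (\<lambda>w. s *s f w) z = s *s local_dd b f z"
  by (simp add: local_dd_def wirtinger_complex_linear[OF complex_linear_scale] wedge_linear vec.scale_sum_right)

lemma local_dd_sum:
  assumes "finite I" "\<And>i. i \<in> I \<Longrightarrow> f i differentiable (at z)"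
  shows "local_dd b (\<lambda>w. \<Sum>i\<in>I. f i w) z = (\<Sum>i\<in>I. local_dd b (f i) z)"
proof -
  have "wirtinger b k (\<lambda>w. \<Sum>i\<in>I. f i w) z = (\<Sum>i\<in>I. wirtinger b k (f i) z)" for k
    by (rule wirtinger_sum[OF assms])
  then show ?thesis
    by (simp only: local_dd_def wedge_sum_right) (rule sum.swap)
qed

lemma local_dd_transform:
  assumes "f differentiable (at z)" "open S" "z \<in> S" "\<And>w. w \<in> S \<Longrightarrow> f w = g w"
  shows "local_dd b f z = local_dd b g z"
  by (simp only: local_dd_def wirtinger_transform[OF assms])

lemma smooth_on_local_dd:
  assumes "open S" "smooth_on S f" shows "smooth_on S (local_dd b f)"
  unfolding local_dd_def[abs_def]
  by (rule smooth_on_sum[OF assms(1)], rule smooth_on_complex_linear[OF assms(1) complex_linear_wedge],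
      rule smooth_on_wirtinger[OF assms])

lemma local_dd_leibniz:
  assumes "f differentiable (at z)" "g differentiable (at z)" "bideg p q (f z)"
  shows "local_dd b (\<lambda>w. wedge (f w) (g w)) z =
    wedge (local_dd b f z) (g z) + (if even (p + q) then 1 else -1) *s wedge (f z) (local_dd b g z)"
proof -
  have "wedge (coframe b k) (wedge (f z) (wirtinger b k g z)) =
      (if even (p + q) then 1 else -1) *s wedge (f z) (wedge (coframe b k) (wirtinger b k g z))" for k
    by (simp add: wedge_assoc[symmetric] coframe_wedge_commute[OF assms(3)] wedge_linear)
  then show ?thesis
    unfolding local_dd_def wirtinger_wedge[OF assms(1,2)] wedge_add_right sum.distrib wedge_sum_left
      wedge_sum_right vec.scale_sum_right wedge_assoc by simp
qed

lemma local_dd_anticommute: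
  assumes "open S" "smooth_on S f" "z \<in> S"
  shows "local_dd b (local_dd b' f) z = - local_dd b' (local_dd b f) z"
proof -
  have expand: "local_dd b (local_dd b' f) z =
      (\<Sum>k\<in>UNIV. \<Sum>l\<in>UNIV. wedge (wedge (coframe b k) (coframe b' l)) (wirtinger b k (wirtinger b' l f) z))" for b b'
  proof -
    have d: "wirtinger b' l f differentiable (at z)" for l
      by (rule smooth_on_differentiable[OF smooth_on_wirtinger[OF assms(1,2)] assms(3)])
    have "wirtinger b k (local_dd b' f) z = (\<Sum>l\<in>UNIV. wedge (coframe b' l) (wirtinger b k (wirtinger b' l f) z))" for k
      unfolding local_dd_def[abs_def]
      by (subst wirtinger_sum)
        (simp_all add: wirtinger_complex_linear[OF complex_linear_wedge d]
          complex_linear_differentiable[OF complex_linear_wedge d])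
    then show ?thesis
      by (simp add: local_dd_def[of b "local_dd b' f"] wedge_sum_right wedge_assoc)
  qed
  have "local_dd b (local_dd b' f) z =
      (\<Sum>l\<in>UNIV. \<Sum>k\<in>UNIV. wedge (wedge (coframe b k) (coframe b' l)) (wirtinger b k (wirtinger b' l f) z))"
    unfolding expand by (rule sum.swap)
  also have "\<dots> = (\<Sum>l\<in>UNIV. \<Sum>k\<in>UNIV. - wedge (wedge (coframe b' l) (coframe b k)) (wirtinger b' l (wirtinger b k f) z))"
    by (intro sum.cong refl) (simp only: coframe_anticommute[of b _ b'] wirtinger_commute[OF assms, of b _ b'] wedge_minus_left)
  also have "\<dots> = - local_dd b' (local_dd b f) z"
    unfolding expand by (simp add: sum_negf)
  finally show ?thesis .
qed

lemma local_dd_square: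
  assumes "open S" "smooth_on S f" "z \<in> S"
  shows "local_dd b (local_dd b f) z = 0"
proof -
  have "local_dd b (local_dd b f) z $ i = - (local_dd b (local_dd b f) z $ i)" for i
    by (subst local_dd_anticommute[OF assms]) simp
  then show ?thesis
    by (auto simp: vec_eq_iff intro: complex_eq_minus_self)
qed

lemma bideg_wirtinger:
  fixes f :: "complex^'m::finite \<Rightarrow> 'n::{finite,linorder} ext"
  assumes "f differentiable (at z)" "\<And>w. bideg p q (f w)"
  shows "bideg p q (wirtinger b k f z)"
  unfolding bideg_def
proof (intro allI impI)
  fix I J
  assume nz: "wirtinger b k f z $ (I, J) \<noteq> 0"
  have "\<exists>w. f w $ (I, J) \<noteq> 0"
  proof (rule ccontr)
    assume "\<not> ?thesis"
    then have "(\<lambda>w. (f w $ (I, J)) *s axis (I, J) 1) = (\<lambda>w. 0)"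
      by simp
    then have "wirtinger b k (\<lambda>w. (f w $ (I, J)) *s axis (I, J) 1) z = 0"
      by (simp add: wirtinger_const)
    then have "(wirtinger b k f z $ (I, J)) *s axis (I, J) (1::complex) = 0"
      unfolding wirtinger_complex_linear[OF complex_linear_component assms(1)] .
    then show False
      using nz by (simp add: axis_eq_0_iff)
  qed
  then show "int (card I) = p \<and> int (card J) = q"
    using assms(2) by (auto simp: bideg_def)
qed

text \<open>The bidegree is required at all points, not only at \<open>z\<close>: a coefficient that vanishes only at \<open>z\<close> may
  have a nonzero derivative there.\<close>
lemma bideg_local_dd:
  assumes "f differentiable (at z)" "\<And>w. bideg p q (f w)"
  shows "bideg (p + (if b then 1 else 0)) (q + (if b then 0 else 1)) (local_dd b f z)"
  unfolding local_dd_def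
  using bideg_wedge[OF bideg_coframe bideg_wirtinger[OF assms]] by (intro bideg_sum) (simp add: add.commute)

text \<open>\<open>\<partial>/\<partial>z\<^sub>i\<close> is a holomorphic vector field.\<close>
lemma interior_local_delbar:
  assumes "f differentiable (at z)"
  shows "interior_dz i (local_dd False f z) = - local_dd False (\<lambda>w. interior_dz i (f w)) z"
  by (simp add: local_dd_def interior_sum coframe_def interior_dzbar_wedge sum_negf
      wirtinger_complex_linear[OF complex_linear_interior assms])

section \<open>Pullback along holomorphic maps\<close>

lemma ext_subst_eq_sum_wedge:
  "ext_subst \<eta> \<mu> a = (\<Sum>S\<in>UNIV. wedge ((a $ S) *s ext_one) (wedge (wedge_over \<eta> (fst S)) (wedge_over \<mu> (snd S))))"
  by (simp add: ext_subst_def case_prod_unfold wedge_linear)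

locale holomorphic_map =
  fixes S :: "'n::{finite,linorder} cspace set" and \<tau> :: "'n cspace \<Rightarrow> 'n cspace"
  assumes open_domain: "open S" and holomorphic: "holomorphic_map_on S \<tau>"
begin

definition pull_dz :: "'n cspace \<Rightarrow> 'n \<Rightarrow> 'n ext" where
  "pull_dz w i = (\<Sum>j\<in>UNIV. (wirt j \<tau> w $ i) *s dz j)"

definition pull_dzbar :: "'n cspace \<Rightarrow> 'n \<Rightarrow> 'n ext" where
  "pull_dzbar w i = (\<Sum>j\<in>UNIV. cnj (wirt j \<tau> w $ i) *s dzbar j)"

lemma pullback_eq: "pullback \<tau> w = ext_subst (pull_dz w) (pull_dzbar w)"
  unfolding pullback_eq_ext_subst pull_dz_def[abs_def] pull_dzbar_def[abs_def] by (rule refl)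

sublocale subst: one_form_subst "pull_dz w" "pull_dzbar w" for w
  by unfold_locales (auto simp: pull_dz_def pull_dzbar_def intro!: bideg_sum bideg_scale bideg_dz bideg_dzbar)

lemma smooth_tau: "smooth_on S \<tau>"
  using holomorphic by (simp add: holomorphic_map_on_def)

lemma wirtbar_tau: "z \<in> S \<Longrightarrow> wirtbar k \<tau> z = 0"
  using holomorphic by (simp add: holomorphic_map_on_def)

lemma smooth_wirt_tau: "smooth_on S (wirt k \<tau>)"
  using smooth_on_wirtinger[OF open_domain smooth_tau, of True] by (simp add: wirtinger_True)

lemma smooth_pull_dz: "smooth_on S (\<lambda>w. pull_dz w i)"
  unfolding pull_dz_def
  by (rule smooth_on_sum[OF open_domain],
      rule smooth_on_complex_linear[OF open_domain complex_linear_component smooth_wirt_tau])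

lemma smooth_pull_dzbar: "smooth_on S (\<lambda>w. pull_dzbar w i)"
  unfolding pull_dzbar_def
  by (rule smooth_on_sum[OF open_domain],
      rule smooth_on_linear[OF open_domain conj_linear_bounded_linear[OF conj_linear_component] smooth_wirt_tau])

lemma wirtbar_wirt_tau:
  assumes "z \<in> S" shows "wirtbar k (wirt j \<tau>) z = 0"
proof -
  have "wirtbar k (wirt j \<tau>) z = wirt j (wirtbar k \<tau>) z"
    using wirtinger_commute[OF open_domain smooth_tau assms, of False k True j]
    by (simp add: wirtinger_True wirtinger_False)
  also have "\<dots> = wirt j (\<lambda>w. 0) z"
    using wirtinger_transform[OF _ open_domain assms, of "\<lambda>w. 0" "wirtbar k \<tau>" True j] wirtbar_tau
    by (simp add: wirtinger_True)
  finally show ?thesis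
    using wirtinger_const[of True j 0 z] by (simp add: wirtinger_True)
qed

text \<open>The coefficients will be the second derivatives of a component of \<open>\<tau>\<close>.\<close>
lemma symmetric_wedge_sum_zero:
  fixes c :: "'n \<Rightarrow> 'n \<Rightarrow> complex"
  assumes "\<And>k j. c k j = c j k"
  shows "(\<Sum>k\<in>UNIV. \<Sum>j\<in>UNIV. c k j *s wedge (coframe b k) (coframe b j)) = 0"
proof -
  let ?s = "\<Sum>k\<in>UNIV. \<Sum>j\<in>UNIV. c k j *s wedge (coframe b k) (coframe b j)"
  have "?s = (\<Sum>j\<in>UNIV. \<Sum>k\<in>UNIV. c k j *s wedge (coframe b k) (coframe b j))"
    by (rule sum.swap)
  also have "\<dots> = (\<Sum>j\<in>UNIV. \<Sum>k\<in>UNIV. - (c j k *s wedge (coframe b j) (coframe b k)))"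
  proof (intro sum.cong refl)
    show "c k j *s wedge (coframe b k) (coframe b j) = - (c j k *s wedge (coframe b j) (coframe b k))" for j k
      by (simp only: assms[of k j] coframe_anticommute[of b k b j] vec.scale_minus_right)
  qed
  also have "\<dots> = - ?s"
    by (simp add: sum_negf)
  finally have "?s = - ?s" .
  from arg_cong[OF this, of "\<lambda>v. v $ i" for i] have "?s $ i = - (?s $ i)" for i
    by (simp only: vector_uminus_component)
  then have "?s $ i = 0" for i
    by (rule complex_eq_minus_self)
  then show ?thesis
    unfolding vec_eq_iff zero_index by blast
qed

lemma local_dd_pull_dz:
  assumes "z \<in> S" shows "local_dd b (\<lambda>w. pull_dz w i) z = 0"
proof -
  have d: "wirt j \<tau> differentiable (at z)" for j
    by (rule smooth_on_differentiable[OF smooth_wirt_tau assms])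
  have d': "(\<lambda>w. (wirt j \<tau> w $ i) *s dz j) differentiable (at z)" for j
    by (rule complex_linear_differentiable[OF complex_linear_component d])
  have "local_dd b (\<lambda>w. pull_dz w i) z =
      (\<Sum>k\<in>UNIV. \<Sum>j\<in>UNIV. (wirtinger b k (wirt j \<tau>) z $ i) *s wedge (coframe b k) (coframe True j))"
    unfolding local_dd_def pull_dz_def
    by (simp add: wirtinger_sum d' wirtinger_complex_linear[OF complex_linear_component d] wedge_linear coframe_def)
  also have "\<dots> = 0"
  proof (cases b)
    case True
    have "wirtinger True k (wirt j \<tau>) z = wirtinger True j (wirt k \<tau>) z" for j k
      using wirtinger_commute[OF open_domain smooth_tau assms, of True k True j] by (simp only: wirtinger_True)
    with True show ?thesis
      using symmetric_wedge_sum_zero[of "\<lambda>k j. wirtinger True k (wirt j \<tau>) z $ i" True] by simp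
  next
    case False
    then show ?thesis
      by (simp add: wirtinger_False wirtbar_wirt_tau[OF assms])
  qed
  finally show ?thesis .
qed

lemma local_dd_pull_dzbar:
  assumes "z \<in> S" shows "local_dd b (\<lambda>w. pull_dzbar w i) z = 0"
proof -
  have d: "wirt j \<tau> differentiable (at z)" for j
    by (rule smooth_on_differentiable[OF smooth_wirt_tau assms])
  have d': "(\<lambda>w. cnj (wirt j \<tau> w $ i) *s dzbar j) differentiable (at z)" for j
    by (rule conj_linear_differentiable[OF conj_linear_component d])
  have "local_dd b (\<lambda>w. pull_dzbar w i) z =
      (\<Sum>k\<in>UNIV. \<Sum>j\<in>UNIV. cnj (wirtinger (\<not> b) k (wirt j \<tau>) z $ i) *s wedge (coframe b k) (coframe False j))"
    unfolding local_dd_def pull_dzbar_def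
    by (simp add: wirtinger_sum d' wirtinger_conj_linear[OF conj_linear_component d] wedge_linear coframe_def)
  also have "\<dots> = 0"
  proof (cases b)
    case True
    then show ?thesis
      by (simp add: wirtinger_False wirtbar_wirt_tau[OF assms])
  next
    case False
    have "wirtinger True k (wirt j \<tau>) z = wirtinger True j (wirt k \<tau>) z" for j k
      using wirtinger_commute[OF open_domain smooth_tau assms, of True k True j] by (simp only: wirtinger_True)
    with False show ?thesis
      using symmetric_wedge_sum_zero[of "\<lambda>k j. cnj (wirtinger True k (wirt j \<tau>) z $ i)" False] by simp
  qed
  finally show ?thesis .
qed

text \<open>Products of closed one-forms are closed, by the Leibniz rule.\<close>
lemma smooth_wedge_over:
  assumes sm: "\<And>i. smooth_on S (\<lambda>w. \<eta> w i)" and bd: "\<And>w i. bideg p q (\<eta> w i)" and odd: "odd (p + q)"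
    and closed: "\<And>i z. z \<in> S \<Longrightarrow> local_dd b (\<lambda>w. \<eta> w i) z = 0"
  shows "smooth_on S (\<lambda>w. wedge_over (\<eta> w) I) \<and> (\<forall>z\<in>S. local_dd b (\<lambda>w. wedge_over (\<eta> w) I) z = 0)"
proof (induction I rule: finite_induct[OF finite])
  case 1
  then show ?case
    by (simp add: smooth_on_const[OF open_domain] local_dd_const)
next
  case (2 k I)
  have anti: "wedge (\<eta> w i) (\<eta> w j) = - wedge (\<eta> w j) (\<eta> w i)" for w i j
    using odd by (rule_tac trans[OF wedge_commute[OF bd bd]]) simp
  have eq: "(\<lambda>w. wedge_over (\<eta> w) (insert k I)) = (\<lambda>w. shuffle_sign {k} I *s wedge (\<eta> w k) (wedge_over (\<eta> w) I))"
    by (rule ext, rule wedge_over_insert[OF anti 2(2)])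
  have sm1: "smooth_on S (\<lambda>w. wedge (\<eta> w k) (wedge_over (\<eta> w) I))"
    by (rule smooth_on_wedge[OF open_domain sm]) (use 2 in blast)
  have "local_dd b (\<lambda>w. wedge (\<eta> w k) (wedge_over (\<eta> w) I)) z = 0" if "z \<in> S" for z
  proof -
    have "(\<lambda>w. wedge_over (\<eta> w) I) differentiable (at z)"
      by (rule smooth_on_differentiable[OF _ that]) (use 2 in blast)
    from local_dd_leibniz[OF smooth_on_differentiable[OF sm that] this bd] show ?thesis
      using 2 that by (simp add: closed)
  qed
  then show ?case
    unfolding eq
    by (simp add: local_dd_scale smooth_on_differentiable[OF sm1]
        smooth_on_complex_linear[OF open_domain complex_linear_scale sm1])
qed

lemma pull_wedge_over:
  fixes I J
  defines "W \<equiv> \<lambda>w. wedge (wedge_over (pull_dz w) I) (wedge_over (pull_dzbar w) J)"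
  shows "smooth_on S W" and "z \<in> S \<Longrightarrow> local_dd b W z = 0"
proof -
  have 1: "smooth_on S (\<lambda>w. wedge_over (pull_dz w) I) \<and> (\<forall>z\<in>S. local_dd b (\<lambda>w. wedge_over (pull_dz w) I) z = 0)" for b
    by (rule smooth_wedge_over[OF smooth_pull_dz subst.bideg_eta _ local_dd_pull_dz]) simp_all
  have 2: "smooth_on S (\<lambda>w. wedge_over (pull_dzbar w) J) \<and> (\<forall>z\<in>S. local_dd b (\<lambda>w. wedge_over (pull_dzbar w) J) z = 0)" for b
    by (rule smooth_wedge_over[OF smooth_pull_dzbar subst.bideg_mu _ local_dd_pull_dzbar]) simp_all
  show "smooth_on S W"
    unfolding W_def by (rule smooth_on_wedge[OF open_domain]) (use 1 2 in blast)+
  show "local_dd b W z = 0" if "z \<in> S"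
    unfolding W_def
    by (subst local_dd_leibniz[OF smooth_on_differentiable[OF _ that] smooth_on_differentiable[OF _ that]
          subst.bideg_wedge_over_eta])
      (use 1 2 that in auto)
qed

lemma differentiable_comp_tau:
  assumes "z \<in> S" "g differentiable (at (\<tau> z))"
  shows "(\<lambda>w. g (\<tau> w)) differentiable (at z)"
  using differentiable_chain_at[OF smooth_on_differentiable[OF smooth_tau assms(1)] assms(2)]
  by (simp add: o_def)

text \<open>The pulled back monomials in the \<open>dz\<^sub>i\<close> and \<open>dzbar\<^sub>i\<close> are annihilated by both operators, so only the
  coefficients are differentiated; for these the chain rule turns \<open>dz\<^sub>k\<close> into the pullback of \<open>dz\<^sub>i\<close>.\<close>
lemma local_dd_pullback:
  assumes z: "z \<in> S" and g: "g differentiable (at (\<tau> z))"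
  shows "local_dd b (\<lambda>w. pullback \<tau> w (g (\<tau> w))) z = pullback \<tau> z (local_dd b g (\<tau> z))"
proof -
  define W where "W P w = wedge (wedge_over (pull_dz w) (fst P)) (wedge_over (pull_dzbar w) (snd P))" for P w
  define G where "G i = (if b then pull_dz z i else pull_dzbar z i)" for i
  have W: "smooth_on S (W P)" "local_dd b (W P) z = 0" for P
    unfolding W_def[abs_def] by (rule pull_wedge_over(1), rule pull_wedge_over(2)[OF z])
  have dg: "(\<lambda>w. g (\<tau> w)) differentiable (at z)"
    by (rule differentiable_comp_tau[OF z g])
  have dc: "(\<lambda>w. (g (\<tau> w) $ P) *s ext_one) differentiable (at z)" for P
    by (rule complex_linear_differentiable[OF complex_linear_component dg])
  have dW: "W P differentiable (at z)" for P
    by (rule smooth_on_differentiable[OF W(1) z])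
  have coeff: "local_dd b (\<lambda>w. (g (\<tau> w) $ P) *s ext_one) z =
      (\<Sum>i\<in>UNIV. wedge (G i) ((wirtinger b i g (\<tau> z) $ P) *s ext_one))" for P
  proof -
    have "local_dd b (\<lambda>w. (g (\<tau> w) $ P) *s ext_one) z =
        (\<Sum>k\<in>UNIV. wedge (coframe b k) ((wirtinger b k (\<lambda>w. g (\<tau> w)) z $ P) *s ext_one))"
      unfolding local_dd_def wirtinger_complex_linear[OF complex_linear_component dg] by (rule refl)
    also have "\<dots> = (\<Sum>k\<in>UNIV. \<Sum>i\<in>UNIV. wedge ((if b then wirt k \<tau> z $ i else cnj (wirt k \<tau> z $ i)) *s coframe b k)
        ((wirtinger b i g (\<tau> z) $ P) *s ext_one))"
      unfolding wirtinger_chain[OF smooth_on_differentiable[OF smooth_tau z] wirtbar_tau[OF z] g]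
      by (simp add: wedge_linear vec.scale_sum_left vector_smult_assoc mult.commute)
    also have "\<dots> = (\<Sum>i\<in>UNIV. wedge (G i) ((wirtinger b i g (\<tau> z) $ P) *s ext_one))"
      by (subst sum.swap) (cases b; simp add: G_def pull_dz_def pull_dzbar_def coframe_def wedge_sum_left)
    finally show ?thesis .
  qed
  have "local_dd b (\<lambda>w. pullback \<tau> w (g (\<tau> w))) z =
      local_dd b (\<lambda>w. \<Sum>P\<in>UNIV. wedge ((g (\<tau> w) $ P) *s ext_one) (W P w)) z"
    by (simp only: pullback_eq ext_subst_eq_sum_wedge W_def)
  also have "\<dots> = (\<Sum>P\<in>UNIV. local_dd b (\<lambda>w. wedge ((g (\<tau> w) $ P) *s ext_one) (W P w)) z)"
    by (rule local_dd_sum[OF finite wedge_differentiable[OF dc dW]])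
  also have "\<dots> = (\<Sum>P\<in>UNIV. wedge (local_dd b (\<lambda>w. (g (\<tau> w) $ P) *s ext_one) z) (W P z))"
    by (intro sum.cong refl) (simp add: local_dd_leibniz[OF dc dW bideg_scale[OF bideg_one]] W(2))
  also have "\<dots> = (\<Sum>i\<in>UNIV. wedge (G i) (\<Sum>P\<in>UNIV. wedge ((wirtinger b i g (\<tau> z) $ P) *s ext_one) (W P z)))"
    unfolding coeff wedge_sum_left by (subst sum.swap) (simp only: wedge_assoc wedge_sum_right)
  also have "\<dots> = (\<Sum>i\<in>UNIV. wedge (G i) (pullback \<tau> z (wirtinger b i g (\<tau> z))))"
    by (simp only: pullback_eq ext_subst_eq_sum_wedge W_def)
  also have "\<dots> = pullback \<tau> z (local_dd b g (\<tau> z))"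
    by (cases b; simp add: local_dd_def pullback_eq ext_subst_sum G_def coframe_def
        subst.ext_subst_dz_wedge subst.ext_subst_dzbar_wedge)
  finally show ?thesis .
qed

lemma pullback_wedge: "pullback \<tau> z (wedge a b) = wedge (pullback \<tau> z a) (pullback \<tau> z b)"
  unfolding pullback_eq by (rule subst.ext_subst_wedge)

lemma bideg_pullback: "bideg p q a \<Longrightarrow> bideg p q (pullback \<tau> z a)"
  unfolding pullback_eq by (rule subst.bideg_ext_subst)

lemma interior_pullback:
  "interior_dz i (pullback \<tau> z b) = (\<Sum>k\<in>UNIV. (wirt i \<tau> z $ k) *s pullback \<tau> z (interior_dz k b))"
  unfolding pullback_eq by (rule interior_ext_subst[OF pull_dz_def pull_dzbar_def])

end

section \<open>Forms on a complex manifold\<close>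

definition dolb :: "bool \<Rightarrow> ('a, 'n::{finite,linorder}) chart set \<Rightarrow> ('a, 'n) form \<Rightarrow> ('a, 'n) form" where
  "dolb b A \<alpha> = (\<lambda>c z. if c \<in> A \<and> z \<in> chart_image c then local_dd b (\<alpha> c) z else 0)"

lemma dolb_True: "dolb True = del"
  by (intro ext) (simp add: dolb_def del_def local_dd_True)

lemma dolb_False: "dolb False = delbar"
  by (intro ext) (simp add: dolb_def delbar_def local_dd_False)

locale complex_atlas =
  fixes X :: "'a topology" and A :: "('a, 'n::{finite,linorder}) chart set"
  assumes manifold: "complex_manifold X A"
begin

lemma open_chart_image: "c \<in> A \<Longrightarrow> open (chart_image c)"
  using manifold by (simp add: complex_manifold_def)

lemma overlap_subset: "overlap c c' \<subseteq> chart_image c"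
  by (auto simp: overlap_def chart_image_def)

lemma open_overlap:
  assumes "c \<in> A" "c' \<in> A" shows "open (overlap c c')"
proof -
  have op: "openin X (fst c)" "openin X (fst c')"
    and hom: "homeomorphic_map (subtopology X (fst c)) (top_of_set (chart_image c)) (snd c)"
    using manifold assms by (auto simp: complex_manifold_def)
  have "openin (subtopology X (fst c)) (fst c \<inter> fst c')"
    using op by (simp add: openin_open_subtopology openin_Int)
  then have "openin (top_of_set (chart_image c)) (overlap c c')"
    using homeomorphic_imp_open_map[OF hom] by (simp add: overlap_def open_map_def)
  then show ?thesis
    using open_chart_image[OF assms(1)] by (simp add: openin_open_eq)
qed

lemma transition_in_chart_image:
  assumes "c \<in> A" "z \<in> overlap c c'" shows "transition c c' z \<in> chart_image c'"
proof -
  have "inj_on (snd c) (topspace (subtopology X (fst c)))"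
    using manifold assms(1) unfolding complex_manifold_def by (blast intro: homeomorphic_imp_injective_map)
  moreover have "openin X (fst c)"
    using manifold assms(1) by (auto simp: complex_manifold_def)
  ultimately have inj: "inj_on (snd c) (fst c)"
    using openin_subset by (fastforce simp: topspace_subtopology Int_absorb1)
  obtain x where x: "x \<in> fst c" "x \<in> fst c'" "z = snd c x"
    using assms(2) by (auto simp: overlap_def)
  then have "transition c c' z = snd c' x"
    by (simp add: transition_def inv_into_f_f[OF inj])
  then show ?thesis
    using x by (simp add: chart_image_def)
qed

lemma holomorphic_transition:
  assumes "c \<in> A" "c' \<in> A" shows "holomorphic_map (overlap c c') (transition c c')"
proof
  show "open (overlap c c')"
    by (rule open_overlap[OF assms])
  show "holomorphic_map_on (overlap c c') (transition c c')"
    using manifold assms by (simp add: complex_manifold_def)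
qed

lemma formsI:
  assumes "\<And>c z. c \<notin> A \<or> z \<notin> chart_image c \<Longrightarrow> \<alpha> c z = 0"
    and "\<And>c. c \<in> A \<Longrightarrow> smooth_on (chart_image c) (\<alpha> c)"
    and "\<And>c c' z. c \<in> A \<Longrightarrow> c' \<in> A \<Longrightarrow> z \<in> overlap c c' \<Longrightarrow>
      \<alpha> c z = pullback (transition c c') z (\<alpha> c' (transition c c' z))"
    and "\<And>c z. c \<in> A \<Longrightarrow> z \<in> chart_image c \<Longrightarrow> bideg p q (\<alpha> c z)"
  shows "\<alpha> \<in> forms A p q"
proof -
  have "bideg p q (\<alpha> c z)" for c z
    using assms(1,4)[of c z] by (cases "c \<in> A \<and> z \<in> chart_image c") auto
  with assms(1-3) show ?thesis
    unfolding forms_def smooth_form_def smooth_family_def bideg_def by blast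
qed

lemma forms_outside: "\<alpha> \<in> forms A p q \<Longrightarrow> c \<notin> A \<or> z \<notin> chart_image c \<Longrightarrow> \<alpha> c z = 0"
  unfolding forms_def smooth_form_def smooth_family_def by blast

lemma forms_smooth: "\<alpha> \<in> forms A p q \<Longrightarrow> c \<in> A \<Longrightarrow> smooth_on (chart_image c) (\<alpha> c)"
  unfolding forms_def smooth_form_def smooth_family_def by blast

lemma forms_differentiable: "\<alpha> \<in> forms A p q \<Longrightarrow> c \<in> A \<Longrightarrow> z \<in> chart_image c \<Longrightarrow> \<alpha> c differentiable (at z)"
  by (rule smooth_on_differentiable[OF forms_smooth])

lemma forms_pullback:
  "\<alpha> \<in> forms A p q \<Longrightarrow> c \<in> A \<Longrightarrow> c' \<in> A \<Longrightarrow> z \<in> overlap c c' \<Longrightarrow>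
    \<alpha> c z = pullback (transition c c') z (\<alpha> c' (transition c c' z))"
  unfolding forms_def smooth_form_def by blast

lemma forms_bideg: "\<alpha> \<in> forms A p q \<Longrightarrow> bideg p q (\<alpha> c z)"
  unfolding forms_def bideg_def by blast

lemma forms_zero: "0 \<in> forms A p q"
  by (rule formsI) (simp_all add: zero_fun_def smooth_on_const open_chart_image pullback_eq_ext_subst)

lemma forms_add:
  assumes "\<alpha> \<in> forms A p q" "\<beta> \<in> forms A p q" shows "\<alpha> + \<beta> \<in> forms A p q"
proof (rule formsI)
  show "smooth_on (chart_image c) ((\<alpha> + \<beta>) c)" if "c \<in> A" for c
    unfolding plus_fun_def
    by (rule smooth_on_add[OF open_chart_image[OF that] assms[THEN forms_smooth, OF that]])
  show "(\<alpha> + \<beta>) c z = pullback (transition c c') z ((\<alpha> + \<beta>) c' (transition c c' z))"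
    if "c \<in> A" "c' \<in> A" "z \<in> overlap c c'" for c c' z
    using assms[THEN forms_pullback, OF that] by (simp add: pullback_eq_ext_subst ext_subst_add)
qed (use assms in \<open>auto simp: forms_outside intro: bideg_add forms_bideg\<close>)

lemma forms_scale:
  assumes "\<alpha> \<in> forms A p q" shows "family_scale k \<alpha> \<in> forms A p q"
proof (rule formsI)
  show "smooth_on (chart_image c) (family_scale k \<alpha> c)" if "c \<in> A" for c
    unfolding family_scale_def
    by (rule smooth_on_complex_linear[OF open_chart_image[OF that] complex_linear_scale forms_smooth[OF assms that]])
  show "family_scale k \<alpha> c z = pullback (transition c c') z (family_scale k \<alpha> c' (transition c c' z))"
    if "c \<in> A" "c' \<in> A" "z \<in> overlap c c'" for c c' z
    using forms_pullback[OF assms that] by (simp add: family_scale_def pullback_eq_ext_subst ext_subst_scale)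
qed (use assms in \<open>auto simp: family_scale_def forms_outside intro: bideg_scale forms_bideg\<close>)

lemma dolb_forms:
  assumes "\<alpha> \<in> forms A p q"
  shows "dolb b A \<alpha> \<in> forms A (p + (if b then 1 else 0)) (q + (if b then 0 else 1))"
proof (rule formsI)
  show "smooth_on (chart_image c) (dolb b A \<alpha> c)" if "c \<in> A" for c
    using smooth_on_local_dd[OF open_chart_image[OF that] forms_smooth[OF assms that], of b]
    by (rule smooth_on_cong[OF open_chart_image[OF that], rotated]) (simp add: dolb_def that)
next
  fix c c' z
  assume c: "c \<in> A" "c' \<in> A" and z: "z \<in> overlap c c'"
  let ?\<tau> = "transition c c'"
  interpret t: holomorphic_map "overlap c c'" ?\<tau>
    by (rule holomorphic_transition[OF c])
  have z': "?\<tau> z \<in> chart_image c'" and zc: "z \<in> chart_image c"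
    using transition_in_chart_image[OF c(1) z] subsetD[OF overlap_subset z] .
  have "local_dd b (\<alpha> c) z = local_dd b (\<lambda>w. pullback ?\<tau> w (\<alpha> c' (?\<tau> w))) z"
    by (rule local_dd_transform[OF forms_differentiable[OF assms c(1) zc] open_overlap[OF c] z])
      (rule forms_pullback[OF assms c])
  also have "\<dots> = pullback ?\<tau> z (local_dd b (\<alpha> c') (?\<tau> z))"
    by (rule t.local_dd_pullback[OF z forms_differentiable[OF assms c(2) z']])
  finally show "dolb b A \<alpha> c z = pullback ?\<tau> z (dolb b A \<alpha> c' (?\<tau> z))"
    using c z' zc by (simp add: dolb_def)
next
  show "bideg (p + (if b then 1 else 0)) (q + (if b then 0 else 1)) (dolb b A \<alpha> c z)"
    if "c \<in> A" "z \<in> chart_image c" for c z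
    using bideg_local_dd[OF forms_differentiable[OF assms that] forms_bideg[OF assms], of b] that
    by (simp add: dolb_def)
qed (auto simp: dolb_def)

lemma del_forms: "\<alpha> \<in> forms A p q \<Longrightarrow> del A \<alpha> \<in> forms A (p + 1) q"
  using dolb_forms[of \<alpha> p q True] by (simp add: dolb_True)

lemma delbar_forms: "\<alpha> \<in> forms A p q \<Longrightarrow> delbar A \<alpha> \<in> forms A p (q + 1)"
  using dolb_forms[of \<alpha> p q False] by (simp add: dolb_False)

lemma dolb_add:
  "\<alpha> \<in> forms A p q \<Longrightarrow> \<beta> \<in> forms A r s \<Longrightarrow> dolb b A (\<alpha> + \<beta>) = dolb b A \<alpha> + dolb b A \<beta>"
  by (intro ext) (simp add: dolb_def plus_fun_def local_dd_add forms_differentiable)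

lemma dolb_scale:
  "\<alpha> \<in> forms A p q \<Longrightarrow> dolb b A (family_scale k \<alpha>) = family_scale k (dolb b A \<alpha>)"
  by (intro ext) (simp add: dolb_def family_scale_def local_dd_scale forms_differentiable)

lemma dolb_dolb:
  assumes "c \<in> A" "z \<in> chart_image c" "\<alpha> \<in> forms A p q"
  shows "dolb b A (dolb b' A \<alpha>) c z = local_dd b (local_dd b' (\<alpha> c)) z"
proof -
  have "local_dd b (local_dd b' (\<alpha> c)) z = local_dd b (dolb b' A \<alpha> c) z"
  proof (rule local_dd_transform[OF _ open_chart_image[OF assms(1)] assms(2)])
    show "local_dd b' (\<alpha> c) differentiable (at z)"
      by (rule smooth_on_differentiable[OF smooth_on_local_dd[OF open_chart_image[OF assms(1)] forms_smooth[OF assms(3,1)]] assms(2)])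
  qed (simp add: dolb_def assms(1))
  then show ?thesis
    using assms by (simp add: dolb_def)
qed

lemma dolb_square: "\<alpha> \<in> forms A p q \<Longrightarrow> dolb b A (dolb b A \<alpha>) = 0"
proof (intro ext)
  fix c z
  assume \<alpha>: "\<alpha> \<in> forms A p q"
  show "dolb b A (dolb b A \<alpha>) c z = 0 c z"
  proof (cases "c \<in> A \<and> z \<in> chart_image c")
    case True
    then show ?thesis
      using \<alpha> by (simp add: dolb_dolb local_dd_square[OF open_chart_image forms_smooth])
  qed (auto simp: dolb_def)
qed

lemma del_delbar_anticommute:
  assumes \<alpha>: "\<alpha> \<in> forms A p q" shows "del A (delbar A \<alpha>) = - delbar A (del A \<alpha>)"
proof -
  have "dolb True A (dolb False A \<alpha>) c z = - dolb False A (dolb True A \<alpha>) c z" for c z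
  proof (cases "c \<in> A \<and> z \<in> chart_image c")
    case True
    then show ?thesis
      using \<alpha> local_dd_anticommute[OF open_chart_image forms_smooth, of c \<alpha> p q z True False]
      by (simp add: dolb_dolb)
  qed (auto simp: dolb_def)
  then show ?thesis
    by (simp add: dolb_True dolb_False fun_eq_iff)
qed

lemma form_wedge_forms:
  assumes "\<alpha> \<in> forms A p q" "\<beta> \<in> forms A r s"
  shows "form_wedge \<alpha> \<beta> \<in> forms A (p + r) (q + s)"
proof (rule formsI)
  show "smooth_on (chart_image c) (form_wedge \<alpha> \<beta> c)" if "c \<in> A" for c
    unfolding form_wedge_def
    by (rule smooth_on_wedge[OF open_chart_image[OF that] forms_smooth[OF assms(1) that] forms_smooth[OF assms(2) that]])
next
  fix c c' z
  assume c: "c \<in> A" "c' \<in> A" and z: "z \<in> overlap c c'"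
  interpret t: holomorphic_map "overlap c c'" "transition c c'"
    by (rule holomorphic_transition[OF c])
  show "form_wedge \<alpha> \<beta> c z = pullback (transition c c') z (form_wedge \<alpha> \<beta> c' (transition c c' z))"
    unfolding form_wedge_def t.pullback_wedge
    by (simp only: forms_pullback[OF assms(1) c z, symmetric] forms_pullback[OF assms(2) c z, symmetric])
qed (use assms in \<open>auto simp: form_wedge_def forms_outside intro: bideg_wedge forms_bideg\<close>)

lemma dolb_form_wedge:
  assumes "\<alpha> \<in> forms A p q" "\<beta> \<in> forms A r s"
  shows "dolb b A (form_wedge \<alpha> \<beta>) =
    form_wedge (dolb b A \<alpha>) \<beta> + family_scale (if even (p + q) then 1 else -1) (form_wedge \<alpha> (dolb b A \<beta>))"
proof (intro ext)
  fix c z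
  show "dolb b A (form_wedge \<alpha> \<beta>) c z = (form_wedge (dolb b A \<alpha>) \<beta>
      + family_scale (if even (p + q) then 1 else -1) (form_wedge \<alpha> (dolb b A \<beta>))) c z"
  proof (cases "c \<in> A \<and> z \<in> chart_image c")
    case True
    then have "local_dd b (\<lambda>w. wedge (\<alpha> c w) (\<beta> c w)) z =
        wedge (local_dd b (\<alpha> c) z) (\<beta> c z) + (if even (p + q) then 1 else -1) *s wedge (\<alpha> c z) (local_dd b (\<beta> c) z)"
      by (intro local_dd_leibniz forms_differentiable[OF assms(1)] forms_differentiable[OF assms(2)] forms_bideg[OF assms(1)]) auto
    with True show ?thesis
      by (simp add: dolb_def form_wedge_def family_scale_def)
  qed (auto simp: dolb_def form_wedge_def family_scale_def)
qed

end

section \<open>Division by a volume form\<close>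

lemma ext_eqI:
  fixes a b :: "'n::finite ext"
  shows "(\<And>I J. a $ (I, J) = b $ (I, J)) \<Longrightarrow> a = b"
  unfolding vec_eq_iff by auto

lemma axis_nth_eq: "axis S x $ T = (if T = S then x else 0)"
  by (simp add: axis_def)

lemma bideg_exceeds_zero:
  fixes a :: "'n::finite ext"
  assumes "bideg p q a" "p > int CARD('n)" shows "a = 0"
proof -
  have "a $ (I, J) = 0" for I J
  proof (rule ccontr)
    assume "a $ (I, J) \<noteq> 0"
    then have "int (card I) = p"
      using assms(1) by (auto simp: bideg_def)
    moreover have "card I \<le> CARD('n)"
      by (rule card_mono) auto
    ultimately show False
      using assms(2) by linarith
  qed
  then show ?thesis
    by (simp add: vec_eq_iff)
qed

lemma bideg_top_index:
  fixes a :: "'n::finite ext"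
  assumes "bideg (int CARD('n)) q a" "a $ (I, J) \<noteq> 0" shows "I = UNIV"
proof -
  have "card I = CARD('n)"
    using assms by (auto simp: bideg_def)
  then show ?thesis
    by (simp add: card_eq_UNIV_imp_eq_UNIV)
qed

lemma volume_eq_axis:
  fixes v :: "'n::finite ext"
  assumes "bideg (int CARD('n)) 0 v"
  shows "v = (v $ (UNIV, {})) *s axis (UNIV, {}) 1"
proof -
  have "v $ (I, J) = ((v $ (UNIV, {})) *s axis (UNIV, {}) 1) $ (I, J)" for I J
  proof (cases "v $ (I, J) = 0")
    case False
    then have "I = UNIV" "J = {}"
      using bideg_top_index[OF assms] assms by (auto simp: bideg_def)
    then show ?thesis by (simp add: axis_def)
  qed (auto simp: axis_def)
  then show ?thesis
    by (rule ext_eqI)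
qed

lemma volume_coeff_nonzero:
  fixes v :: "'n::finite ext"
  assumes "bideg (int CARD('n)) 0 v" "v \<noteq> 0" shows "v $ (UNIV, {}) \<noteq> 0"
  using volume_eq_axis[OF assms(1)] assms(2) by auto

lemma wedge_volume_nth:
  fixes v :: "'n::{finite,linorder} ext"
  assumes "bideg (int CARD('n)) 0 v"
  shows "wedge v x $ (UNIV, J) = v $ (UNIV, {}) * x $ ({}, J)"
proof -
  have "wedge (axis (UNIV, {}) 1) x $ (UNIV, J) = x $ ({}, J)"
  proof (induction x rule: ext_basis_induct)
    case (basis S)
    obtain I' J' where "S = (I', J')" by (cases S)
    then show ?case
      by (simp add: wedge_axis merge_sign_def axis_nth_eq)
  qed (simp_all add: wedge_linear)
  then show ?thesis
    by (subst volume_eq_axis[OF assms]) (simp add: wedge_scale_left)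
qed

lemma wedge_volume_cancel:
  fixes v x :: "'n::{finite,linorder} ext"
  assumes "bideg (int CARD('n)) 0 v" "v \<noteq> 0" "bideg 0 q x" "wedge v x = 0"
  shows "x = 0"
proof -
  have "x $ (I, J) = 0" for I J
  proof (cases "I = {}")
    case True
    then show ?thesis
      using wedge_volume_nth[OF assms(1), of x J] volume_coeff_nonzero[OF assms(1,2)] assms(4) by simp
  next
    case False
    then show ?thesis
      using assms(3) by (auto simp: bideg_def card_gt_0_iff)
  qed
  then show ?thesis
    by (simp add: vec_eq_iff)
qed

text \<open>Up to the coefficient of \<open>v\<close> this inverts \<open>x \<mapsto> v \<and> x\<close> on elements of bidegree \<open>(0, q)\<close>.\<close>
definition top_part :: "'n::finite ext \<Rightarrow> 'n ext" where
  "top_part y = (\<chi> P. if fst P = {} then y $ (UNIV, snd P) else 0)"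

definition divide_volume :: "'n::finite ext \<Rightarrow> 'n ext \<Rightarrow> 'n ext" where
  "divide_volume v y = inverse (v $ (UNIV, {})) *s top_part y"

lemma complex_linear_top_part: "complex_linear top_part"
  by (simp add: complex_linear_def top_part_def vec_eq_iff)

lemma bideg_divide_volume:
  "bideg p q y \<Longrightarrow> bideg 0 q (divide_volume v y)"
  by (auto simp: bideg_def divide_volume_def top_part_def split: if_splits)

lemma wedge_divide_volume:
  fixes v y :: "'n::{finite,linorder} ext"
  assumes v: "bideg (int CARD('n)) 0 v" "v \<noteq> 0" and y: "bideg (int CARD('n)) q y"
  shows "wedge v (divide_volume v y) = y"
proof -
  have bd: "bideg (int CARD('n)) q (wedge v (divide_volume v y))"
    using bideg_wedge[OF v(1) bideg_divide_volume[OF y]] by simp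
  have "wedge v (divide_volume v y) $ (I, J) = y $ (I, J)" for I J
  proof (cases "I = UNIV")
    case True
    then show ?thesis
      using volume_coeff_nonzero[OF v] by (simp add: wedge_volume_nth[OF v(1)] divide_volume_def top_part_def)
  next
    case False
    then show ?thesis
      using bideg_top_index[OF bd, of I J] bideg_top_index[OF y, of I J] by metis
  qed
  then show ?thesis
    by (rule ext_eqI)
qed

lemma dz_wedge_interior_volume:
  fixes v :: "'n::{finite,linorder} ext"
  assumes "bideg (int CARD('n)) 0 v"
  shows "wedge (dz j) (interior_dz k v) = (if j = k then v else 0)"
proof -
  have "wedge (dz j) v = 0"
    using bideg_exceeds_zero[OF bideg_wedge[OF bideg_dz assms]] by simp
  then show ?thesis
    using interior_dz_wedge[of k j v] by simp
qed

lemma wedge_dz_nth: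
  assumes "j \<notin> I" shows "wedge (dz j) y $ (I, J) = 0"
proof (induction y rule: ext_basis_induct)
  case (basis S)
  then show ?case using assms by (cases S) (auto simp: wedge_dz_axis axis_nth_eq)
qed (simp_all add: wedge_linear)

text \<open>If \<open>dz\<^sub>j \<and> x = 0\<close>, then \<open>x = dz\<^sub>j \<and> (\<partial>/\<partial>z\<^sub>j \<lrcorner> x)\<close>, so every monomial of \<open>x\<close> contains \<open>dz\<^sub>j\<close>. If this
  holds for all \<open>j\<close>, only monomials with the full holomorphic degree remain.\<close>
lemma wedge_dz_all_zero:
  fixes x :: "'n::{finite,linorder} ext"
  assumes "bideg p q x" "p \<noteq> int CARD('n)" and z: "\<And>j. wedge (dz j) x = 0"
  shows "x = 0"
proof -
  have "x $ (I, J) = 0" for I J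
  proof (cases "I = UNIV")
    case True
    then show ?thesis
      using assms(1,2) by (auto simp: bideg_def)
  next
    case False
    then obtain j where "j \<notin> I"
      by blast
    have "x = wedge (dz j) (interior_dz j x)"
      using interior_dz_wedge[of j j x] by (simp add: z)
    then have "x $ (I, J) = wedge (dz j) (interior_dz j x) $ (I, J)"
      by (rule arg_cong)
    then show ?thesis
      by (simp add: wedge_dz_nth[OF \<open>j \<notin> I\<close>])
  qed
  then show ?thesis
    by (simp add: vec_eq_iff)
qed

section \<open>Contraction of the volume form\<close>

text \<open>The device that isolates one component of a contracted vector-valued form: up to sign, \<open>\<epsilon>\<close> passes the
  factors \<open>x k\<close>, and it kills all \<open>w k\<close> but one. It is used for \<open>\<epsilon> = dz\<^sub>j\<close>, \<open>w k = \<partial>/\<partial>z\<^sub>k \<lrcorner> v\<close>, and for the pullbacks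
  of these elements under a coordinate change.\<close>
lemma one_form_wedge_contraction:
  fixes x w :: "'n::{finite,linorder} \<Rightarrow> 'n ext"
  assumes e: "bideg 1 0 \<epsilon>" and x: "\<And>k. bideg 0 q (x k)" and w: "\<And>k. wedge \<epsilon> (w k) = (if j = k then v else 0)"
  shows "wedge \<epsilon> (\<Sum>k\<in>UNIV. wedge (x k) (w k)) = (if even q then 1 else -1) *s wedge (x j) v"
proof -
  have "wedge \<epsilon> (wedge (x k) (w k)) = (if j = k then (if even q then 1 else -1) *s wedge (x j) v else 0)" for k
  proof -
    have "wedge \<epsilon> (wedge (x k) (w k)) = (if even q then 1 else -1) *s wedge (x k) (wedge \<epsilon> (w k))"
      unfolding wedge_assoc[symmetric] wedge_commute[OF e x] by (simp add: wedge_linear)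
    then show ?thesis
      by (auto simp: w)
  qed
  then show ?thesis
    by (simp add: wedge_sum_right)
qed

lemma dz_wedge_contraction:
  fixes v :: "'n::{finite,linorder} ext"
  assumes "bideg (int CARD('n)) 0 v" "\<And>k. bideg 0 q (x k)"
  shows "wedge (dz j) (\<Sum>k\<in>UNIV. wedge (x k) (interior_dz k v)) = (if even q then 1 else -1) *s wedge (x j) v"
  by (rule one_form_wedge_contraction[OF bideg_dz assms(2) dz_wedge_interior_volume[OF assms(1)]])

text \<open>The sign from moving \<open>dz\<^sub>j\<close> and then \<open>v\<close> past an element of bidegree \<open>(0, q)\<close>.\<close>
definition volume_sign :: "int \<Rightarrow> int \<Rightarrow> complex" where
  "volume_sign n q = (if even q then 1 else -1) * (if odd n \<and> odd q then -1 else 1)"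

lemma volume_sign_square [simp]: "volume_sign n q * volume_sign n q = 1"
  by (simp add: volume_sign_def)

lemma dz_wedge_contraction_volume:
  fixes v :: "'n::{finite,linorder} ext"
  assumes "bideg (int CARD('n)) 0 v" "\<And>k. bideg 0 q (x k)"
  shows "wedge (dz j) (\<Sum>k\<in>UNIV. wedge (x k) (interior_dz k v)) = volume_sign (int CARD('n)) q *s wedge v (x j)"
proof -
  have "wedge (x j) v = (if odd (int CARD('n)) \<and> odd q then -1 else 1) *s wedge v (x j)"
    by (rule trans[OF wedge_commute[OF assms(2,1)]]) auto
  then show ?thesis
    unfolding dz_wedge_contraction[OF assms] volume_sign_def by (simp only: vector_smult_assoc)
qed

text \<open>The components of the vector-valued element whose contraction with \<open>v\<close> is \<open>\<gamma>\<close>: the component \<open>i\<close> is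
  recovered from \<open>dz\<^sub>i \<and> \<gamma>\<close> by \<open>dz_wedge_contraction_volume\<close>.\<close>
definition divide_contraction :: "int \<Rightarrow> 'n::{finite,linorder} ext \<Rightarrow> 'n ext \<Rightarrow> 'n \<Rightarrow> 'n ext" where
  "divide_contraction q v \<gamma> i = volume_sign (int CARD('n)) q *s divide_volume v (wedge (dz i) \<gamma>)"

lemma contraction_divide_contraction:
  fixes v \<gamma> :: "'n::{finite,linorder} ext"
  assumes v: "bideg (int CARD('n)) 0 v" "v \<noteq> 0" and \<gamma>: "bideg (int CARD('n) - 1) q \<gamma>"
  shows "(\<Sum>i\<in>UNIV. wedge (divide_contraction q v \<gamma> i) (interior_dz i v)) = \<gamma>" (is "?s = _")
    and "bideg 0 q (divide_contraction q v \<gamma> i)"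
proof -
  have dg: "bideg (int CARD('n)) q (wedge (dz j) \<gamma>)" for j
    using bideg_wedge[OF bideg_dz \<gamma>] by simp
  show x: "bideg 0 q (divide_contraction q v \<gamma> i)" for i
    unfolding divide_contraction_def by (rule bideg_scale[OF bideg_divide_volume[OF dg]])
  have "?s - \<gamma> = 0"
  proof (rule wedge_dz_all_zero)
    have "bideg (0 + (int CARD('n) - 1)) (q + 0) ?s"
      by (rule bideg_sum, rule bideg_wedge[OF x bideg_interior[OF v(1)]])
    then show "bideg (int CARD('n) - 1) q (?s - \<gamma>)"
      using \<gamma> by (simp add: bideg_diff)
    show "wedge (dz j) (?s - \<gamma>) = 0" for j
      unfolding wedge_diff_right dz_wedge_contraction_volume[OF v(1) x]
      by (simp add: divide_contraction_def wedge_scale_right vector_smult_assoc wedge_divide_volume[OF v dg])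
  qed simp
  then show "?s = \<gamma>"
    by simp
qed

lemma contraction_volume_cancel:
  fixes v :: "'n::{finite,linorder} ext"
  assumes v: "bideg (int CARD('n)) 0 v" "v \<noteq> 0" and x: "\<And>k. bideg 0 q (x k)"
    and z: "(\<Sum>i\<in>UNIV. wedge (x i) (interior_dz i v)) = 0"
  shows "x j = 0"
proof (rule wedge_volume_cancel[OF v x])
  have "volume_sign (int CARD('n)) q *s wedge v (x j) = 0"
    using dz_wedge_contraction_volume[where x = x and j = j, OF v(1) x] by (simp add: z)
  moreover have "volume_sign (int CARD('n)) q \<noteq> 0"
    by (simp add: volume_sign_def)
  ultimately show "wedge v (x j) = 0"
    by simp
qed

text \<open>The identity behind the comparison of polarised and primitive classes. There is no nonzero element of
  bidegree \<open>(n + 1, 1)\<close>, so \<open>\<zeta> \<and> v = 0\<close>; contracting this equation with the derivation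
  \<open>\<Sum>\<^sub>i x i \<and> (\<partial>/\<partial>z\<^sub>i \<lrcorner> _)\<close> of degree \<open>0\<close> gives the claim.\<close>
lemma wedge_contraction_volume:
  fixes v \<zeta> :: "'n::{finite,linorder} ext"
  assumes v: "bideg (int CARD('n)) 0 v" and \<zeta>: "bideg 1 1 \<zeta>" and x: "\<And>k. bideg 0 1 (x k)"
  shows "wedge \<zeta> (\<Sum>i\<in>UNIV. wedge (x i) (interior_dz i v)) = - wedge v (\<Sum>i\<in>UNIV. wedge (x i) (interior_dz i \<zeta>))"
proof -
  have "wedge \<zeta> v = 0"
    using bideg_exceeds_zero[OF bideg_wedge[OF \<zeta> v]] by simp
  then have der: "wedge \<zeta> (interior_dz i v) = - wedge (interior_dz i \<zeta>) v" for i
    using interior_wedge[OF \<zeta>, of i v] by (simp add: add_eq_0_iff2)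
  have "wedge \<zeta> (wedge (x i) (interior_dz i v)) = - wedge v (wedge (x i) (interior_dz i \<zeta>))" for i
  proof -
    have "wedge \<zeta> (x i) = wedge (x i) \<zeta>"
      by (rule trans[OF wedge_commute[OF \<zeta> x]]) simp
    then have "wedge \<zeta> (wedge (x i) (interior_dz i v)) = - wedge (wedge (x i) (interior_dz i \<zeta>)) v"
      by (simp add: wedge_assoc[symmetric]) (simp add: wedge_assoc der wedge_minus_right)
    moreover have "wedge (wedge (x i) (interior_dz i \<zeta>)) v = wedge v (wedge (x i) (interior_dz i \<zeta>))"
      by (rule trans[OF wedge_commute[OF bideg_wedge[OF x bideg_interior[OF \<zeta>]] v]]) simp
    ultimately show ?thesis
      by simp
  qed
  then show ?thesis
    by (simp add: wedge_sum_right sum_negf)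
qed

lemma complex_linear_vcomp: "complex_linear (vcomp i)"
  by (simp add: complex_linear_def vcomp_def vec_eq_iff)

definition vembed :: "'n \<Rightarrow> 'n::finite ext \<Rightarrow> complex^('n \<times> 'n set \<times> 'n set)" where
  "vembed i a = (\<chi> P. if fst P = i then a $ snd P else 0)"

lemma complex_linear_vembed: "complex_linear (vembed i)"
  by (simp add: complex_linear_def vembed_def vec_eq_iff)

lemma vcomp_vembed: "vcomp i (\<Sum>j\<in>UNIV. vembed j (f j)) = f i"
  by (simp add: vcomp_def vembed_def vec_eq_iff)

lemma vcomp_eq_iff: "s = t \<longleftrightarrow> (\<forall>i. vcomp i s = vcomp i t)"
  by (auto simp: vcomp_def vec_eq_iff)

lemma vcomp_linear [simp]:
  "vcomp i (s + t) = vcomp i s + vcomp i t" "vcomp i (s - t) = vcomp i s - vcomp i t"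
  "vcomp i (k *s t) = k *s vcomp i t" "vcomp i 0 = 0"
  by (simp_all add: vcomp_def vec_eq_iff)

lemma contract_add: "contract (\<theta> + \<theta>') \<beta> = contract \<theta> \<beta> + contract \<theta>' \<beta>"
  by (intro ext) (simp add: contract_def wedge_linear sum.distrib)

lemma contract_diff: "contract (\<theta> - \<theta>') \<beta> = contract \<theta> \<beta> - contract \<theta>' \<beta>"
  by (intro ext) (simp add: contract_def wedge_diff_left sum_subtractf)

lemma contract_scale: "contract (family_scale k \<theta>) \<beta> = family_scale k (contract \<theta> \<beta>)"
  by (intro ext) (simp add: contract_def family_scale_def wedge_linear vec.scale_sum_right)

lemma bounded_bilinear_smult: "bounded_bilinear (\<lambda>k (a :: complex^'i::finite). k *s a)"
  unfolding bilinear_conv_bounded_bilinear[symmetric] bilinear_def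
  by (auto intro!: linearI simp: vec.scale_left_distrib vec.scale_right_distrib scaleR_eq_smult vector_smult_assoc
      scaleR_conv_of_real mult.commute)

lemma smooth_on_divide_volume:
  assumes "open S" "smooth_on S f" "smooth_on S g" "\<And>z. z \<in> S \<Longrightarrow> f z $ (UNIV, {}) \<noteq> 0"
  shows "smooth_on S (\<lambda>z. divide_volume (f z) (g z))"
  unfolding divide_volume_def
  by (rule smooth_on_bilinear[OF assms(1) bounded_bilinear_smult],
      rule smooth_on_inverse[OF assms(1) assms(4)], assumption,
      rule smooth_on_linear[OF assms(1) bounded_linear_vec_nth assms(2)],
      rule smooth_on_complex_linear[OF assms(1) complex_linear_top_part assms(3)])

context complex_atlas
begin

lemma vformsI:
  assumes "\<And>c z. c \<notin> A \<or> z \<notin> chart_image c \<Longrightarrow> \<theta> c z = 0"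
    and "\<And>c. c \<in> A \<Longrightarrow> smooth_on (chart_image c) (\<theta> c)"
    and "\<And>c c' z k. c \<in> A \<Longrightarrow> c' \<in> A \<Longrightarrow> z \<in> overlap c c' \<Longrightarrow>
      (\<Sum>i\<in>UNIV. (wirt i (transition c c') z $ k) *s vcomp i (\<theta> c z))
          = pullback (transition c c') z (vcomp k (\<theta> c' (transition c c' z)))"
    and "\<And>c z i. c \<in> A \<Longrightarrow> z \<in> chart_image c \<Longrightarrow> bideg p q (vcomp i (\<theta> c z))"
  shows "\<theta> \<in> vforms A p q"
proof -
  have "bideg p q (vcomp i (\<theta> c z))" for c z i
    using assms(1,4)[of c z] by (cases "c \<in> A \<and> z \<in> chart_image c") auto
  then have "\<theta> c z $ (i, I, J) \<noteq> 0 \<Longrightarrow> int (card I) = p \<and> int (card J) = q" for c z i I J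
    unfolding bideg_def vcomp_def by simp
  with assms(1-3) show ?thesis
    unfolding vforms_def smooth_family_def by blast
qed

lemma vforms_outside: "\<theta> \<in> vforms A p q \<Longrightarrow> c \<notin> A \<or> z \<notin> chart_image c \<Longrightarrow> \<theta> c z = 0"
  unfolding vforms_def smooth_family_def by blast

lemma vforms_smooth: "\<theta> \<in> vforms A p q \<Longrightarrow> c \<in> A \<Longrightarrow> smooth_on (chart_image c) (\<lambda>z. vcomp i (\<theta> c z))"
  by (rule smooth_on_complex_linear[OF open_chart_image complex_linear_vcomp])
    (auto simp: vforms_def smooth_family_def)

lemma vforms_pullback:
  "\<theta> \<in> vforms A p q \<Longrightarrow> c \<in> A \<Longrightarrow> c' \<in> A \<Longrightarrow> z \<in> overlap c c' \<Longrightarrow>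
    (\<Sum>i\<in>UNIV. (wirt i (transition c c') z $ k) *s vcomp i (\<theta> c z))
          = pullback (transition c c') z (vcomp k (\<theta> c' (transition c c' z)))"
  unfolding vforms_def by blast

lemma vforms_bideg: "\<theta> \<in> vforms A p q \<Longrightarrow> bideg p q (vcomp i (\<theta> c z))"
  unfolding vforms_def bideg_def vcomp_def vec_lambda_beta by blast

lemma vforms_zero: "0 \<in> vforms A p q"
  by (rule vformsI) (simp_all add: zero_fun_def smooth_on_const open_chart_image pullback_eq_ext_subst)

lemma vforms_add:
  assumes "\<theta> \<in> vforms A p q" "\<theta>' \<in> vforms A p q" shows "\<theta> + \<theta>' \<in> vforms A p q"
proof (rule vformsI)
  show "smooth_on (chart_image c) ((\<theta> + \<theta>') c)" if "c \<in> A" for c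
    unfolding plus_fun_def
    by (rule smooth_on_add[OF open_chart_image[OF that]]) (use assms that in \<open>auto simp: vforms_def smooth_family_def\<close>)
  show "(\<Sum>i\<in>UNIV. (wirt i (transition c c') z $ k) *s vcomp i ((\<theta> + \<theta>') c z))
          = pullback (transition c c') z (vcomp k ((\<theta> + \<theta>') c' (transition c c' z)))"
    if "c \<in> A" "c' \<in> A" "z \<in> overlap c c'" for c c' z k
    using assms[THEN vforms_pullback, OF that, of k]
    by (simp add: pullback_eq_ext_subst ext_subst_add vec.scale_right_distrib sum.distrib)
qed (use assms in \<open>auto simp: vforms_outside intro: bideg_add vforms_bideg\<close>)

lemma vforms_scale:
  assumes "\<theta> \<in> vforms A p q" shows "family_scale s \<theta> \<in> vforms A p q"
proof (rule vformsI)
  show "smooth_on (chart_image c) (family_scale s \<theta> c)" if "c \<in> A" for c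
    unfolding family_scale_def
    by (rule smooth_on_complex_linear[OF open_chart_image[OF that] complex_linear_scale])
      (use assms that in \<open>auto simp: vforms_def smooth_family_def\<close>)
  show "(\<Sum>i\<in>UNIV. (wirt i (transition c c') z $ k) *s vcomp i (family_scale s \<theta> c z))
          = pullback (transition c c') z (vcomp k (family_scale s \<theta> c' (transition c c' z)))"
    if "c \<in> A" "c' \<in> A" "z \<in> overlap c c'" for c c' z k
    using vforms_pullback[OF assms that, of k, symmetric]
    by (simp add: family_scale_def pullback_eq_ext_subst ext_subst_scale vec.scale_sum_right vector_smult_assoc mult.commute)
qed (use assms in \<open>auto simp: family_scale_def vforms_outside intro: bideg_scale vforms_bideg\<close>)

lemma vcomp_vdelbar:
  "vcomp i (vdelbar A \<theta> c z) = (if c \<in> A \<and> z \<in> chart_image c then local_delbar (\<lambda>w. vcomp i (\<theta> c w)) z else 0)"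
  by (simp add: vdelbar_def vcomp_def vec_eq_iff)

lemma vdelbar_add:
  "\<theta> \<in> vforms A p q \<Longrightarrow> \<theta>' \<in> vforms A p q \<Longrightarrow> vdelbar A (\<theta> + \<theta>') = vdelbar A \<theta> + vdelbar A \<theta>'"
  by (intro ext) (auto simp: vcomp_eq_iff vcomp_vdelbar local_dd_False[symmetric] local_dd_add
      smooth_on_differentiable[OF vforms_smooth])

lemma vdelbar_scale:
  "\<theta> \<in> vforms A p q \<Longrightarrow> vdelbar A (family_scale s \<theta>) = family_scale s (vdelbar A \<theta>)"
  by (intro ext) (auto simp: vcomp_eq_iff vcomp_vdelbar local_dd_False[symmetric] local_dd_scale family_scale_def
      smooth_on_differentiable[OF vforms_smooth])

lemma vdelbar_bideg:
  assumes "\<theta> \<in> vforms A p q" shows "bideg p (q + 1) (vcomp i (vdelbar A \<theta> c z))"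
proof (cases "c \<in> A \<and> z \<in> chart_image c")
  case True
  then show ?thesis
    using bideg_local_dd[OF smooth_on_differentiable[OF vforms_smooth[OF assms]] vforms_bideg[OF assms], of c z False i]
    by (simp add: vcomp_vdelbar local_dd_False)
qed (auto simp: vcomp_vdelbar)

end

locale volume_atlas = complex_atlas X A for X :: "'a topology" and A :: "('a, 'n::{finite,linorder}) chart set" +
  fixes u :: "('a, 'n) form"
  assumes volume: "nonvanishing_holomorphic_volume_form A u"
begin

lemma u_forms: "u \<in> forms A (int CARD('n)) 0" and delbar_u: "delbar A u = 0"
  and u_nonzero: "c \<in> A \<Longrightarrow> z \<in> chart_image c \<Longrightarrow> u c z \<noteq> 0"
  using volume by (auto simp: nonvanishing_holomorphic_volume_form_def)

lemmas u_bideg = forms_bideg[OF u_forms]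

lemma smooth_interior_u: "c \<in> A \<Longrightarrow> smooth_on (chart_image c) (\<lambda>z. interior_dz i (u c z))"
  by (rule smooth_on_complex_linear[OF open_chart_image complex_linear_interior forms_smooth[OF u_forms]])

text \<open>Rewriting the contraction of \<open>u\<close> in one chart in terms of the pullback of \<open>u\<close> from another one. The
  coefficients that appear are the left-hand side of the transformation law in \<^const>\<open>vforms\<close>.\<close>
lemma contraction_pullback:
  assumes c: "c \<in> A" "c' \<in> A" and z: "z \<in> overlap c c'"
  shows "(\<Sum>i\<in>UNIV. wedge (x i) (interior_dz i (u c z))) =
    (\<Sum>k\<in>UNIV. wedge (\<Sum>i\<in>UNIV. (wirt i (transition c c') z $ k) *s x i)
       (pullback (transition c c') z (interior_dz k (u c' (transition c c' z)))))"
proof -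
  interpret t: holomorphic_map "overlap c c'" "transition c c'"
    by (rule holomorphic_transition[OF c])
  show ?thesis
    unfolding forms_pullback[OF u_forms c z] t.interior_pullback wedge_sum_right wedge_sum_left
    by (subst sum.swap) (simp add: wedge_linear)
qed

lemma contract_u_forms:
  assumes \<theta>: "\<theta> \<in> vforms A 0 q"
  shows "contract \<theta> u \<in> forms A (int CARD('n) - 1) q"
proof (rule formsI)
  show "smooth_on (chart_image c) (contract \<theta> u c)" if "c \<in> A" for c
    unfolding contract_def
    by (rule smooth_on_sum[OF open_chart_image[OF that]],
        rule smooth_on_wedge[OF open_chart_image[OF that] vforms_smooth[OF \<theta> that] smooth_interior_u[OF that]])
next
  fix c c' z
  assume c: "c \<in> A" "c' \<in> A" and z: "z \<in> overlap c c'"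
  interpret t: holomorphic_map "overlap c c'" "transition c c'"
    by (rule holomorphic_transition[OF c])
  show "contract \<theta> u c z = pullback (transition c c') z (contract \<theta> u c' (transition c c' z))"
    unfolding contract_def contraction_pullback[OF c z] vforms_pullback[OF \<theta> c z] t.pullback_wedge[symmetric]
    by (simp add: pullback_eq_ext_subst ext_subst_sum)
next
  show "bideg (int CARD('n) - 1) q (contract \<theta> u c z)" for c z
    unfolding contract_def
    using bideg_wedge[OF vforms_bideg[OF \<theta>] bideg_interior[OF u_bideg]] by (intro bideg_sum) simp
qed (use \<theta> in \<open>auto simp: contract_def vforms_outside\<close>)

lemma contract_u_cancel:
  assumes "\<And>c z i. bideg 0 q (vcomp i (\<theta> c z))" "\<And>c z. c \<notin> A \<or> z \<notin> chart_image c \<Longrightarrow> \<theta> c z = 0"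
    and "contract \<theta> u = 0"
  shows "\<theta> = 0"
proof (intro ext)
  fix c z
  show "\<theta> c z = 0 c z"
  proof (cases "c \<in> A \<and> z \<in> chart_image c")
    case True
    then have "u c z \<noteq> 0" by (simp add: u_nonzero)
    have "(\<Sum>i\<in>UNIV. wedge (vcomp i (\<theta> c z)) (interior_dz i (u c z))) = 0"
      using fun_cong[OF fun_cong[OF assms(3), of c], of z] by (simp add: contract_def)
    then have "vcomp i (\<theta> c z) = 0" for i
      by (rule contraction_volume_cancel[OF u_bideg \<open>u c z \<noteq> 0\<close> assms(1)])
    then show ?thesis
      by (simp add: vcomp_eq_iff)
  qed (use assms(2) in auto)
qed

text \<open>The preimage is given pointwise by division. It obeys the transformation law because both sides of the
  law have the same contraction with the pulled back volume form, and this contraction is injective.\<close>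
lemma contract_u_surj:
  assumes \<gamma>: "\<gamma> \<in> forms A (int CARD('n) - 1) q"
  obtains \<theta> where "\<theta> \<in> vforms A 0 q" "contract \<theta> u = \<gamma>"
proof -
  define \<theta> where "\<theta> c z = (\<Sum>i\<in>UNIV. vembed i (divide_contraction q (u c z) (\<gamma> c z) i))" for c z
  have comp: "vcomp i (\<theta> c z) = divide_contraction q (u c z) (\<gamma> c z) i" for c z i
    unfolding \<theta>_def by (rule vcomp_vembed)
  have out: "\<theta> c z = 0" if "c \<notin> A \<or> z \<notin> chart_image c" for c z
    using that by (simp add: vcomp_eq_iff comp divide_contraction_def divide_volume_def forms_outside[OF \<gamma>]
        top_part_def vec_eq_iff)
  have bd: "bideg 0 q (vcomp i (\<theta> c z))" for c z i
  proof (cases "c \<in> A \<and> z \<in> chart_image c")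
    case True
    then show ?thesis
      unfolding comp by (intro contraction_divide_contraction(2)[OF u_bideg u_nonzero forms_bideg[OF \<gamma>]]) auto
  qed (auto simp: out)
  have eq: "contract \<theta> u = \<gamma>"
  proof (intro ext)
    fix c z
    show "contract \<theta> u c z = \<gamma> c z"
    proof (cases "c \<in> A \<and> z \<in> chart_image c")
      case True
      then show ?thesis
        unfolding contract_def comp
        by (intro contraction_divide_contraction(1)[OF u_bideg u_nonzero forms_bideg[OF \<gamma>]]) auto
    next
      case False
      then show ?thesis
        using forms_outside[OF \<gamma>, of c z] out[of c z] by (simp add: contract_def)
    qed
  qed
  have "\<theta> \<in> vforms A 0 q"
  proof (rule vformsI)
    show "smooth_on (chart_image c) (\<theta> c)" if c: "c \<in> A" for c
    proof -
      have "smooth_on (chart_image c) (\<lambda>z. divide_contraction q (u c z) (\<gamma> c z) i)" for i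
        unfolding divide_contraction_def
        by (rule smooth_on_complex_linear[OF open_chart_image[OF c] complex_linear_scale],
            rule smooth_on_divide_volume[OF open_chart_image[OF c] forms_smooth[OF u_forms c]],
            rule smooth_on_complex_linear[OF open_chart_image[OF c] complex_linear_wedge forms_smooth[OF \<gamma> c]],
            rule volume_coeff_nonzero[OF u_bideg u_nonzero[OF c]])
      then show ?thesis
        unfolding \<theta>_def[abs_def]
        by (intro smooth_on_sum[OF open_chart_image[OF c]] smooth_on_complex_linear[OF open_chart_image[OF c] complex_linear_vembed])
    qed
  next
    fix c c' z j
    assume c: "c \<in> A" "c' \<in> A" and z: "z \<in> overlap c c'"
    let ?\<tau> = "transition c c'"
    interpret t: holomorphic_map "overlap c c'" ?\<tau>
      by (rule holomorphic_transition[OF c])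
    \<comment> \<open>the defect in the transformation law\<close>
    define x where "x k = (\<Sum>i\<in>UNIV. (wirt i ?\<tau> z $ k) *s vcomp i (\<theta> c z)) - pullback ?\<tau> z (vcomp k (\<theta> c' (?\<tau> z)))" for k
    have x: "bideg 0 q (x k)" for k
      unfolding x_def by (intro bideg_diff bideg_sum bideg_scale bd t.bideg_pullback)
    have "contract \<theta> u c z = pullback ?\<tau> z (contract \<theta> u c' (?\<tau> z))"
      unfolding eq by (rule forms_pullback[OF \<gamma> c z])
    then have "(\<Sum>k\<in>UNIV. wedge (x k) (pullback ?\<tau> z (interior_dz k (u c' (?\<tau> z))))) = 0"
      unfolding contract_def contraction_pullback[OF c z] x_def wedge_diff_left sum_subtractf
      by (simp add: pullback_eq_ext_subst ext_subst_sum t.pullback_wedge[unfolded pullback_eq_ext_subst])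
    moreover have w: "wedge (pullback ?\<tau> z (dz j)) (pullback ?\<tau> z (interior_dz k (u c' (?\<tau> z)))) =
        (if j = k then u c z else 0)" for k
      unfolding t.pullback_wedge[symmetric] dz_wedge_interior_volume[OF u_bideg] forms_pullback[OF u_forms c z]
      by (simp add: pullback_eq_ext_subst)
    ultimately have "(if even q then 1 else -1) *s wedge (x j) (u c z) = 0"
      using one_form_wedge_contraction[where x = x, OF t.bideg_pullback[OF bideg_dz] x w] by simp
    then have "wedge (x j) (u c z) = 0"
      by (cases "even q") simp_all
    then have "wedge (u c z) (x j) = 0"
      using wedge_commute[OF u_bideg x] by (auto split: if_splits)
    moreover have "u c z \<noteq> 0"
      using u_nonzero[OF c(1)] overlap_subset z by blast
    ultimately have "x j = 0"
      using wedge_volume_cancel[OF u_bideg _ x] by blast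
    then show "(\<Sum>i\<in>UNIV. (wirt i ?\<tau> z $ j) *s vcomp i (\<theta> c z)) = pullback ?\<tau> z (vcomp j (\<theta> c' (?\<tau> z)))"
      by (simp add: x_def)
  qed (use out bd in auto)
  then show ?thesis
    using that eq by blast
qed

text \<open>The second factors \<open>\<partial>/\<partial>z\<^sub>i \<lrcorner> u\<close> are \<open>\<partial>bar\<close>-closed, since \<open>\<partial>bar\<close> anticommutes with the contraction.\<close>
lemma contract_vdelbar:
  assumes \<theta>: "\<theta> \<in> vforms A 0 q"
  shows "contract (vdelbar A \<theta>) u = delbar A (contract \<theta> u)"
proof (intro ext)
  fix c z
  show "contract (vdelbar A \<theta>) u c z = delbar A (contract \<theta> u) c z"
  proof (cases "c \<in> A \<and> z \<in> chart_image c")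
    case True
    then have c: "c \<in> A" and z: "z \<in> chart_image c" by auto
    have d\<theta>: "(\<lambda>w. vcomp i (\<theta> c w)) differentiable (at z)" for i
      by (rule smooth_on_differentiable[OF vforms_smooth[OF \<theta> c] z])
    have du: "(\<lambda>w. interior_dz i (u c w)) differentiable (at z)" for i
      by (rule smooth_on_differentiable[OF smooth_interior_u[OF c] z])
    have "local_dd False (u c) z = 0"
      using fun_cong[OF fun_cong[OF delbar_u, of c], of z] c z by (simp add: delbar_def local_dd_False)
    then have closed: "local_dd False (\<lambda>w. interior_dz i (u c w)) z = 0" for i
      using interior_local_delbar[OF forms_differentiable[OF u_forms c z], of i] by simp
    have "delbar A (contract \<theta> u) c z =
        local_dd False (\<lambda>w. \<Sum>i\<in>UNIV. wedge (vcomp i (\<theta> c w)) (interior_dz i (u c w))) z"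
      using c z by (simp add: delbar_def local_dd_False contract_def)
    also have "\<dots> = (\<Sum>i\<in>UNIV. local_dd False (\<lambda>w. wedge (vcomp i (\<theta> c w)) (interior_dz i (u c w))) z)"
      by (rule local_dd_sum[OF finite wedge_differentiable[OF d\<theta> du]])
    also have "\<dots> = contract (vdelbar A \<theta>) u c z"
      unfolding contract_def
      by (intro sum.cong refl)
        (simp add: local_dd_leibniz[OF d\<theta> du vforms_bideg[OF \<theta>]] closed vcomp_vdelbar c z flip: local_dd_False)
    finally show ?thesis
      by simp
  qed (auto simp: delbar_def contract_def vcomp_vdelbar)
qed

lemma form_wedge_contract:
  assumes "\<theta> \<in> vforms A 0 1" "\<zeta> \<in> forms A 1 1"
  shows "form_wedge \<zeta> (contract \<theta> u) = - form_wedge u (contract \<theta> \<zeta>)"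
  by (intro ext) (simp add: form_wedge_def contract_def
      wedge_contraction_volume[OF u_bideg forms_bideg[OF assms(2)] vforms_bideg[OF assms(1)]])

text \<open>Division by \<open>u\<close> in each chart; the quotients agree on overlaps because division is unique.\<close>
lemma form_wedge_u_surj:
  assumes \<gamma>: "\<gamma> \<in> forms A (int CARD('n)) q"
  obtains \<beta> where "\<beta> \<in> forms A 0 q" "form_wedge u \<beta> = \<gamma>"
proof -
  define \<beta> where "\<beta> c z = divide_volume (u c z) (\<gamma> c z)" for c z
  have out: "\<beta> c z = 0" if "c \<notin> A \<or> z \<notin> chart_image c" for c z
    using that by (simp add: \<beta>_def divide_volume_def forms_outside[OF \<gamma>] top_part_def vec_eq_iff)
  have bd: "bideg 0 q (\<beta> c z)" for c z
    unfolding \<beta>_def by (rule bideg_divide_volume[OF forms_bideg[OF \<gamma>]])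
  have eq: "form_wedge u \<beta> = \<gamma>"
  proof (intro ext)
    fix c z
    show "form_wedge u \<beta> c z = \<gamma> c z"
    proof (cases "c \<in> A \<and> z \<in> chart_image c")
      case True
      then show ?thesis
        unfolding form_wedge_def \<beta>_def
        by (intro wedge_divide_volume[OF u_bideg u_nonzero forms_bideg[OF \<gamma>]]) auto
    next
      case False
      then show ?thesis
        using forms_outside[OF \<gamma>, of c z] out[of c z] by (simp add: form_wedge_def)
    qed
  qed
  have "\<beta> \<in> forms A 0 q"
  proof (rule formsI)
    show "smooth_on (chart_image c) (\<beta> c)" if c: "c \<in> A" for c
      unfolding \<beta>_def[abs_def]
      by (rule smooth_on_divide_volume[OF open_chart_image[OF c] forms_smooth[OF u_forms c] forms_smooth[OF \<gamma> c]
            volume_coeff_nonzero[OF u_bideg u_nonzero[OF c]]])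
  next
    fix c c' z
    assume c: "c \<in> A" "c' \<in> A" and z: "z \<in> overlap c c'"
    let ?\<tau> = "transition c c'"
    interpret t: holomorphic_map "overlap c c'" ?\<tau>
      by (rule holomorphic_transition[OF c])
    have "form_wedge u \<beta> c z = pullback ?\<tau> z (form_wedge u \<beta> c' (?\<tau> z))"
      unfolding eq by (rule forms_pullback[OF \<gamma> c z])
    then have "wedge (u c z) (\<beta> c z - pullback ?\<tau> z (\<beta> c' (?\<tau> z))) = 0"
      unfolding form_wedge_def t.pullback_wedge wedge_diff_right forms_pullback[OF u_forms c z, symmetric] by simp
    moreover have "bideg 0 q (\<beta> c z - pullback ?\<tau> z (\<beta> c' (?\<tau> z)))"
      by (intro bideg_diff bd t.bideg_pullback)
    moreover have "u c z \<noteq> 0"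
      using u_nonzero[OF c(1)] overlap_subset z by blast
    ultimately show "\<beta> c z = pullback ?\<tau> z (\<beta> c' (?\<tau> z))"
      using wedge_volume_cancel[OF u_bideg] by fastforce
  qed (use out bd in auto)
  then show ?thesis
    using that eq by blast
qed

lemma form_wedge_u_cancel:
  assumes "\<And>c z. bideg 0 q (\<beta> c z)" "\<And>c z. c \<notin> A \<or> z \<notin> chart_image c \<Longrightarrow> \<beta> c z = 0"
    and "form_wedge u \<beta> = 0"
  shows "\<beta> = 0"
proof (intro ext)
  fix c z
  show "\<beta> c z = 0 c z"
  proof (cases "c \<in> A \<and> z \<in> chart_image c")
    case True
    have "wedge (u c z) (\<beta> c z) = 0"
      using fun_cong[OF fun_cong[OF assms(3), of c], of z] by (simp add: form_wedge_def)
    moreover have "u c z \<noteq> 0"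
      using True by (simp add: u_nonzero)
    ultimately show ?thesis
      using wedge_volume_cancel[OF u_bideg _ assms(1)[of c z]] by simp
  qed (use assms(2) in auto)
qed

end

section \<open>Quotients by subspaces of families\<close>

definition family_subspace :: "('a, 'n, 'i::finite) family set \<Rightarrow> bool" where
  "family_subspace V \<longleftrightarrow> 0 \<in> V \<and> (\<forall>x\<in>V. \<forall>y\<in>V. x + y \<in> V) \<and> (\<forall>k. \<forall>x\<in>V. family_scale k x \<in> V)"

definition family_linear_on :: "('a, 'n, 'i::finite) family set \<Rightarrow>
    (('a, 'n, 'i) family \<Rightarrow> ('a, 'n, 'j::finite) family) \<Rightarrow> bool" where
  "family_linear_on V f \<longleftrightarrow> (\<forall>x\<in>V. \<forall>y\<in>V. f (x + y) = f x + f y)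
     \<and> (\<forall>k. \<forall>x\<in>V. f (family_scale k x) = family_scale k (f x))"

lemma family_scale_add: "family_scale k (x + y) = family_scale k x + family_scale k y"
  by (intro ext) (simp add: family_scale_def vec.scale_right_distrib)

lemma family_scale_minus_one: "family_scale (-1) x = - x"
  by (intro ext) (simp add: family_scale_def)

lemma family_scale_one [simp]: "family_scale 1 x = x"
  by (intro ext) (simp add: family_scale_def)

lemma family_scale_zero_left: "family_scale 0 x = 0"
  by (intro ext) (simp add: family_scale_def)

lemma family_scale_zero_right [simp]: "family_scale k 0 = 0"
  by (intro ext) (simp add: family_scale_def)

lemma family_scale_scale: "family_scale k (family_scale l x) = family_scale (k * l) x"
  by (intro ext) (simp add: family_scale_def vector_smult_assoc)

lemma
  assumes "family_subspace V"
  shows family_subspace_zero: "0 \<in> V"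
    and family_subspace_add: "x \<in> V \<Longrightarrow> y \<in> V \<Longrightarrow> x + y \<in> V"
    and family_subspace_scale: "x \<in> V \<Longrightarrow> family_scale k x \<in> V"
    and family_subspace_minus: "x \<in> V \<Longrightarrow> - x \<in> V"
    and family_subspace_diff: "x \<in> V \<Longrightarrow> y \<in> V \<Longrightarrow> x - y \<in> V"
proof -
  show z: "0 \<in> V" and a: "x \<in> V \<Longrightarrow> y \<in> V \<Longrightarrow> x + y \<in> V" and s: "x \<in> V \<Longrightarrow> family_scale k x \<in> V" for x y k
    using assms by (auto simp: family_subspace_def)
  show m: "x \<in> V \<Longrightarrow> - x \<in> V" for x
    using s[of x "-1"] by (simp add: family_scale_minus_one)
  show "x \<in> V \<Longrightarrow> y \<in> V \<Longrightarrow> x - y \<in> V"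
    using a[of x "- y"] m[of y] by simp
qed

lemma family_linear_on_zero:
  assumes "family_subspace V" "family_linear_on V f" shows "f 0 = 0"
proof -
  have "f (family_scale 0 0) = family_scale 0 (f 0)"
    using family_subspace_zero[OF assms(1)] assms(2) unfolding family_linear_on_def by blast
  then show ?thesis
    by (simp add: family_scale_zero_left)
qed

lemma family_subspace_image:
  assumes V: "family_subspace V" and f: "family_linear_on V f"
  shows "family_subspace (f ` V)"
  unfolding family_subspace_def
proof (intro conjI ballI allI)
  show "0 \<in> f ` V"
    using imageI[OF family_subspace_zero[OF V], of f] by (simp add: family_linear_on_zero[OF V f])
next
  fix x y assume "x \<in> f ` V" "y \<in> f ` V"
  then obtain a b where ab: "a \<in> V" "b \<in> V" "x = f a" "y = f b"
    by auto
  then have "x + y = f (a + b)"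
    using f by (simp add: family_linear_on_def)
  then show "x + y \<in> f ` V"
    using family_subspace_add[OF V ab(1,2)] by blast
next
  fix k x assume "x \<in> f ` V"
  then obtain a where a: "a \<in> V" "x = f a"
    by auto
  then have "family_scale k x = f (family_scale k a)"
    using f by (simp add: family_linear_on_def)
  then show "family_scale k x \<in> f ` V"
    using family_subspace_scale[OF V a(1)] by blast
qed

lemma family_subspace_kernel:
  assumes V: "family_subspace V" and f: "family_linear_on V f"
  shows "family_subspace {x \<in> V. f x = 0}"
  using V f family_linear_on_zero[OF V f] by (simp add: family_subspace_def family_linear_on_def)

lemma family_subspace_plus:
  assumes V: "family_subspace V" and W: "family_subspace W"
  shows "family_subspace (V + W)"
  unfolding family_subspace_def
proof (intro conjI ballI allI)
  show "0 \<in> V + W"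
    using set_plus_intro[OF family_subspace_zero[OF V] family_subspace_zero[OF W]] by simp
next
  fix x y assume "x \<in> V + W" "y \<in> V + W"
  then obtain a b a' b' where *: "a \<in> V" "b \<in> W" "a' \<in> V" "b' \<in> W" and xy: "x = a + b" "y = a' + b'"
    by (auto elim!: set_plus_elim)
  have "x + y = (a + a') + (b + b')"
    unfolding xy by (simp add: add_ac)
  then show "x + y \<in> V + W"
    using * set_plus_intro[OF family_subspace_add[OF V] family_subspace_add[OF W]] by simp
next
  fix k x assume "x \<in> V + W"
  then obtain a b where *: "a \<in> V" "b \<in> W" and x: "x = a + b"
    by (auto elim!: set_plus_elim)
  show "family_scale k x \<in> V + W"
    unfolding x family_scale_add
    by (rule set_plus_intro[OF family_subspace_scale[OF V *(1)] family_subspace_scale[OF W *(2)]])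
qed

lemma family_subspace_plus_self:
  assumes "family_subspace B" shows "B + B = B"
proof
  show "B + B \<subseteq> B"
    using family_subspace_add[OF assms] by (auto elim!: set_plus_elim)
  show "B \<subseteq> B + B"
    by (rule set_zero_plus2[OF family_subspace_zero[OF assms]])
qed

lemma coset_eq_iff:
  assumes B: "family_subspace B"
  shows "x +o B = y +o B \<longleftrightarrow> x - y \<in> B"
proof
  assume "x +o B = y +o B"
  moreover have "x \<in> x +o B"
    using set_plus_intro2[OF family_subspace_zero[OF B], of x] by simp
  ultimately show "x - y \<in> B"
    by (simp add: set_minus_plus)
next
  assume d: "x - y \<in> B"
  have sub: "x +o B \<subseteq> y +o B" if "x - y \<in> B" for x y
  proof
    fix w assume "w \<in> x +o B"
    then have "w - x \<in> B"
      by (simp add: set_minus_plus)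
    from family_subspace_add[OF B this that] show "w \<in> y +o B"
      by (simp add: set_minus_plus[symmetric])
  qed
  show "x +o B = y +o B"
    using sub[OF d] sub[of y x] family_subspace_minus[OF B d] by auto
qed

lemma coset_eq_zero_iff: "family_subspace B \<Longrightarrow> x +o B = 0 +o B \<longleftrightarrow> x \<in> B"
  using coset_eq_iff[of B x 0] by simp

lemma coset_eq_self_iff: "family_subspace B \<Longrightarrow> x +o B = B \<longleftrightarrow> x \<in> B"
  using coset_eq_iff[of B x 0] by simp

lemma coset_plus: "family_subspace B \<Longrightarrow> (x +o B) + (y +o B) = (x + y) +o B"
  by (simp add: set_plus_rearrange family_subspace_plus_self)

lemma induced_map_coset:
  assumes B': "family_subspace B'" and f: "family_linear_on UNIV f" and BB': "f ` B \<subseteq> B'" and B: "0 \<in> B"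
  shows "induced_map B' f (x +o B) = f x +o B'"
proof
  show "induced_map B' f (x +o B) \<subseteq> f x +o B'"
  proof
    fix w assume "w \<in> induced_map B' f (x +o B)"
    then obtain b b' where b: "b \<in> B" "b' \<in> B'" "w = f (x + b) + b'"
      unfolding induced_map_def elt_set_plus_def by (auto elim!: set_plus_elim)
    then have "w = f x + (f b + b')"
      using f by (simp add: family_linear_on_def add.assoc)
    moreover have "f b + b' \<in> B'"
      using b BB' by (intro family_subspace_add[OF B']) auto
    ultimately show "w \<in> f x +o B'"
      by (simp add: set_plus_intro2)
  qed
  show "f x +o B' \<subseteq> induced_map B' f (x +o B)"
  proof
    fix w assume "w \<in> f x +o B'"
    then obtain b' where "b' \<in> B'" "w = f x + b'"
      by (auto simp: elt_set_plus_def)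
    moreover have "x \<in> x +o B"
      using set_plus_intro2[OF B, of x] by simp
    ultimately show "w \<in> induced_map B' f (x +o B)"
      unfolding induced_map_def by blast
  qed
qed

lemma coset_scale_eq_induced_map: "coset_scale B k = induced_map B (family_scale k)"
  by (intro ext) (simp add: coset_scale_def induced_map_def)

lemma coset_scale_coset:
  assumes B: "family_subspace B"
  shows "coset_scale B k (x +o B) = family_scale k x +o B"
  unfolding coset_scale_eq_induced_map
  by (rule induced_map_coset[OF B _ _ family_subspace_zero[OF B]])
    (auto simp: family_linear_on_def family_scale_add family_scale_scale mult.commute intro: family_subspace_scale[OF B])

lemma coset_vector_space_quotient:
  assumes B: "family_subspace B" and Z: "family_subspace Z"
  shows "coset_vector_space B (quotient_space Z B)"
  unfolding coset_vector_space_def quotient_space_def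
proof (intro conjI ballI allI)
  show "B \<in> (\<lambda>x. x +o B) ` Z"
    using family_subspace_zero[OF Z] set_zero_plus[of B] by blast
next
  fix C D assume "C \<in> (\<lambda>x. x +o B) ` Z" "D \<in> (\<lambda>x. x +o B) ` Z"
  then show "C + D \<in> (\<lambda>x. x +o B) ` Z"
    using family_subspace_add[OF Z] by (auto simp: coset_plus[OF B])
next
  fix k C assume "C \<in> (\<lambda>x. x +o B) ` Z"
  then show "coset_scale B k C \<in> (\<lambda>x. x +o B) ` Z"
    using family_subspace_scale[OF Z] by (auto simp: coset_scale_coset[OF B])
qed auto

lemma induced_map_linear_isomorphism:
  assumes B: "family_subspace B" and Z: "family_subspace Z" and B': "family_subspace B'" and Z': "family_subspace Z'"
    and f: "family_linear_on UNIV f" and BB': "f ` B \<subseteq> B'" and ZZ': "f ` Z \<subseteq> Z'"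
    and inj: "\<And>x. x \<in> Z \<Longrightarrow> f x \<in> B' \<Longrightarrow> x \<in> B"
    and surj: "\<And>y. y \<in> Z' \<Longrightarrow> \<exists>x\<in>Z. y - f x \<in> B'"
  shows "linear_isomorphism B (quotient_space Z B) B' (quotient_space Z' B') (induced_map B' f)"
proof -
  note im = induced_map_coset[OF B' f BB' family_subspace_zero[OF B]]
  have "inj_on (induced_map B' f) (quotient_space Z B)"
  proof (rule inj_onI)
    fix C D assume "C \<in> quotient_space Z B" "D \<in> quotient_space Z B" and eq: "induced_map B' f C = induced_map B' f D"
    then obtain x y where xy: "x \<in> Z" "y \<in> Z" "C = x +o B" "D = y +o B"
      by (auto simp: quotient_space_def)
    have "f x = f (x - y) + f y"
      using f unfolding family_linear_on_def by (metis UNIV_I diff_add_cancel)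
    then have "f (x - y) = f x - f y"
      by simp
    also have "\<dots> \<in> B'"
      using eq by (simp add: xy im coset_eq_iff[OF B'])
    finally have "x - y \<in> B"
      by (rule inj[OF family_subspace_diff[OF Z xy(1,2)]])
    then show "C = D"
      by (simp add: xy coset_eq_iff[OF B])
  qed
  moreover have "induced_map B' f ` quotient_space Z B = quotient_space Z' B'"
  proof
    show "induced_map B' f ` quotient_space Z B \<subseteq> quotient_space Z' B'"
      using ZZ' by (auto simp: quotient_space_def im)
    show "quotient_space Z' B' \<subseteq> induced_map B' f ` quotient_space Z B"
    proof
      fix D assume "D \<in> quotient_space Z' B'"
      then obtain y where y: "y \<in> Z'" "D = y +o B'"
        by (auto simp: quotient_space_def)
      obtain x where x: "x \<in> Z" "y - f x \<in> B'"
        using surj[OF y(1)] by blast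
      then have "D = induced_map B' f (x +o B)"
        by (simp add: y im coset_eq_iff[OF B'])
      then show "D \<in> induced_map B' f ` quotient_space Z B"
        using x(1) by (auto simp: quotient_space_def)
    qed
  qed
  ultimately have "bij_betw (induced_map B' f) (quotient_space Z B) (quotient_space Z' B')"
    by (simp add: bij_betw_def)
  moreover have "induced_map B' f (C + D) = induced_map B' f C + induced_map B' f D"
    if "C \<in> quotient_space Z B" "D \<in> quotient_space Z B" for C D
    using that f by (auto simp: quotient_space_def coset_plus[OF B] coset_plus[OF B'] im family_linear_on_def)
  moreover have "induced_map B' f (coset_scale B k C) = coset_scale B' k (induced_map B' f C)"
    if "C \<in> quotient_space Z B" for k C
    using that f by (auto simp: quotient_space_def coset_scale_coset[OF B] coset_scale_coset[OF B'] im family_linear_on_def)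
  ultimately show ?thesis
    unfolding linear_isomorphism_def
    using coset_vector_space_quotient[OF B Z] coset_vector_space_quotient[OF B' Z'] by blast
qed

lemma linear_isomorphism_inv:
  assumes "linear_isomorphism B H B' H' f"
  shows "linear_isomorphism B' H' B H (inv_into H f)"
proof -
  have H: "coset_vector_space B H" "coset_vector_space B' H'" and bij: "bij_betw f H H'"
    and add: "\<And>C D. C \<in> H \<Longrightarrow> D \<in> H \<Longrightarrow> f (C + D) = f C + f D"
    and scale: "\<And>k C. C \<in> H \<Longrightarrow> f (coset_scale B k C) = coset_scale B' k (f C)"
    using assms by (auto simp: linear_isomorphism_def)
  have inj: "inj_on f H"
    using bij by (simp add: bij_betw_def)
  have *: "inv_into H f C \<in> H" "f (inv_into H f C) = C" if "C \<in> H'" for C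
    using that bij by (auto simp: bij_betw_def inv_into_into f_inv_into_f)
  have "inv_into H f (C + D) = inv_into H f C + inv_into H f D" if "C \<in> H'" "D \<in> H'" for C D
  proof (rule inv_into_f_eq[OF inj])
    show "inv_into H f C + inv_into H f D \<in> H"
      using H(1) *(1) that by (auto simp: coset_vector_space_def)
    show "f (inv_into H f C + inv_into H f D) = C + D"
      using add * that by simp
  qed
  moreover have "inv_into H f (coset_scale B' k C) = coset_scale B k (inv_into H f C)" if "C \<in> H'" for k C
  proof (rule inv_into_f_eq[OF inj])
    show "coset_scale B k (inv_into H f C) \<in> H"
      using H(1) *(1) that by (auto simp: coset_vector_space_def)
    show "f (coset_scale B k (inv_into H f C)) = coset_scale B' k C"
      using scale * that by simp
  qed
  ultimately show ?thesis
    using H bij_betw_inv_into[OF bij] by (simp add: linear_isomorphism_def)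
qed

lemma linear_isomorphism_comp:
  assumes "linear_isomorphism B H B' H' f" "linear_isomorphism B' H' B'' H'' g"
  shows "linear_isomorphism B H B'' H'' (g \<circ> f)"
proof -
  have "f C \<in> H'" if "C \<in> H" for C
    using assms(1) that by (auto simp: linear_isomorphism_def bij_betw_def)
  then show ?thesis
    using assms by (auto simp: linear_isomorphism_def intro: bij_betw_trans)
qed

lemma linear_isomorphism_restrict:
  assumes B: "family_subspace B" and B': "family_subspace B'" and iso: "linear_isomorphism B H B' H' f"
    and K': "coset_vector_space B' K'" "K' \<subseteq> H'"
  shows "linear_isomorphism B {C \<in> H. f C \<in> K'} B' K' f"
proof -
  have H: "coset_vector_space B H" "coset_vector_space B' H'" and bij: "bij_betw f H H'"
    and add: "\<And>C D. C \<in> H \<Longrightarrow> D \<in> H \<Longrightarrow> f (C + D) = f C + f D"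
    and scale: "\<And>k C. C \<in> H \<Longrightarrow> f (coset_scale B k C) = coset_scale B' k (f C)"
    using iso by (auto simp: linear_isomorphism_def)
  have BH: "B \<in> H"
    using H(1) by (simp add: coset_vector_space_def)
  have "f B \<in> H'"
    using bij BH by (auto simp: bij_betw_def)
  then obtain y where y: "f B = y +o B'"
    using H(2) by (auto simp: coset_vector_space_def)
  have "B = coset_scale B 0 B"
    using coset_scale_coset[OF B, of 0 0] by (simp add: family_scale_zero_left)
  then have "f B = coset_scale B' 0 (f B)"
    using scale[OF BH, of 0] by simp
  also have "\<dots> = B'"
    by (simp add: y coset_scale_coset[OF B'] family_scale_zero_left)
  finally have fB: "f B = B'" .
  have "coset_vector_space B {C \<in> H. f C \<in> K'}"
    using H(1) K'(1) add scale BH fB by (auto simp: coset_vector_space_def)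
  moreover have "bij_betw f {C \<in> H. f C \<in> K'} K'"
    using bij K'(2) by (auto simp: bij_betw_def inj_on_def)
  ultimately show ?thesis
    using K'(1) add scale by (simp add: linear_isomorphism_def)
qed

section \<open>Cohomology of \<open>\<partial>\<partial>bar\<close>-manifolds\<close>

lemma form_wedge_add_right: "form_wedge \<alpha> (\<beta> + \<gamma>) = form_wedge \<alpha> \<beta> + form_wedge \<alpha> \<gamma>"
  by (intro ext) (simp add: form_wedge_def wedge_linear)

lemma form_wedge_add_left: "form_wedge (\<alpha> + \<beta>) \<gamma> = form_wedge \<alpha> \<gamma> + form_wedge \<beta> \<gamma>"
  by (intro ext) (simp add: form_wedge_def wedge_linear)

lemma form_wedge_diff_right: "form_wedge \<alpha> (\<beta> - \<gamma>) = form_wedge \<alpha> \<beta> - form_wedge \<alpha> \<gamma>"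
  by (intro ext) (simp add: form_wedge_def wedge_diff_right)

lemma form_wedge_scale_right: "form_wedge \<alpha> (family_scale k \<beta>) = family_scale k (form_wedge \<alpha> \<beta>)"
  by (intro ext) (simp add: form_wedge_def wedge_linear family_scale_def)

lemma form_wedge_zero [simp]: "form_wedge 0 \<beta> = 0" "form_wedge \<alpha> 0 = 0"
  by (intro ext; simp add: form_wedge_def)+

context complex_atlas
begin

lemma family_subspace_forms: "family_subspace (forms A p q)"
  by (simp add: family_subspace_def forms_zero forms_add forms_scale)

lemma family_subspace_vforms: "family_subspace (vforms A p q)"
  by (simp add: family_subspace_def vforms_zero vforms_add vforms_scale)

lemma family_linear_on_del: "family_linear_on (forms A p q) (del A)"
  by (simp add: family_linear_on_def dolb_True[symmetric] dolb_add dolb_scale)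

lemma family_linear_on_delbar: "family_linear_on (forms A p q) (delbar A)"
  by (simp add: family_linear_on_def dolb_False[symmetric] dolb_add dolb_scale)

lemma family_linear_on_vdelbar: "family_linear_on (vforms A p q) (vdelbar A)"
  by (simp add: family_linear_on_def vdelbar_add vdelbar_scale)

lemma family_linear_on_del_delbar: "family_linear_on (forms A p q) (\<lambda>\<beta>. del A (delbar A \<beta>))"
  using family_linear_on_del[of p "q + 1"] family_linear_on_delbar[of p q] delbar_forms
  by (simp add: family_linear_on_def)

lemma del_zero: "del A 0 = 0"
  using dolb_scale[OF forms_zero, of True 0] by (simp add: dolb_True family_scale_zero_left)

lemma delbar_diff: "\<alpha> \<in> forms A p q \<Longrightarrow> \<beta> \<in> forms A p q \<Longrightarrow> delbar A (\<alpha> - \<beta>) = delbar A \<alpha> - delbar A \<beta>"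
  and delbar_add: "\<alpha> \<in> forms A p q \<Longrightarrow> \<beta> \<in> forms A p q \<Longrightarrow> delbar A (\<alpha> + \<beta>) = delbar A \<alpha> + delbar A \<beta>"
  and delbar_scale: "\<alpha> \<in> forms A p q \<Longrightarrow> delbar A (family_scale k \<alpha>) = family_scale k (delbar A \<alpha>)"
  and delbar_minus: "\<alpha> \<in> forms A p q \<Longrightarrow> delbar A (- \<alpha>) = - delbar A \<alpha>"
  and del_diff: "\<alpha> \<in> forms A p q \<Longrightarrow> \<beta> \<in> forms A p q \<Longrightarrow> del A (\<alpha> - \<beta>) = del A \<alpha> - del A \<beta>"
proof -
  show add: "\<alpha> \<in> forms A p q \<Longrightarrow> \<beta> \<in> forms A p q \<Longrightarrow> delbar A (\<alpha> + \<beta>) = delbar A \<alpha> + delbar A \<beta>"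
    and scale: "\<alpha> \<in> forms A p q \<Longrightarrow> delbar A (family_scale k \<alpha>) = family_scale k (delbar A \<alpha>)" for \<alpha> \<beta> k
    using family_linear_on_delbar[of p q] by (simp_all add: family_linear_on_def)
  show minus: "\<alpha> \<in> forms A p q \<Longrightarrow> delbar A (- \<alpha>) = - delbar A \<alpha>" for \<alpha>
    using scale[of \<alpha> "-1"] by (simp add: family_scale_minus_one)
  show "\<alpha> \<in> forms A p q \<Longrightarrow> \<beta> \<in> forms A p q \<Longrightarrow> delbar A (\<alpha> - \<beta>) = delbar A \<alpha> - delbar A \<beta>"
    using add[of \<alpha> "- \<beta>"] family_subspace_minus[OF family_subspace_forms] by (simp add: minus)
  have dadd: "\<alpha> \<in> forms A p q \<Longrightarrow> \<beta> \<in> forms A p q \<Longrightarrow> del A (\<alpha> + \<beta>) = del A \<alpha> + del A \<beta>"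
    and dscale: "\<alpha> \<in> forms A p q \<Longrightarrow> del A (family_scale k \<alpha>) = family_scale k (del A \<alpha>)" for \<alpha> \<beta> k
    using family_linear_on_del[of p q] by (simp_all add: family_linear_on_def)
  show "\<alpha> \<in> forms A p q \<Longrightarrow> \<beta> \<in> forms A p q \<Longrightarrow> del A (\<alpha> - \<beta>) = del A \<alpha> - del A \<beta>"
    using dadd[of \<alpha> "- \<beta>"] dscale[of \<beta> "-1"] family_subspace_minus[OF family_subspace_forms]
    by (simp add: family_scale_minus_one)
qed

lemma family_subspace_BC_exact: "family_subspace (BC_exact A p q)"
  unfolding BC_exact_def by (rule family_subspace_image[OF family_subspace_forms family_linear_on_del_delbar])

lemma family_subspace_delbar_exact: "family_subspace (delbar_exact A p q)"
  unfolding delbar_exact_def by (rule family_subspace_image[OF family_subspace_forms family_linear_on_delbar])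

lemma family_subspace_A_exact: "family_subspace (A_exact A p q)"
  unfolding A_exact_def
  by (intro family_subspace_plus family_subspace_image[OF family_subspace_forms] family_linear_on_del family_linear_on_delbar)

lemma family_subspace_T_exact: "family_subspace (T_exact A q)"
  unfolding T_exact_def by (rule family_subspace_image[OF family_subspace_vforms family_linear_on_vdelbar])

lemma family_subspace_delbar_closed: "family_subspace {\<alpha> \<in> forms A p q. delbar A \<alpha> = 0}"
  by (rule family_subspace_kernel[OF family_subspace_forms family_linear_on_delbar])

lemma family_subspace_vdelbar_closed: "family_subspace {\<theta> \<in> vforms A p q. vdelbar A \<theta> = 0}"
  by (rule family_subspace_kernel[OF family_subspace_vforms family_linear_on_vdelbar])

lemma family_subspace_d_closed: "family_subspace {\<alpha> \<in> forms A p q. del A \<alpha> = 0 \<and> delbar A \<alpha> = 0}"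
proof -
  have "family_linear_on {\<alpha> \<in> forms A p q. del A \<alpha> = 0} (delbar A)"
    using family_linear_on_delbar[of p q] by (simp add: family_linear_on_def)
  from family_subspace_kernel[OF family_subspace_kernel[OF family_subspace_forms family_linear_on_del] this]
  show ?thesis
    by (simp add: conj_ac)
qed

lemma del_exactI: "a \<in> forms A (p - 1) q \<Longrightarrow> del A a \<in> A_exact A p q"
  unfolding A_exact_def
  using set_plus_intro[of "del A a" "del A ` forms A (p - 1) q" 0 "delbar A ` forms A p (q - 1)"]
    family_subspace_zero[OF family_subspace_delbar_exact[of p q, unfolded delbar_exact_def]] by simp

lemma delbar_exactI: "b \<in> forms A p (q - 1) \<Longrightarrow> delbar A b \<in> delbar_exact A p q"
  by (simp add: delbar_exact_def)

lemma delbar_exact_subset_A_exact: "delbar_exact A p q \<subseteq> A_exact A p q"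
  unfolding A_exact_def delbar_exact_def
  by (rule set_zero_plus2) (rule family_subspace_zero[OF family_subspace_image[OF family_subspace_forms family_linear_on_del]])

lemma BC_exact_subset_delbar_exact: "BC_exact A p q \<subseteq> delbar_exact A p q"
proof
  fix \<gamma> assume "\<gamma> \<in> BC_exact A p q"
  then obtain \<beta> where \<beta>: "\<beta> \<in> forms A (p - 1) (q - 1)" "\<gamma> = del A (delbar A \<beta>)"
    by (auto simp: BC_exact_def)
  have d: "del A \<beta> \<in> forms A p (q - 1)"
    using del_forms[OF \<beta>(1)] by simp
  have "\<gamma> = delbar A (- del A \<beta>)"
    using del_delbar_anticommute[OF \<beta>(1)] \<beta>(2) delbar_minus[OF d] by simp
  then show "\<gamma> \<in> delbar_exact A p q"
    using family_subspace_minus[OF family_subspace_forms d] by (auto simp: delbar_exact_def)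
qed

end

locale ddbar_atlas = complex_atlas X A for X :: "'a topology" and A :: "('a, 'n::{finite,linorder}) chart set" +
  assumes ddbar: "ddbar_manifold A"
begin

lemma d_closed_exact_iff:
  assumes "\<alpha> \<in> forms A p q" "del A \<alpha> = 0" "delbar A \<alpha> = 0"
  shows "\<alpha> \<in> del A ` forms A (p - 1) q \<longleftrightarrow> \<alpha> \<in> delbar_exact A p q"
    and "\<alpha> \<in> delbar_exact A p q \<longleftrightarrow> \<alpha> \<in> BC_exact A p q"
  using ddbar assms by (auto simp: ddbar_manifold_def ext_d_def delbar_exact_def BC_exact_def)

lemma del_square: "\<alpha> \<in> forms A p q \<Longrightarrow> del A (del A \<alpha>) = 0"
  using dolb_square[of \<alpha> p q True] by (simp add: dolb_True)

lemma delbar_square: "\<alpha> \<in> forms A p q \<Longrightarrow> delbar A (delbar A \<alpha>) = 0"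
  using dolb_square[of \<alpha> p q False] by (simp add: dolb_False)

text \<open>The injectivity of the canonical map from Dolbeault to Aeppli cohomology: if \<open>\<delta> = \<partial>a + \<partial>bar b\<close> is
  \<open>\<partial>bar\<close>-closed, then \<open>\<partial>a\<close> is \<open>d\<close>-closed and \<open>\<partial>\<close>-exact, hence \<open>\<partial>bar\<close>-exact.\<close>
lemma A_exact_imp_delbar_exact:
  assumes \<delta>: "delbar A \<delta> = 0" "\<delta> \<in> A_exact A p q"
  shows "\<delta> \<in> delbar_exact A p q"
proof -
  obtain a b where a: "a \<in> forms A (p - 1) q" and b: "b \<in> forms A p (q - 1)" and eq: "\<delta> = del A a + delbar A b"
    using \<delta>(2) by (auto simp: A_exact_def elim!: set_plus_elim)
  have fa: "del A a \<in> forms A p q" and fb: "delbar A b \<in> forms A p q"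
    using del_forms[OF a] delbar_forms[OF b] by simp_all
  have "delbar A (del A a) = 0"
    using \<delta>(1) delbar_add[OF fa fb] delbar_square[OF b] by (simp add: eq)
  then have "del A a \<in> delbar_exact A p q"
    using d_closed_exact_iff(1)[OF fa del_square[OF a]] a by blast
  then show ?thesis
    unfolding eq by (intro family_subspace_add[OF family_subspace_delbar_exact] delbar_exactI b)
qed

text \<open>Injectivity is one of the equivalences of the \<open>\<partial>\<partial>bar\<close>-property. For surjectivity, a \<open>\<partial>bar\<close>-closed \<open>y\<close> has
  a \<open>d\<close>-closed and \<open>\<partial>\<close>-exact derivative \<open>\<partial>y\<close>, which therefore is \<open>\<partial>\<partial>bar \<beta>\<close> for some \<open>\<beta>\<close>; then \<open>y - \<partial>bar \<beta>\<close> is a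
  \<open>d\<close>-closed representative of the Dolbeault class of \<open>y\<close>.\<close>
lemma canonical_BC_delbar_iso:
  "linear_isomorphism (BC_exact A p q) (H_BC A p q) (delbar_exact A p q) (H_delbar A p q) (canonical_BC_delbar A p q)"
  unfolding H_BC_def H_delbar_def canonical_BC_delbar_def
proof (rule induced_map_linear_isomorphism[OF family_subspace_BC_exact family_subspace_d_closed
      family_subspace_delbar_exact family_subspace_delbar_closed])
  show "family_linear_on UNIV (\<lambda>\<alpha>. \<alpha>)"
    by (simp add: family_linear_on_def)
  show "(\<lambda>\<alpha>. \<alpha>) ` BC_exact A p q \<subseteq> delbar_exact A p q"
    using BC_exact_subset_delbar_exact by simp
  show "x \<in> BC_exact A p q" if "x \<in> {\<alpha> \<in> forms A p q. del A \<alpha> = 0 \<and> delbar A \<alpha> = 0}" "x \<in> delbar_exact A p q" for x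
    using d_closed_exact_iff(2) that by blast
  show "\<exists>x\<in>{\<alpha> \<in> forms A p q. del A \<alpha> = 0 \<and> delbar A \<alpha> = 0}. y - x \<in> delbar_exact A p q"
    if "y \<in> {\<alpha> \<in> forms A p q. delbar A \<alpha> = 0}" for y
  proof -
    have y: "y \<in> forms A p q" "delbar A y = 0"
      using that by auto
    have "del A y \<in> forms A (p + 1) q" "del A (del A y) = 0" "delbar A (del A y) = 0"
      using del_forms[OF y(1)] del_square[OF y(1)] del_delbar_anticommute[OF y(1)] y(2)
        by (simp_all add: del_zero)
    moreover have "del A y \<in> del A ` forms A (p + 1 - 1) q"
      using y(1) by simp
    ultimately have "del A y \<in> BC_exact A (p + 1) q"
      using d_closed_exact_iff by blast
    then obtain \<beta> where \<beta>: "\<beta> \<in> forms A p (q - 1)" "del A y = del A (delbar A \<beta>)"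
      by (auto simp: BC_exact_def)
    have d\<beta>: "delbar A \<beta> \<in> forms A p q"
      using delbar_forms[OF \<beta>(1)] by simp
    have "y - delbar A \<beta> \<in> {\<alpha> \<in> forms A p q. del A \<alpha> = 0 \<and> delbar A \<alpha> = 0}"
      using family_subspace_diff[OF family_subspace_forms y(1) d\<beta>] del_diff[OF y(1) d\<beta>] delbar_diff[OF y(1) d\<beta>]
        y(2) \<beta>(2) delbar_square[OF \<beta>(1)] by simp
    moreover have "y - (y - delbar A \<beta>) \<in> delbar_exact A p q"
      using delbar_exactI[OF \<beta>(1)] by simp
    ultimately show ?thesis
      by blast
  qed
qed auto

end

section \<open>The Calabi-Yau isomorphism\<close>

context volume_atlas
begin

text \<open>Statements on \<^const>\<open>vdelbar\<close> are transferred from \<open>\<partial>bar\<close> on scalar forms by contracting \<open>u\<close>. In this way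
  no transformation law has to be checked for \<open>vdelbar A \<xi>\<close> itself.\<close>
lemma vdelbar_eqI:
  assumes \<xi>: "\<xi> \<in> vforms A 0 q" and \<theta>: "\<theta> \<in> vforms A 0 (q + 1)"
    and eq: "contract \<theta> u = delbar A (contract \<xi> u)"
  shows "vdelbar A \<xi> = \<theta>"
proof -
  have "\<theta> - vdelbar A \<xi> = 0"
  proof (rule contract_u_cancel)
    show "bideg 0 (q + 1) (vcomp i ((\<theta> - vdelbar A \<xi>) c z))" for c z i
      using bideg_diff[OF vforms_bideg[OF \<theta>] vdelbar_bideg[OF \<xi>]] by simp
    show "(\<theta> - vdelbar A \<xi>) c z = 0" if "c \<notin> A \<or> z \<notin> chart_image c" for c z
      using vforms_outside[OF \<theta> that] that by (auto simp: vdelbar_def)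
    show "contract (\<theta> - vdelbar A \<xi>) u = 0"
      by (simp add: contract_diff eq contract_vdelbar[OF \<xi>])
  qed
  then show ?thesis
    by simp
qed

lemma vdelbar_zero_iff:
  assumes \<theta>: "\<theta> \<in> vforms A 0 q"
  shows "vdelbar A \<theta> = 0 \<longleftrightarrow> delbar A (contract \<theta> u) = 0"
proof
  show "vdelbar A \<theta> = 0" if "delbar A (contract \<theta> u) = 0"
  proof (rule vdelbar_eqI[OF \<theta> vforms_zero])
    show "contract 0 u = delbar A (contract \<theta> u)"
      unfolding that by (intro ext) (simp add: contract_def)
  qed
  show "delbar A (contract \<theta> u) = 0" if "vdelbar A \<theta> = 0"
    unfolding contract_vdelbar[OF \<theta>, symmetric] that by (intro ext) (simp add: contract_def)
qed

lemma T_exact_closed: "T_exact A 1 \<subseteq> {\<theta> \<in> vforms A 0 1. vdelbar A \<theta> = 0}"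
proof
  fix x assume "x \<in> T_exact A 1"
  then obtain \<xi> where \<xi>: "\<xi> \<in> vforms A 0 0" "x = vdelbar A \<xi>"
    by (auto simp: T_exact_def)
  have f: "delbar A (contract \<xi> u) \<in> forms A (int CARD('n) - 1) (0 + 1)"
    by (rule delbar_forms[OF contract_u_forms[OF \<xi>(1)]])
  obtain \<theta> where \<theta>: "\<theta> \<in> vforms A 0 (0 + 1)" "contract \<theta> u = delbar A (contract \<xi> u)"
    by (rule contract_u_surj[OF f])
  have "x = \<theta>"
    unfolding \<xi>(2) by (rule vdelbar_eqI[OF \<xi>(1) \<theta>])
  moreover have "delbar A (contract \<theta> u) = 0"
    using dolb_square[OF contract_u_forms[OF \<xi>(1)], of False] by (simp add: \<theta>(2) dolb_False)
  ultimately show "x \<in> {\<theta> \<in> vforms A 0 1. vdelbar A \<theta> = 0}"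
    using \<theta>(1) vdelbar_zero_iff[OF \<theta>(1)] by simp
qed

lemma family_linear_on_contract: "family_linear_on UNIV (\<lambda>\<theta>. contract \<theta> u)"
  by (simp add: family_linear_on_def contract_add contract_scale)

lemma contract_T_exact: "(\<lambda>\<theta>. contract \<theta> u) ` T_exact A 1 \<subseteq> delbar_exact A (int CARD('n) - 1) 1"
  using contract_u_forms by (auto simp: T_exact_def delbar_exact_def contract_vdelbar)

lemma calabi_yau_map_iso:
  "linear_isomorphism (T_exact A 1) (H_T A 1)
     (delbar_exact A (int CARD('n) - 1) 1) (H_delbar A (int CARD('n) - 1) 1) (calabi_yau_map A u)"
  unfolding H_T_def H_delbar_def calabi_yau_map_def
proof (rule induced_map_linear_isomorphism[OF family_subspace_T_exact family_subspace_vdelbar_closed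
      family_subspace_delbar_exact family_subspace_delbar_closed family_linear_on_contract contract_T_exact])
  show "(\<lambda>\<theta>. contract \<theta> u) ` {\<theta> \<in> vforms A 0 1. vdelbar A \<theta> = 0}
      \<subseteq> {\<alpha> \<in> forms A (int CARD('n) - 1) 1. delbar A \<alpha> = 0}"
    using contract_u_forms vdelbar_zero_iff by blast
  show "\<theta> \<in> T_exact A 1" if closed: "\<theta> \<in> {\<theta> \<in> vforms A 0 1. vdelbar A \<theta> = 0}"
    and exact: "contract \<theta> u \<in> delbar_exact A (int CARD('n) - 1) 1" for \<theta>
  proof -
    obtain \<beta> where \<beta>: "\<beta> \<in> forms A (int CARD('n) - 1) 0" "contract \<theta> u = delbar A \<beta>"
      using exact by (auto simp: delbar_exact_def)
    obtain \<xi> where \<xi>: "\<xi> \<in> vforms A 0 0" "contract \<xi> u = \<beta>"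
      by (rule contract_u_surj[OF \<beta>(1)])
    have "vdelbar A \<xi> = \<theta>"
      using closed by (intro vdelbar_eqI[OF \<xi>(1)]) (simp_all add: \<xi>(2) \<beta>(2))
    then show ?thesis
      using \<xi>(1) by (auto simp: T_exact_def)
  qed
  show "\<exists>\<theta>\<in>{\<theta> \<in> vforms A 0 1. vdelbar A \<theta> = 0}. y - contract \<theta> u \<in> delbar_exact A (int CARD('n) - 1) 1"
    if "y \<in> {\<alpha> \<in> forms A (int CARD('n) - 1) 1. delbar A \<alpha> = 0}" for y
  proof -
    have y: "y \<in> forms A (int CARD('n) - 1) 1" "delbar A y = 0"
      using that by auto
    obtain \<theta> where \<theta>: "\<theta> \<in> vforms A 0 1" "contract \<theta> u = y"
      by (rule contract_u_surj[OF y(1)])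
    then have "vdelbar A \<theta> = 0"
      using vdelbar_zero_iff[OF \<theta>(1)] y(2) by simp
    moreover have "y - contract \<theta> u \<in> delbar_exact A (int CARD('n) - 1) 1"
      using family_subspace_zero[OF family_subspace_delbar_exact] by (simp add: \<theta>(2))
    ultimately show ?thesis
      using \<theta>(1) by blast
  qed
qed

end

section \<open>Polarised and primitive classes\<close>

locale skt_atlas = volume_atlas X A u + ddbar_atlas X A
  for X :: "'a topology" and A :: "('a, 'n::{finite,linorder}) chart set" and u +
  fixes \<omega> :: "('a, 'n) form"
  assumes skt: "SKT_metric A \<omega>"
begin

lemma omega_forms: "\<omega> \<in> forms A 1 1" and del_delbar_omega: "del A (delbar A \<omega>) = 0"
  using skt by (auto simp: SKT_metric_def)

lemma delbar_form_wedge: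
  "\<alpha> \<in> forms A p q \<Longrightarrow> \<beta> \<in> forms A r s \<Longrightarrow> delbar A (form_wedge \<alpha> \<beta>) =
    form_wedge (delbar A \<alpha>) \<beta> + family_scale (if even (p + q) then 1 else -1) (form_wedge \<alpha> (delbar A \<beta>))"
  using dolb_form_wedge[of \<alpha> p q \<beta> r s False] by (simp add: dolb_False)

lemma del_form_wedge:
  "\<alpha> \<in> forms A p q \<Longrightarrow> \<beta> \<in> forms A r s \<Longrightarrow> del A (form_wedge \<alpha> \<beta>) =
    form_wedge (del A \<alpha>) \<beta> + family_scale (if even (p + q) then 1 else -1) (form_wedge \<alpha> (del A \<beta>))"
  using dolb_form_wedge[of \<alpha> p q \<beta> r s True] by (simp add: dolb_True)

lemma T_tilde_iso:
  "linear_isomorphism (T_exact A 1) (H_T A 1)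
     (BC_exact A (int CARD('n) - 1) 1) (H_BC A (int CARD('n) - 1) 1) (T_tilde A u)"
  unfolding T_tilde_def
  by (rule linear_isomorphism_comp[OF calabi_yau_map_iso linear_isomorphism_inv[OF canonical_BC_delbar_iso]])

lemma T_tilde_coset:
  assumes \<theta>: "\<theta> \<in> vforms A 0 1" "vdelbar A \<theta> = 0"
  obtains \<gamma> \<eta> where "\<gamma> \<in> forms A (int CARD('n) - 1) 1" "del A \<gamma> = 0" "delbar A \<gamma> = 0"
    "\<eta> \<in> forms A (int CARD('n) - 1) 0" "\<gamma> = contract \<theta> u + delbar A \<eta>"
    "T_tilde A u (\<theta> +o T_exact A 1) = \<gamma> +o BC_exact A (int CARD('n) - 1) 1"
proof -
  let ?B = "delbar_exact A (int CARD('n) - 1) 1" and ?can = "canonical_BC_delbar A (int CARD('n) - 1) 1"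
  have C: "\<theta> +o T_exact A 1 \<in> H_T A 1"
    using \<theta> by (auto simp: H_T_def quotient_space_def)
  then have "T_tilde A u (\<theta> +o T_exact A 1) \<in> H_BC A (int CARD('n) - 1) 1"
    using T_tilde_iso by (auto simp: linear_isomorphism_def bij_betw_def)
  then obtain \<gamma> where \<gamma>: "\<gamma> \<in> forms A (int CARD('n) - 1) 1" "del A \<gamma> = 0" "delbar A \<gamma> = 0"
    and T: "T_tilde A u (\<theta> +o T_exact A 1) = \<gamma> +o BC_exact A (int CARD('n) - 1) 1"
    by (auto simp: H_BC_def quotient_space_def)
  have "calabi_yau_map A u (\<theta> +o T_exact A 1) \<in> H_delbar A (int CARD('n) - 1) 1"
    using calabi_yau_map_iso C by (auto simp: linear_isomorphism_def bij_betw_def)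
  then have "?can (T_tilde A u (\<theta> +o T_exact A 1)) = calabi_yau_map A u (\<theta> +o T_exact A 1)"
    using canonical_BC_delbar_iso[of "int CARD('n) - 1" 1]
    by (simp add: T_tilde_def linear_isomorphism_def bij_betw_def f_inv_into_f)
  moreover have "calabi_yau_map A u (\<theta> +o T_exact A 1) = contract \<theta> u +o ?B"
    unfolding calabi_yau_map_def
    by (rule induced_map_coset[OF family_subspace_delbar_exact family_linear_on_contract contract_T_exact
          family_subspace_zero[OF family_subspace_T_exact]])
  moreover have "?can (\<gamma> +o BC_exact A (int CARD('n) - 1) 1) = \<gamma> +o ?B"
    unfolding canonical_BC_delbar_def
    by (rule induced_map_coset[OF family_subspace_delbar_exact _ _ family_subspace_zero[OF family_subspace_BC_exact]])
      (use BC_exact_subset_delbar_exact in \<open>auto simp: family_linear_on_def\<close>)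
  ultimately have "\<gamma> +o ?B = contract \<theta> u +o ?B"
    by (simp add: T)
  then have "\<gamma> - contract \<theta> u \<in> ?B"
    by (simp add: coset_eq_iff[OF family_subspace_delbar_exact])
  then obtain \<eta> where "\<eta> \<in> forms A (int CARD('n) - 1) 0" "\<gamma> - contract \<theta> u = delbar A \<eta>"
    by (auto simp: delbar_exact_def)
  then show ?thesis
    using that[OF \<gamma>, of \<eta>] T by (simp add: algebra_simps)
qed

text \<open>\<open>\<partial>bar \<omega>\<close> is \<open>\<partial>\<close>-closed by the SKT condition, so the \<open>\<partial>\<partial>bar\<close>-property makes it \<open>\<partial>\<partial>bar\<close>-exact. Without
  this the condition defining \<^const>\<open>H_T_polarised\<close> would be void.\<close>
lemma SKT_delbar_class_nonempty: "SKT_delbar_class A \<omega> \<noteq> {}"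
proof -
  have f: "delbar A \<omega> \<in> forms A 1 2"
    using delbar_forms[OF omega_forms] by simp
  have "delbar A \<omega> \<in> delbar_exact A 1 2"
    using omega_forms by (intro delbar_exactI) simp
  then have "delbar A \<omega> \<in> BC_exact A 1 2"
    using d_closed_exact_iff(2)[OF f del_delbar_omega delbar_square[OF omega_forms]] by simp
  then obtain \<alpha> where \<alpha>: "\<alpha> \<in> forms A 0 1" "delbar A \<omega> = del A (delbar A \<alpha>)"
    by (auto simp: BC_exact_def)
  have "\<omega> + del A \<alpha> \<in> (\<omega> + del A \<alpha>) +o delbar_exact A 1 1"
    using set_plus_intro2[OF family_subspace_zero[OF family_subspace_delbar_exact], of "\<omega> + del A \<alpha>"] by simp
  then show ?thesis
    using \<alpha> unfolding SKT_delbar_class_def by blast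
qed

lemma SKT_delbar_classE:
  assumes "\<zeta> \<in> SKT_delbar_class A \<omega>"
  obtains \<alpha> \<beta> where "\<alpha> \<in> forms A 0 1" "\<beta> \<in> forms A 1 0" "\<zeta> = \<omega> + del A \<alpha> + delbar A \<beta>"
    "\<zeta> \<in> forms A 1 1" "delbar A \<zeta> = 0"
proof -
  obtain \<alpha> \<beta> where \<alpha>: "\<alpha> \<in> forms A 0 1" "delbar A \<omega> = del A (delbar A \<alpha>)" and \<beta>: "\<beta> \<in> forms A 1 0"
    and \<zeta>: "\<zeta> = \<omega> + del A \<alpha> + delbar A \<beta>"
    using assms by (auto simp: SKT_delbar_class_def delbar_exact_def elt_set_plus_def)
  have f1: "del A \<alpha> \<in> forms A 1 1" and f2: "delbar A \<beta> \<in> forms A 1 1"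
    using del_forms[OF \<alpha>(1)] delbar_forms[OF \<beta>] by simp_all
  have f: "\<omega> + del A \<alpha> \<in> forms A 1 1"
    by (rule forms_add[OF omega_forms f1])
  have "delbar A \<zeta> = 0"
    unfolding \<zeta> delbar_add[OF f f2] delbar_add[OF omega_forms f1]
    using del_delbar_anticommute[OF \<alpha>(1)] delbar_square[OF \<beta>] \<alpha>(2) by simp
  then show ?thesis
    using that[OF \<alpha>(1) \<beta> \<zeta>] forms_add[OF f f2] \<zeta> by simp
qed

text \<open>Wedging with \<open>u\<close> is a bijection of the forms of bidegree \<open>(0, r)\<close> onto those of bidegree \<open>(n, r)\<close>, and
  \<open>\<partial>bar (u \<and> b) = (-1)\<^sup>n u \<and> \<partial>bar b\<close> because \<open>\<partial>bar u = 0\<close>. The statement is applied to a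
  contraction \<open>\<theta> \<lrcorner> \<zeta>\<close>, which is known only pointwise; that it is a global form follows from either side.\<close>
lemma form_wedge_u_delbar_exact_iff:
  assumes bd: "\<And>c z. bideg 0 q (\<beta> c z)" and out: "\<And>c z. c \<notin> A \<or> z \<notin> chart_image c \<Longrightarrow> \<beta> c z = 0"
  shows "form_wedge u \<beta> \<in> delbar_exact A (int CARD('n)) q \<longleftrightarrow> \<beta> \<in> delbar_exact A 0 q"
proof -
  define s :: complex where "s = (if even CARD('n) then 1 else -1)"
  have ss: "s * s = 1"
    by (simp add: s_def)
  have *: "delbar A (form_wedge u (family_scale s b)) = form_wedge u (delbar A b)" if b: "b \<in> forms A 0 r" for b r
    using delbar_form_wedge[OF u_forms forms_scale[OF b], of s] delbar_scale[OF b, of s]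
    by (cases "even CARD('n)") (simp_all add: s_def delbar_u form_wedge_scale_right family_scale_scale)
  show ?thesis
  proof
    assume "\<beta> \<in> delbar_exact A 0 q"
    then obtain b where b: "b \<in> forms A 0 (q - 1)" "\<beta> = delbar A b"
      by (auto simp: delbar_exact_def)
    have "form_wedge u (family_scale s b) \<in> forms A (int CARD('n)) (q - 1)"
      using form_wedge_forms[OF u_forms forms_scale[OF b(1)], of s] by simp
    from delbar_exactI[OF this] show "form_wedge u \<beta> \<in> delbar_exact A (int CARD('n)) q"
      unfolding *[OF b(1)] b(2) .
  next
    assume "form_wedge u \<beta> \<in> delbar_exact A (int CARD('n)) q"
    then obtain c where c: "c \<in> forms A (int CARD('n)) (q - 1)" "form_wedge u \<beta> = delbar A c"
      by (auto simp: delbar_exact_def)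
    obtain b where b: "b \<in> forms A 0 (q - 1)" "form_wedge u b = c"
      by (rule form_wedge_u_surj[OF c(1)])
    have sb: "family_scale s b \<in> forms A 0 (q - 1)" and f: "delbar A (family_scale s b) \<in> forms A 0 q"
      using forms_scale[OF b(1)] delbar_forms[OF forms_scale[OF b(1)]] by auto
    have "form_wedge u \<beta> = form_wedge u (delbar A (family_scale s b))"
      using *[OF sb] by (simp add: family_scale_scale ss b(2) c(2))
    then have "form_wedge u (\<beta> - delbar A (family_scale s b)) = 0"
      by (simp add: form_wedge_diff_right)
    moreover have "bideg 0 q ((\<beta> - delbar A (family_scale s b)) c z)" for c z
      using bideg_diff[OF bd forms_bideg[OF f]] by simp
    moreover have "(\<beta> - delbar A (family_scale s b)) c z = 0" if "c \<notin> A \<or> z \<notin> chart_image c" for c z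
      using out[OF that] forms_outside[OF f that] by simp
    ultimately have "\<beta> - delbar A (family_scale s b) = 0"
      using form_wedge_u_cancel by blast
    then show "\<beta> \<in> delbar_exact A 0 q"
      using delbar_exactI[OF sb] by simp
  qed
qed

text \<open>Modulo \<open>Im \<partial> + Im \<partial>bar\<close>, replacing \<open>\<omega>\<close> by \<open>\<zeta>\<close> is possible because \<open>\<gamma>\<close> is closed under both operators, and
  replacing \<open>\<gamma>\<close> by \<open>\<theta> \<lrcorner> u\<close> because \<open>\<zeta>\<close> is \<open>\<partial>bar\<close>-closed. What remains is \<open>- u \<and> (\<theta> \<lrcorner> \<zeta>)\<close>.\<close>
lemma wedge_omega_exact_iff:
  assumes \<theta>: "\<theta> \<in> vforms A 0 1" "vdelbar A \<theta> = 0"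
    and \<gamma>: "\<gamma> \<in> forms A (int CARD('n) - 1) 1" "del A \<gamma> = 0" "delbar A \<gamma> = 0"
    and \<eta>: "\<eta> \<in> forms A (int CARD('n) - 1) 0" and eq: "\<gamma> = contract \<theta> u + delbar A \<eta>"
    and \<zeta>: "\<zeta> \<in> SKT_delbar_class A \<omega>"
  shows "form_wedge \<omega> \<gamma> \<in> A_exact A (int CARD('n)) 2 \<longleftrightarrow> contract \<theta> \<zeta> \<in> delbar_exact A 0 2"
proof -
  let ?n = "int CARD('n)"
  let ?E = "A_exact A ?n 2"
  obtain \<alpha> \<beta> where \<alpha>: "\<alpha> \<in> forms A 0 1" and \<beta>: "\<beta> \<in> forms A 1 0" and \<zeta>_eq: "\<zeta> = \<omega> + del A \<alpha> + delbar A \<beta>"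
    and \<zeta>_forms: "\<zeta> \<in> forms A 1 1" and \<zeta>_closed: "delbar A \<zeta> = 0"
    using SKT_delbar_classE[OF \<zeta>] by blast
  note E = family_subspace_A_exact[of ?n 2]
  have "form_wedge (del A \<alpha>) \<gamma> = del A (form_wedge \<alpha> \<gamma>)"
    using del_form_wedge[OF \<alpha> \<gamma>(1)] by (simp add: \<gamma>(2) family_scale_minus_one)
  moreover have "form_wedge \<alpha> \<gamma> \<in> forms A (?n - 1) 2"
    using form_wedge_forms[OF \<alpha> \<gamma>(1)] by simp
  ultimately have 1: "form_wedge (del A \<alpha>) \<gamma> \<in> ?E"
    using del_exactI by simp
  have "form_wedge (delbar A \<beta>) \<gamma> = delbar A (form_wedge \<beta> \<gamma>)"
    using delbar_form_wedge[OF \<beta> \<gamma>(1)] by (simp add: \<gamma>(3) family_scale_minus_one)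
  moreover have "form_wedge \<beta> \<gamma> \<in> forms A ?n (2 - 1)"
    using form_wedge_forms[OF \<beta> \<gamma>(1)] by simp
  ultimately have 2: "form_wedge (delbar A \<beta>) \<gamma> \<in> ?E"
    using delbar_exactI[of _ ?n 2] delbar_exact_subset_A_exact by auto
  have "form_wedge \<zeta> (delbar A \<eta>) = delbar A (form_wedge \<zeta> \<eta>)"
    using delbar_form_wedge[OF \<zeta>_forms \<eta>] by (simp add: \<zeta>_closed)
  moreover have "form_wedge \<zeta> \<eta> \<in> forms A ?n (2 - 1)"
    using form_wedge_forms[OF \<zeta>_forms \<eta>] by simp
  ultimately have 3: "form_wedge \<zeta> (delbar A \<eta>) \<in> ?E"
    using delbar_exactI[of _ ?n 2] delbar_exact_subset_A_exact by auto
  have "form_wedge \<omega> \<gamma> = form_wedge \<zeta> \<gamma> - (form_wedge (del A \<alpha>) \<gamma> + form_wedge (delbar A \<beta>) \<gamma>)"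
    unfolding \<zeta>_eq form_wedge_add_left by simp
  also have "form_wedge \<zeta> \<gamma> = form_wedge \<zeta> (contract \<theta> u) + form_wedge \<zeta> (delbar A \<eta>)"
    unfolding eq form_wedge_add_right by simp
  also have "form_wedge \<zeta> (contract \<theta> u) = - form_wedge u (contract \<theta> \<zeta>)"
    by (rule form_wedge_contract[OF \<theta>(1) \<zeta>_forms])
  finally have diff: "form_wedge \<omega> \<gamma> = - form_wedge u (contract \<theta> \<zeta>)
      + (form_wedge \<zeta> (delbar A \<eta>) - (form_wedge (del A \<alpha>) \<gamma> + form_wedge (delbar A \<beta>) \<gamma>))" (is "_ = _ + ?e")
    unfolding add_diff_eq .
  have e: "?e \<in> ?E"
    by (intro family_subspace_diff[OF E] family_subspace_add[OF E] 1 2 3)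
  have "form_wedge \<omega> \<gamma> \<in> ?E \<longleftrightarrow> form_wedge u (contract \<theta> \<zeta>) \<in> ?E"
  proof
    assume "form_wedge \<omega> \<gamma> \<in> ?E"
    from family_subspace_diff[OF E e this] show "form_wedge u (contract \<theta> \<zeta>) \<in> ?E"
      unfolding diff by simp
  next
    assume "form_wedge u (contract \<theta> \<zeta>) \<in> ?E"
    from family_subspace_add[OF E family_subspace_minus[OF E this] e] show "form_wedge \<omega> \<gamma> \<in> ?E"
      unfolding diff .
  qed
  also have "\<dots> \<longleftrightarrow> form_wedge u (contract \<theta> \<zeta>) \<in> delbar_exact A ?n 2"
  proof
    assume ex: "form_wedge u (contract \<theta> \<zeta>) \<in> ?E"
    have f: "contract \<theta> u \<in> forms A (?n - 1) 1"
      by (rule contract_u_forms[OF \<theta>(1)])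
    have "delbar A (contract \<theta> u) = 0"
      using \<theta>(2) vdelbar_zero_iff[OF \<theta>(1)] by simp
    then have "delbar A (form_wedge \<zeta> (contract \<theta> u)) = 0"
      using delbar_form_wedge[OF \<zeta>_forms f] by (simp add: \<zeta>_closed)
    moreover have "form_wedge u (contract \<theta> \<zeta>) = - form_wedge \<zeta> (contract \<theta> u)"
      using form_wedge_contract[OF \<theta>(1) \<zeta>_forms] by simp
    ultimately have "delbar A (form_wedge u (contract \<theta> \<zeta>)) = 0"
      using delbar_minus[OF form_wedge_forms[OF \<zeta>_forms f]] by simp
    then show "form_wedge u (contract \<theta> \<zeta>) \<in> delbar_exact A ?n 2"
      by (rule A_exact_imp_delbar_exact[OF _ ex])
  qed (use delbar_exact_subset_A_exact in blast)
  also have "\<dots> \<longleftrightarrow> contract \<theta> \<zeta> \<in> delbar_exact A 0 2"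
  proof (rule form_wedge_u_delbar_exact_iff)
    show "bideg 0 2 (contract \<theta> \<zeta> c z)" for c z
      unfolding contract_def
      using bideg_wedge[OF vforms_bideg[OF \<theta>(1)] bideg_interior[OF forms_bideg[OF \<zeta>_forms]]]
      by (intro bideg_sum) simp
    show "contract \<theta> \<zeta> c z = 0" if "c \<notin> A \<or> z \<notin> chart_image c" for c z
      using vforms_outside[OF \<theta>(1) that] by (simp add: contract_def)
  qed
  finally show ?thesis .
qed

text \<open>The Lefschetz map is well defined: by the Leibniz rule and \<open>\<partial>\<partial>bar \<omega> = 0\<close>,
  \<open>\<omega> \<and> \<partial>\<partial>bar \<beta> = \<partial>(\<omega> \<and> \<partial>bar \<beta>) + \<partial>bar (\<partial>\<omega> \<and> \<beta>)\<close>.\<close>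
lemma wedge_omega_BC_exact: "form_wedge \<omega> ` BC_exact A p q \<subseteq> A_exact A (p + 1) (q + 1)"
proof
  fix x assume "x \<in> form_wedge \<omega> ` BC_exact A p q"
  then obtain \<beta> where \<beta>: "\<beta> \<in> forms A (p - 1) (q - 1)" "x = form_wedge \<omega> (del A (delbar A \<beta>))"
    by (auto simp: BC_exact_def)
  have d\<beta>: "delbar A \<beta> \<in> forms A (p - 1) q" and d\<omega>: "del A \<omega> \<in> forms A 2 1"
    using delbar_forms[OF \<beta>(1)] del_forms[OF omega_forms] by simp_all
  have "delbar A (del A \<omega>) = 0"
    using del_delbar_anticommute[OF omega_forms] del_delbar_omega by simp
  then have "x = del A (form_wedge \<omega> (delbar A \<beta>)) + delbar A (form_wedge (del A \<omega>) \<beta>)"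
    unfolding \<beta>(2) del_form_wedge[OF omega_forms d\<beta>] delbar_form_wedge[OF d\<omega> \<beta>(1)]
    by (simp add: family_scale_minus_one)
  moreover have "form_wedge \<omega> (delbar A \<beta>) \<in> forms A (p + 1 - 1) (q + 1)"
    using form_wedge_forms[OF omega_forms d\<beta>] by (simp add: add.commute)
  moreover have "form_wedge (del A \<omega>) \<beta> \<in> forms A (p + 1) (q + 1 - 1)"
    using form_wedge_forms[OF d\<omega> \<beta>(1)] by (simp add: add.commute)
  ultimately show "x \<in> A_exact A (p + 1) (q + 1)"
    unfolding A_exact_def by blast
qed

lemma lefschetz_coset: "lefschetz A \<omega> p q (\<gamma> +o BC_exact A p q) = form_wedge \<omega> \<gamma> +o A_exact A (p + 1) (q + 1)"
  unfolding lefschetz_def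
  by (rule induced_map_coset[OF family_subspace_A_exact _ wedge_omega_BC_exact family_subspace_zero[OF family_subspace_BC_exact]])
    (simp add: family_linear_on_def form_wedge_add_right form_wedge_scale_right)

lemma lefschetz_zero_iff:
  "lefschetz A \<omega> (int CARD('n) - 1) 1 (\<gamma> +o BC_exact A (int CARD('n) - 1) 1) = 0 +o A_exact A (int CARD('n)) 2
     \<longleftrightarrow> form_wedge \<omega> \<gamma> \<in> A_exact A (int CARD('n)) 2"
  by (simp add: lefschetz_coset coset_eq_self_iff[OF family_subspace_A_exact])

lemma H_BC_prim_eq:
  "H_BC_prim A \<omega> = quotient_space {\<gamma> \<in> forms A (int CARD('n) - 1) 1. del A \<gamma> = 0 \<and> delbar A \<gamma> = 0
     \<and> form_wedge \<omega> \<gamma> \<in> A_exact A (int CARD('n)) 2} (BC_exact A (int CARD('n) - 1) 1)"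
proof -
  have "{C \<in> g ` Z. P C} = g ` {x \<in> Z. P (g x)}" for g :: "('a, 'n) form \<Rightarrow> ('a, 'n) form set" and Z P
    by blast
  then show ?thesis
    unfolding H_BC_prim_def H_BC_def quotient_space_def by (simp only: lefschetz_zero_iff mem_Collect_eq conj_assoc)
qed

lemma coset_vector_space_prim:
  "coset_vector_space (BC_exact A (int CARD('n) - 1) 1) (H_BC_prim A \<omega>)"
  unfolding H_BC_prim_eq
proof (rule coset_vector_space_quotient[OF family_subspace_BC_exact])
  show "family_subspace {\<gamma> \<in> forms A (int CARD('n) - 1) 1. del A \<gamma> = 0 \<and> delbar A \<gamma> = 0
     \<and> form_wedge \<omega> \<gamma> \<in> A_exact A (int CARD('n)) 2}"
    using family_subspace_d_closed[of "int CARD('n) - 1" 1] family_subspace_A_exact[of "int CARD('n)" 2]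
    by (simp add: family_subspace_def form_wedge_add_right form_wedge_scale_right)
qed

text \<open>The representatives of a class in \<^term>\<open>H_T A 1\<close> are again closed vector-valued forms, so the previous
  equivalence applies to each of them and to every \<open>\<zeta>\<close>; as both exist, the universally quantified condition is
  equivalent to a single instance.\<close>
lemma H_T_polarised_eq: "H_T_polarised A \<omega> = {C \<in> H_T A 1. T_tilde A u C \<in> H_BC_prim A \<omega>}"
proof -
  have iff: "contract \<theta> \<zeta> +o delbar_exact A 0 2 = 0 +o delbar_exact A 0 2 \<longleftrightarrow> T_tilde A u C \<in> H_BC_prim A \<omega>"
    if C: "C \<in> H_T A 1" and \<theta>C: "\<theta> \<in> C" and \<zeta>: "\<zeta> \<in> SKT_delbar_class A \<omega>" for C \<theta> \<zeta>
  proof -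
    obtain \<theta>0 where \<theta>0: "\<theta>0 \<in> {\<theta> \<in> vforms A 0 1. vdelbar A \<theta> = 0}" "C = \<theta>0 +o T_exact A 1"
      using C by (auto simp: H_T_def quotient_space_def)
    have d: "\<theta> - \<theta>0 \<in> T_exact A 1"
      using \<theta>C \<theta>0(2) by (simp add: set_minus_plus)
    then have "\<theta>0 + (\<theta> - \<theta>0) \<in> {\<theta> \<in> vforms A 0 1. vdelbar A \<theta> = 0}"
      using family_subspace_add[OF family_subspace_vdelbar_closed \<theta>0(1)] T_exact_closed by blast
    then have \<theta>: "\<theta> \<in> vforms A 0 1" "vdelbar A \<theta> = 0"
      by auto
    have C_eq: "C = \<theta> +o T_exact A 1"
      using d by (simp add: \<theta>0(2) coset_eq_iff[OF family_subspace_T_exact]) (metis family_subspace_T_exact family_subspace_minus minus_diff_eq)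
    obtain \<gamma> \<eta> where \<gamma>: "\<gamma> \<in> forms A (int CARD('n) - 1) 1" "del A \<gamma> = 0" "delbar A \<gamma> = 0"
      and \<eta>: "\<eta> \<in> forms A (int CARD('n) - 1) 0" "\<gamma> = contract \<theta> u + delbar A \<eta>"
      and T: "T_tilde A u (\<theta> +o T_exact A 1) = \<gamma> +o BC_exact A (int CARD('n) - 1) 1"
      by (rule T_tilde_coset[OF \<theta>])
    have "T_tilde A u C \<in> H_BC_prim A \<omega> \<longleftrightarrow> form_wedge \<omega> \<gamma> \<in> A_exact A (int CARD('n)) 2"
    proof -
      have "\<gamma> +o BC_exact A (int CARD('n) - 1) 1 \<in> H_BC A (int CARD('n) - 1) 1"
        using \<gamma> by (auto simp: H_BC_def quotient_space_def)
      then show ?thesis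
        unfolding C_eq T H_BC_prim_def mem_Collect_eq lefschetz_zero_iff by blast
    qed
    then show ?thesis
      unfolding coset_eq_zero_iff[OF family_subspace_delbar_exact] wedge_omega_exact_iff[OF \<theta> \<gamma> \<eta> \<zeta>] by blast
  qed
  obtain \<zeta> where \<zeta>: "\<zeta> \<in> SKT_delbar_class A \<omega>"
    using SKT_delbar_class_nonempty by blast
  have "\<exists>\<theta>. \<theta> \<in> C" if "C \<in> H_T A 1" for C
  proof -
    obtain \<theta> where "C = \<theta> +o T_exact A 1"
      using \<open>C \<in> H_T A 1\<close> by (auto simp: H_T_def quotient_space_def)
    then show ?thesis
      using set_plus_intro2[OF family_subspace_zero[OF family_subspace_T_exact[of 1]], of \<theta>] by blast
  qed
  with iff \<zeta> show ?thesis
    unfolding H_T_polarised_def by blast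
qed

lemma T_tilde_polarised_iso:
  "linear_isomorphism (T_exact A 1) (H_T_polarised A \<omega>)
     (BC_exact A (int CARD('n) - 1) 1) (H_BC_prim A \<omega>) (T_tilde A u)"
  unfolding H_T_polarised_eq
  by (rule linear_isomorphism_restrict[OF family_subspace_T_exact family_subspace_BC_exact T_tilde_iso coset_vector_space_prim])
    (auto simp: H_BC_prim_def)

end

theorem theorem7:
  fixes X :: "'a topology"
    and A :: "('a, 'n::{finite,linorder}) chart set"
    and u \<omega> :: "('a, 'n) form"
  assumes "complex_manifold X A"
    and "compact_space X"
    and "ddbar_manifold A"
    and "nonvanishing_holomorphic_volume_form A u"
    and "SKT_metric A \<omega>"
  shows "linear_isomorphism (T_exact A 1) (H_T A 1)
           (BC_exact A (int CARD('n) - 1) 1) (H_BC A (int CARD('n) - 1) 1) (T_tilde A u) \<and>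
         linear_isomorphism (T_exact A 1) (H_T_polarised A \<omega>)
           (BC_exact A (int CARD('n) - 1) 1) (H_BC_prim A \<omega>) (T_tilde A u)"
proof -
  interpret skt_atlas X A u \<omega>
    by unfold_locales (rule assms)+
  show ?thesis
    using T_tilde_iso T_tilde_polarised_iso by blast
qed

end
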